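(* Let $L:\mathbb{R}^d\to\mathbb{R}$ be a continuous function attaining its global minimum at a unique point, with $L_m:=\inf L>0$. Let $\beta,\lambda,\sigma,\gamma>0$, put $t_k:=k\gamma$ and $I_k:=[t_{k-1},t_k)$ for $k\ge1$, and let $X=X(t)$, $t\ge0$, be the continuous process solving the semi-discrete model $$dX=-\lambda(X-\bar x_k^* )\,dt+\sigma\sum_{i=1}^d(X-\bar x_k^* )_i\,dW_i\,\vec e_i,\qquad t\in I_k,\ k\ge1,$$ where $$\bar x_k^*=\frac{\int_{\mathbb{R}^d}x\,e^{-\beta L(x)}\,\rho(dx,t_{k-1})}{\int_{\mathbb{R}^d}e^{-\beta L(x)}\,\rho(dx,t_{k-1})}$$ and $\rho(\cdot,t)$ denotes the law of $X(t)$. Put $m(t):=\mathbb{E}X(t)$, $V(t):=\mathbb{E}|X(t)-\mathbb{E}X(t)|^2$ and $M_L(t):=\mathbb{E}e^{-\beta L(X(t))}$. If the sequence $\{\bar x_k^*\}_{k\ge1}$ is bounded and $$2\lambda>\sigma^2,$$ then $$M_L^*:=\inf_kM_L(t_k)>0 .$$ Moreover, if the step size $\gamma$ also satisfies $$e^{(-2\lambda+\sigma^2)\gamma}+\frac{e^{-\beta L_m}}{M_L^*}\Big(e^{(-2\lambda+\sigma^2)\gamma}-e^{-2\lambda\gamma}\Big)<1,$$ then there is $\bar m\in\mathbb{R}^d$ such that $m(t_k)\to\bar m$ and $V(t_k)\to0$ as $k\to\infty$. Consequently, $\bar x_k^*\to\bar m$ as $k\to\infty$, and the law of $X(t)$ converges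 weakly, as $t\to\infty$, to the Dirac measure $\delta(x-\bar m)$ (i.e. in the dual of $C_b(\mathbb{R}^d)$).
   Context: $W_1,\dots,W_d$ are independent standard one-dimensional Brownian motions, independent of $X(0)$; $\vec e_i$ is the $i$-th standard basis vector of $\mathbb{R}^d$; $(v)_i$ is the $i$-th component of a vector $v$; $|\cdot|$ is the Euclidean norm. The equation is understood in the It\^o sense; on each interval $I_k$ the vector $\bar x_k^*$ is a deterministic constant computed from the law of $X(t_{k-1})$. The initial datum $X(0)$ has finite second moment. $C_b(\mathbb{R}^d)$ is the space of bounded continuous functions on $\mathbb{R}^d$ with the supremum norm; weak convergence to $\delta(x-\bar m)$ means $\mathbb{E}\varphi(X(t))\to\varphi(\bar m)$ for every $\varphi\in C_b(\mathbb{R}^d)$. *)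

theory Defs
  imports "HOL-Probability.Probability"
begin

text \<open>Processes are functions of time and outcome; only times \<open>t \<ge> 0\<close> matter.\<close>

definition standard_brownian_motion :: "'a measure \<Rightarrow> (real \<Rightarrow> 'a \<Rightarrow> real) \<Rightarrow> bool" where
  "standard_brownian_motion M B \<longleftrightarrow>
     (\<forall>t\<ge>0. B t \<in> borel_measurable M) \<and>
     (AE \<omega> in M. B 0 \<omega> = 0) \<and>
     (AE \<omega> in M. continuous_on {0..} (\<lambda>t. B t \<omega>)) \<and>
     (\<forall>s t. 0 \<le> s \<and> s < t \<longrightarrow>
        distributed M lborel (\<lambda>\<omega>. B t \<omega> - B s \<omega>) (normal_density 0 (sqrt (t - s)))) \<and>
     (\<forall>(n::nat) \<tau>. 0 \<le> \<tau> 0 \<and> mono \<tau> \<longrightarrow>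
        prob_space.indep_vars M (\<lambda>_. borel) (\<lambda>j \<omega>. B (\<tau> (Suc j)) \<omega> - B (\<tau> j) \<omega>) {..<n})"

text \<open>
  A filtration to which the Brownian motions are adapted and whose past is independent of their
  future increments. When the \<open>W i\<close> are jointly independent of \<open>X 0\<close>, the (augmented) filtration
  generated by \<open>X 0\<close> and \<open>W\<close> is of this kind. The filtration is indexed by all reals only because
  the library's locale is; the values at negative times are irrelevant.
\<close>

definition brownian_filtration ::
  "'a measure \<Rightarrow> (real \<Rightarrow> 'a measure) \<Rightarrow> ('d::finite \<Rightarrow> real \<Rightarrow> 'a \<Rightarrow> real) \<Rightarrow> bool" where
  "brownian_filtration M F W \<longleftrightarrow>
     filtration (space M) F \<and>
     (\<forall>t. subalgebra M (F t)) \<and>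
     (\<forall>i. \<forall>t\<ge>0. W i t \<in> borel_measurable (F t)) \<and>
     (\<forall>s t. 0 \<le> s \<and> s \<le> t \<longrightarrow>
        prob_space.indep_set M (sets (F s))
          (sets (vimage_algebra (space M) (\<lambda>\<omega>. (\<chi> i. W i t \<omega> - W i s \<omega>) :: real ^ 'd) borel)))"

subsection \<open>The Ito integral\<close>

text \<open>
  A simple process on \<open>[a, b]\<close> is given by a number \<open>n\<close> of steps, times \<open>\<tau> 0 \<le> \<dots> \<le> \<tau> n\<close> in
  \<open>[a, b]\<close>, and bounded heights \<open>\<xi> j\<close> measurable at time \<open>\<tau> j\<close>.
\<close>

definition simple_data ::
  "'a measure \<Rightarrow> (real \<Rightarrow> 'a measure) \<Rightarrow> real \<Rightarrow> real \<Rightarrow> nat \<Rightarrow> (nat \<Rightarrow> real) \<Rightarrow> (nat \<Rightarrow> 'a \<Rightarrow> real) \<Rightarrow> bool"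
  where
  "simple_data M F a b n \<tau> \<xi> \<longleftrightarrow>
     a \<le> \<tau> 0 \<and> (\<forall>j<n. \<tau> j \<le> \<tau> (Suc j)) \<and> \<tau> n \<le> b \<and>
     (\<forall>j<n. \<xi> j \<in> borel_measurable (F (\<tau> j)) \<and> (\<exists>C. \<forall>\<omega>\<in>space M. \<bar>\<xi> j \<omega>\<bar> \<le> C))"

definition simple_process ::
  "nat \<Rightarrow> (nat \<Rightarrow> real) \<Rightarrow> (nat \<Rightarrow> 'a \<Rightarrow> real) \<Rightarrow> real \<Rightarrow> 'a \<Rightarrow> real" where
  "simple_process n \<tau> \<xi> s \<omega> = (\<Sum>j<n. \<xi> j \<omega> * indicator {\<tau> j<..\<tau> (Suc j)} s)"

definition simple_ito_integral ::
  "(real \<Rightarrow> 'a \<Rightarrow> real) \<Rightarrow> nat \<Rightarrow> (nat \<Rightarrow> real) \<Rightarrow> (nat \<Rightarrow> 'a \<Rightarrow> real) \<Rightarrow> 'a \<Rightarrow> real" where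
  "simple_ito_integral B n \<tau> \<xi> \<omega> = (\<Sum>j<n. \<xi> j \<omega> * (B (\<tau> (Suc j)) \<omega> - B (\<tau> j) \<omega>))"

definition tends_to_0_in_prob :: "'a measure \<Rightarrow> (nat \<Rightarrow> 'a \<Rightarrow> ennreal) \<Rightarrow> bool" where
  "tends_to_0_in_prob M Z \<longleftrightarrow>
     (\<forall>\<epsilon>>0. (\<lambda>p. measure M {\<omega> \<in> space M. \<epsilon> < Z p \<omega>}) \<longlonglongrightarrow> 0)"

definition progressively_measurable ::
  "(real \<Rightarrow> 'a measure) \<Rightarrow> real \<Rightarrow> real \<Rightarrow> (real \<Rightarrow> 'a \<Rightarrow> real) \<Rightarrow> bool" where
  "progressively_measurable F a b H \<longleftrightarrow>
     (\<forall>u\<in>{a..b}. (\<lambda>(s, \<omega>). H s \<omega>) \<in> borel_measurable (restrict_space borel {a..u} \<Otimes>\<^sub>M F u))"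

text \<open>
  \<open>has_ito_integral M F B H a b J\<close>: the random variable \<open>J\<close> is (a version of) the Ito integral of
  \<open>H\<close> against \<open>B\<close> over \<open>[a, b]\<close>, for progressively measurable \<open>H\<close> with
  \<open>\<integral> H\<^sup>2 ds < \<infinity>\<close> almost surely. No moment condition is imposed on \<open>H\<close>.
\<close>

definition has_ito_integral ::
  "'a measure \<Rightarrow> (real \<Rightarrow> 'a measure) \<Rightarrow> (real \<Rightarrow> 'a \<Rightarrow> real) \<Rightarrow> (real \<Rightarrow> 'a \<Rightarrow> real)
     \<Rightarrow> real \<Rightarrow> real \<Rightarrow> ('a \<Rightarrow> real) \<Rightarrow> bool" where
  "has_ito_integral M F B H a b J \<longleftrightarrow>
     progressively_measurable F a b H \<and>
     (AE \<omega> in M. (\<integral>\<^sup>+s\<in>{a..b}. ennreal ((H s \<omega>)\<^sup>2) \<partial>lborel) < \<infinity>) \<and>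
     J \<in> borel_measurable M \<and>
     (\<exists>n \<tau> \<xi>.
        (\<forall>p. simple_data M F a b (n p) (\<tau> p) (\<xi> p)) \<and>
        tends_to_0_in_prob M (\<lambda>p \<omega>. \<integral>\<^sup>+s\<in>{a..b}.
           ennreal ((simple_process (n p) (\<tau> p) (\<xi> p) s \<omega> - H s \<omega>)\<^sup>2) \<partial>lborel) \<and>
        tends_to_0_in_prob M (\<lambda>p \<omega>.
           ennreal \<bar>simple_ito_integral B (n p) (\<tau> p) (\<xi> p) \<omega> - J \<omega>\<bar>))"

subsection \<open>The semi-discrete model\<close>

definition grid :: "real \<Rightarrow> nat \<Rightarrow> real" where
  "grid \<gamma> k = real k * \<gamma>"

definition weighted_mean ::
  "real \<Rightarrow> (real ^ 'd::finite \<Rightarrow> real) \<Rightarrow> (real ^ 'd) measure \<Rightarrow> real ^ 'd" where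
  "weighted_mean \<beta> L \<rho> =
     (\<integral>x. exp (- \<beta> * L x) *\<^sub>R x \<partial>\<rho>) /\<^sub>R (\<integral>x. exp (- \<beta> * L x) \<partial>\<rho>)"

text \<open>\<open>consensus_point \<dots> k\<close> is only used for \<open>k \<ge> 1\<close>.\<close>

definition consensus_point ::
  "'a measure \<Rightarrow> real \<Rightarrow> real \<Rightarrow> (real ^ 'd::finite \<Rightarrow> real) \<Rightarrow> (real \<Rightarrow> 'a \<Rightarrow> real ^ 'd) \<Rightarrow> nat \<Rightarrow> real ^ 'd"
  where
  "consensus_point M \<beta> \<gamma> L X k = weighted_mean \<beta> L (distr M borel (X (grid \<gamma> (k - 1))))"

definition semi_discrete_solution ::
  "'a measure \<Rightarrow> (real \<Rightarrow> 'a measure) \<Rightarrow> ('d::finite \<Rightarrow> real \<Rightarrow> 'a \<Rightarrow> real) \<Rightarrow> real \<Rightarrow> real \<Rightarrow> real \<Rightarrow> real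
     \<Rightarrow> (real ^ 'd \<Rightarrow> real) \<Rightarrow> (real \<Rightarrow> 'a \<Rightarrow> real ^ 'd) \<Rightarrow> bool" where
  "semi_discrete_solution M F W \<beta> lam \<sigma> \<gamma> L X \<longleftrightarrow>
     (AE \<omega> in M. continuous_on {0..} (\<lambda>t. X t \<omega>)) \<and>
     (\<forall>t\<ge>0. X t \<in> borel_measurable (F t)) \<and>
     (\<forall>k\<ge>1. \<forall>t\<in>{grid \<gamma> (k - 1)..<grid \<gamma> k}.
        \<exists>J :: 'd \<Rightarrow> 'a \<Rightarrow> real.
          (\<forall>i. has_ito_integral M F (W i) (\<lambda>s \<omega>. (X s \<omega> - consensus_point M \<beta> \<gamma> L X k) $ i)
                 (grid \<gamma> (k - 1)) t (J i)) \<and>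
          (AE \<omega> in M. X t \<omega> = X (grid \<gamma> (k - 1)) \<omega>
             - lam *\<^sub>R (LINT s:{grid \<gamma> (k - 1)..t}|lborel. X s \<omega> - consensus_point M \<beta> \<gamma> L X k)
             + \<sigma> *\<^sub>R (\<Sum>i\<in>UNIV. J i \<omega> *\<^sub>R axis i 1)))"

definition mean_at :: "'a measure \<Rightarrow> (real \<Rightarrow> 'a \<Rightarrow> real ^ 'd::finite) \<Rightarrow> real \<Rightarrow> real ^ 'd" where
  "mean_at M X t = (\<integral>\<omega>. X t \<omega> \<partial>M)"

definition variance_at :: "'a measure \<Rightarrow> (real \<Rightarrow> 'a \<Rightarrow> real ^ 'd::finite) \<Rightarrow> real \<Rightarrow> real" where
  "variance_at M X t = (\<integral>\<omega>. (norm (X t \<omega> - mean_at M X t))\<^sup>2 \<partial>M)"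

definition weight_at ::
  "'a measure \<Rightarrow> real \<Rightarrow> (real ^ 'd::finite \<Rightarrow> real) \<Rightarrow> (real \<Rightarrow> 'a \<Rightarrow> real ^ 'd) \<Rightarrow> real \<Rightarrow> real" where
  "weight_at M \<beta> L X t = (\<integral>\<omega>. exp (- \<beta> * L (X t \<omega>)) \<partial>M)"

definition weight_inf ::
  "'a measure \<Rightarrow> real \<Rightarrow> real \<Rightarrow> (real ^ 'd::finite \<Rightarrow> real) \<Rightarrow> (real \<Rightarrow> 'a \<Rightarrow> real ^ 'd) \<Rightarrow> real" where
  "weight_inf M \<beta> \<gamma> L X = (INF k. weight_at M \<beta> L X (grid \<gamma> k))"

end

theory Submission
  imports Defs
begin

text \<open>
  Componentwise, \<open>Y = (X - x\<^sub>c)\<^sub>i\<close> solves the linear equation \<open>dY = - \<lambda> Y dt + \<sigma> Y dW\<close> on each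
  interval, so its mean decays like \<open>exp (- \<lambda> t)\<close> and its second moment at most like
  \<open>exp ((- 2 \<lambda> + \<sigma>\<^sup>2) t)\<close>. The Ito formula is not needed for this: a simple process truncated once
  its energy \<open>\<integral> \<xi>\<^sup>2 ds\<close> exceeds \<open>N\<close> is again simple, and the isometry for such processes gives
  \<open>E (J\<^sup>2; Q < N) \<le> E (min N Q)\<close> for the integral \<open>J\<close> of a process with energy \<open>Q\<close>. A Gronwall
  argument on \<open>E (Y\<^sup>2; Q < N)\<close> then yields finite second moments, and the sharp rates follow from
  Euler steps with error \<open>O (h powr (3/2))\<close>.

  Since \<open>x\<^sub>c\<close> is bounded and \<open>2 \<lambda> > \<sigma>\<^sup>2\<close>, the second moments stay bounded along the grid, so a fixed
  part of the mass stays in a fixed ball and the weights are bounded below. Jensen's inequality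
  bounds \<open>|m - x\<^sub>c|\<^sup>2\<close> by a multiple of the variance \<open>V\<close>; hence \<open>V\<close> contracts geometrically and the
  increments of \<open>m\<close> are summable.
\<close>

subsection \<open>Simple processes\<close>

text \<open>The Ito integral is given only as a limit in probability, for integrands without
  moments, so the isometry and the martingale property are out of reach until the second moments of
  the solution are known to be finite. Hence the two passes over each interval: a crude bound, then
  the sharp rates.

  The exponent 3/2 arises because an increment of \<open>Y\<close> over time \<open>h\<close> has L2
  size \<open>sqrt h\<close>, so freezing the drift at the left endpoint costs
  \<open>h * sqrt h\<close>. Over \<open>T / h\<close> steps this adds up to a multiple of
  \<open>sqrt h\<close>, which vanishes with \<open>h\<close>.

  The two rates enter with opposite signs. In
  \<open>V = E|X - x\<^sub>c|\<^sup>2 - |m - x\<^sub>c|\<^sup>2\<close> an upper bound suffices for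
  the first term, while the mean is subtracted, and its decay is computed exactly. With
  \<open>\<kappa> = - 2 \<lambda> + \<sigma>\<^sup>2\<close> one step leaves \<open>exp (\<kappa>
  \<gamma>) V + (exp (\<kappa> \<gamma>) - exp (- 2 \<lambda> \<gamma>)) |m -
  x\<^sub>c|\<^sup>2\<close>. Bounding the last square by its multiple of \<open>V\<close> yields
  the left side of the step size condition, times \<open>V\<close>.\<close>

abbreviation nn_square :: "'b measure \<Rightarrow> ('b \<Rightarrow> real) \<Rightarrow> ennreal" where
  "nn_square N f \<equiv> \<integral>\<^sup>+x. ennreal ((f x)\<^sup>2) \<partial>N"

abbreviation mean_square :: "'b measure \<Rightarrow> ('b \<Rightarrow> real) \<Rightarrow> real" where
  "mean_square N f \<equiv> \<integral>x. (f x)\<^sup>2 \<partial>N"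

abbreviation square_integrable :: "'b measure \<Rightarrow> ('b \<Rightarrow> real) \<Rightarrow> bool" where
  "square_integrable N f \<equiv> integrable N (\<lambda>x. (f x)\<^sup>2)"

text \<open>The time integral of the squared simple process as a finite sum, which makes visible the
  heights it depends on and hence the time at which it is known.\<close>

definition energy :: "nat \<Rightarrow> (nat \<Rightarrow> real) \<Rightarrow> (nat \<Rightarrow> 'a \<Rightarrow> real) \<Rightarrow> 'a \<Rightarrow> real" where
  "energy n \<tau> \<xi> \<omega> = (\<Sum>j<n. (\<xi> j \<omega>)\<^sup>2 * (\<tau> (Suc j) - \<tau> j))"

text \<open>Increments are independent of all of \<open>F s\<close>, not merely of earlier
  increments of \<open>B\<close>: the heights of a simple process may also depend on the initial
  datum and on the other Brownian motions.\<close>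

locale brownian = prob_space M for M :: "'a measure" +
  fixes F :: "real \<Rightarrow> 'a measure" and B :: "real \<Rightarrow> 'a \<Rightarrow> real"
  assumes subalg: "\<And>t. subalgebra M (F t)"
    and F_mono: "\<And>s t. s \<le> t \<Longrightarrow> sets (F s) \<subseteq> sets (F t)"
    and adapted: "\<And>t. 0 \<le> t \<Longrightarrow> B t \<in> borel_measurable (F t)"
    and incr_indep: "\<And>s t. 0 \<le> s \<Longrightarrow> s \<le> t \<Longrightarrow>
      indep_set (sets (F s)) (sets (vimage_algebra (space M) (\<lambda>\<omega>. B t \<omega> - B s \<omega>) borel))"
    and incr_normal: "\<And>s t. 0 \<le> s \<Longrightarrow> s < t \<Longrightarrow>
      distributed M lborel (\<lambda>\<omega>. B t \<omega> - B s \<omega>) (normal_density 0 (sqrt (t - s)))"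
begin

lemma space_F: "space (F t) = space M"
  using subalg[of t] by (simp add: subalgebra_def)

lemma measurable_F_mono:
  assumes "f \<in> borel_measurable (F s)" "s \<le> t"
  shows "f \<in> borel_measurable (F t)"
  using assms F_mono[of s t] space_F unfolding measurable_def by auto

lemma measurable_from_F: "f \<in> borel_measurable (F s) \<Longrightarrow> f \<in> borel_measurable M"
  using measurable_from_subalg[OF subalg] .

lemma B_measurable [measurable]: "0 \<le> t \<Longrightarrow> B t \<in> borel_measurable M"
  using adapted measurable_from_F by blast

lemma increment_moments:
  assumes "0 \<le> s" "s \<le> t"
  shows "integrable M (\<lambda>\<omega>. B t \<omega> - B s \<omega>)" "(\<integral>\<omega>. B t \<omega> - B s \<omega> \<partial>M) = 0"
    "square_integrable M (\<lambda>\<omega>. B t \<omega> - B s \<omega>)" "mean_square M (\<lambda>\<omega>. B t \<omega> - B s \<omega>) = t - s"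
proof -
  have *: "integrable M (\<lambda>\<omega>. B t \<omega> - B s \<omega>) \<and> (\<integral>\<omega>. B t \<omega> - B s \<omega> \<partial>M) = 0 \<and>
    square_integrable M (\<lambda>\<omega>. B t \<omega> - B s \<omega>) \<and> (mean_square M (\<lambda>\<omega>. B t \<omega> - B s \<omega>)) = t - s"
  \<comment> \<open>A normal density needs positive deviation, so the degenerate case is separated;
    there every claim is about the constant 0.\<close>
  proof (cases "s = t")
    case False
    with assms have st: "s < t" "0 < sqrt (t - s)" by auto
    note D = incr_normal[OF assms(1) st(1)]
    have e: "expectation (\<lambda>\<omega>. B t \<omega> - B s \<omega>) = 0"
      using normal_distributed_expectation[OF st(2) D] .
    have v: "mean_square M (\<lambda>\<omega>. B t \<omega> - B s \<omega>) = t - s"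
      using normal_distributed_variance[OF st(2) D] e st by simp
    have i1: "integrable M (\<lambda>\<omega>. B t \<omega> - B s \<omega>)"
      using distributed_integrable[OF D, of "\<lambda>x. x"] integrable_normal_moment_nz_1[OF st(2), of 0] by simp
    have i2: "square_integrable M (\<lambda>\<omega>. B t \<omega> - B s \<omega>)"
      using distributed_integrable[OF D, of "\<lambda>x. x\<^sup>2"] integrable_normal_moment[OF st(2), of 0 2] by simp
    show ?thesis using e v i1 i2 by simp
  qed auto
  then show "integrable M (\<lambda>\<omega>. B t \<omega> - B s \<omega>)" "(\<integral>\<omega>. B t \<omega> - B s \<omega> \<partial>M) = 0"
    "square_integrable M (\<lambda>\<omega>. B t \<omega> - B s \<omega>)" "mean_square M (\<lambda>\<omega>. B t \<omega> - B s \<omega>) = t - s"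
    by auto
qed

lemma increment_indep_var:
  assumes st: "0 \<le> s" "s \<le> t" and G: "G \<in> borel_measurable (F s)"
  shows "indep_var borel G borel (\<lambda>\<omega>. B t \<omega> - B s \<omega>)"
proof -
  have G': "G \<in> borel_measurable M" using G by (rule measurable_from_F)
  have sub: "sigma_sets (space M) {G -` A \<inter> space M |A. A \<in> sets borel} \<subseteq> sets (F s)"
    using measurable_sets[OF G] space_F[of s] sets.sigma_sets_subset[of _ "F s"]
    by (smt (verit, best) mem_Collect_eq subsetI)
  show ?thesis
    unfolding indep_var_eq sets_vimage_algebra[symmetric]
  proof (intro conjI)
    show "random_variable borel (\<lambda>\<omega>. B t \<omega> - B s \<omega>)" using st by auto
    show "indep_set (sets (vimage_algebra (space M) G borel))
      (sets (vimage_algebra (space M) (\<lambda>\<omega>. B t \<omega> - B s \<omega>) borel))"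
      using incr_indep[OF st] sub unfolding indep_sets2_eq sets_vimage_algebra by blast
  qed fact
qed

text \<open>With \<open>G = \<xi> * I\<close> the first pair kills the cross terms of the isometry;
  with \<open>G = \<xi>\<^sup>2\<close> the second pair produces the energy.\<close>

lemma increment_product:
  assumes st: "0 \<le> s" "s \<le> t" and G: "G \<in> borel_measurable (F s)" "integrable M G"
  shows "integrable M (\<lambda>\<omega>. G \<omega> * (B t \<omega> - B s \<omega>))" "(\<integral>\<omega>. G \<omega> * (B t \<omega> - B s \<omega>) \<partial>M) = 0"
    "integrable M (\<lambda>\<omega>. G \<omega> * (B t \<omega> - B s \<omega>)\<^sup>2)"
    "(\<integral>\<omega>. G \<omega> * (B t \<omega> - B s \<omega>)\<^sup>2 \<partial>M) = (\<integral>\<omega>. G \<omega> \<partial>M) * (t - s)"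
proof -
  note iv = increment_indep_var[OF st G(1)]
  have iv2: "indep_var borel G borel (\<lambda>\<omega>. (B t \<omega> - B s \<omega>)\<^sup>2)"
    using indep_var_compose[OF iv, of "\<lambda>x. x" borel "\<lambda>x. x\<^sup>2" borel] by (simp add: comp_def)
  note m = increment_moments[OF st]
  show "integrable M (\<lambda>\<omega>. G \<omega> * (B t \<omega> - B s \<omega>))" "(\<integral>\<omega>. G \<omega> * (B t \<omega> - B s \<omega>) \<partial>M) = 0"
    using indep_var_integrable[OF iv G(2) m(1)] indep_var_lebesgue_integral[OF iv G(2) m(1)] m(2) by auto
  show "integrable M (\<lambda>\<omega>. G \<omega> * (B t \<omega> - B s \<omega>)\<^sup>2)"
    "(\<integral>\<omega>. G \<omega> * (B t \<omega> - B s \<omega>)\<^sup>2 \<partial>M) = (\<integral>\<omega>. G \<omega> \<partial>M) * (t - s)"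
    using indep_var_integrable[OF iv2 G(2) m(3)] indep_var_lebesgue_integral[OF iv2 G(2) m(3)] m(4) by auto
qed

end

section \<open>Energy and isometry of simple integrals\<close>

lemma simple_dataD:
  assumes "simple_data M F a b n \<tau> \<xi>"
  shows "\<And>i j. i \<le> j \<Longrightarrow> j \<le> n \<Longrightarrow> \<tau> i \<le> \<tau> j"
    "\<And>j. j \<le> n \<Longrightarrow> a \<le> \<tau> j" "\<And>j. j \<le> n \<Longrightarrow> \<tau> j \<le> b"
    "\<And>j. j < n \<Longrightarrow> \<xi> j \<in> borel_measurable (F (\<tau> j))"
    "\<And>j. j < n \<Longrightarrow> \<exists>C. \<forall>\<omega>\<in>space M. \<bar>\<xi> j \<omega>\<bar> \<le> C"
proof -
  show mono: "\<tau> i \<le> \<tau> j" if "i \<le> j" "j \<le> n" for i j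
    using that
  proof (induction j rule: dec_induct)
    case (step k)
    then have "\<tau> k \<le> \<tau> (Suc k)" using assms by (auto simp: simple_data_def)
    with step show ?case by auto
  qed simp
  show "a \<le> \<tau> j" if "j \<le> n" for j
    using mono[of 0 j] that assms by (auto simp: simple_data_def intro: order_trans)
  show "\<tau> j \<le> b" if "j \<le> n" for j
    using mono[of j n] that assms by (auto simp: simple_data_def intro: order_trans)
qed (use assms in \<open>auto simp: simple_data_def\<close>)

lemma simple_process_after:
  assumes "\<And>i. i \<le> n \<Longrightarrow> \<tau> i \<le> \<tau> n" "\<tau> n < s"
  shows "simple_process n \<tau> \<xi> s \<omega> = 0"
proof -
  have "s \<notin> {\<tau> j<..\<tau> (Suc j)}" if "j < n" for j
    using assms(1)[of "Suc j"] assms(2) that by auto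
  then show ?thesis by (auto simp: simple_process_def intro!: sum.neutral)
qed

text \<open>The half-open steps are disjoint, so no cross terms appear. In the induction the process
  built from the earlier steps already vanishes beyond \<open>\<tau> n\<close>, where the last step
  lives.\<close>

lemma simple_process_sq:
  assumes "\<And>j. j < n \<Longrightarrow> \<tau> j \<le> \<tau> (Suc j)"
  shows "(simple_process n \<tau> \<xi> s \<omega>)\<^sup>2 = (\<Sum>j<n. (\<xi> j \<omega>)\<^sup>2 * indicator {\<tau> j<..\<tau> (Suc j)} s)"
  using assms
proof (induction n)
  case (Suc n)
  have mono: "\<tau> i \<le> \<tau> n" if "i \<le> n" for i
    using that
  proof (induction rule: inc_induct)
    case (step k) with Suc.prems[of k] show ?case by auto
  qed simp
  have "simple_process n \<tau> \<xi> s \<omega> * indicator {\<tau> n<..\<tau> (Suc n)} s = 0"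
    using simple_process_after[of n \<tau> s \<xi> \<omega>, OF mono] by (auto simp: indicator_def)
  moreover have "simple_process (Suc n) \<tau> \<xi> s \<omega>
      = simple_process n \<tau> \<xi> s \<omega> + \<xi> n \<omega> * indicator {\<tau> n<..\<tau> (Suc n)} s"
    by (simp add: simple_process_def)
  ultimately have "(simple_process (Suc n) \<tau> \<xi> s \<omega>)\<^sup>2
      = (simple_process n \<tau> \<xi> s \<omega>)\<^sup>2 + (\<xi> n \<omega>)\<^sup>2 * indicator {\<tau> n<..\<tau> (Suc n)} s"
    by (auto simp: indicator_def power2_sum)
  with Suc show ?case by simp
qed (simp add: simple_process_def)

lemma simple_process_outside:
  assumes "simple_data M F a b n \<tau> \<xi>" "s \<notin> {a..b}"
  shows "simple_process n \<tau> \<xi> s \<omega> = 0"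
proof -
  have "s \<notin> {\<tau> j<..\<tau> (Suc j)}" if "j < n" for j
    using simple_dataD(2)[OF assms(1), of j] simple_dataD(3)[OF assms(1), of "Suc j"] that assms(2) by auto
  then show ?thesis by (auto simp: simple_process_def intro!: sum.neutral)
qed

lemma energy_eq_nn_integral:
  assumes "simple_data M F a b n \<tau> \<xi>"
  shows "nn_square lborel (\<lambda>s. simple_process n \<tau> \<xi> s \<omega>) = ennreal (energy n \<tau> \<xi> \<omega>)"
proof -
  have mono: "\<And>j. j < n \<Longrightarrow> \<tau> j \<le> \<tau> (Suc j)" using simple_dataD(1)[OF assms] by auto
  have "ennreal ((simple_process n \<tau> \<xi> s \<omega>)\<^sup>2)
      = (\<Sum>j<n. ennreal ((\<xi> j \<omega>)\<^sup>2) * indicator {\<tau> j<..\<tau> (Suc j)} s)" for s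
  proof -
    have "ennreal ((\<xi> j \<omega>)\<^sup>2) * indicator {\<tau> j<..\<tau> (Suc j)} s
        = ennreal ((\<xi> j \<omega>)\<^sup>2 * indicator {\<tau> j<..\<tau> (Suc j)} s)" for j
      by (simp add: indicator_def)
    then show ?thesis
      using simple_process_sq[of n \<tau> \<xi> s \<omega>, OF mono] by (simp add: sum_ennreal)
  qed
  then have "nn_square lborel (\<lambda>s. simple_process n \<tau> \<xi> s \<omega>)
      = (\<integral>\<^sup>+s. (\<Sum>j<n. ennreal ((\<xi> j \<omega>)\<^sup>2) * indicator {\<tau> j<..\<tau> (Suc j)} s) \<partial>lborel)" by simp
  also have "\<dots> = (\<Sum>j<n. ennreal ((\<xi> j \<omega>)\<^sup>2) * ennreal (\<tau> (Suc j) - \<tau> j))"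
    using mono by (subst nn_integral_sum) (auto simp: nn_integral_cmult)
  also have "\<dots> = (\<Sum>j<n. ennreal ((\<xi> j \<omega>)\<^sup>2 * (\<tau> (Suc j) - \<tau> j)))"
    using mono by (intro sum.cong) (auto simp: ennreal_mult)
  also have "\<dots> = ennreal (energy n \<tau> \<xi> \<omega>)"
    using mono by (subst sum_ennreal) (auto simp: energy_def)
  finally show ?thesis .
qed

lemma energy_nonneg: "(\<And>j. j < n \<Longrightarrow> \<tau> j \<le> \<tau> (Suc j)) \<Longrightarrow> 0 \<le> energy n \<tau> \<xi> \<omega>"
  unfolding energy_def by (intro sum_nonneg mult_nonneg_nonneg) auto

context brownian
begin

lemma simple_ito_adapted:
  assumes "simple_data M F a b n \<tau> \<xi>" "0 \<le> a"
  shows "simple_ito_integral B n \<tau> \<xi> \<in> borel_measurable (F (\<tau> n))"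
proof -
  note D = simple_dataD[OF assms(1)]
  have "(\<lambda>\<omega>. \<xi> j \<omega> * (B (\<tau> (Suc j)) \<omega> - B (\<tau> j) \<omega>)) \<in> borel_measurable (F (\<tau> n))" if "j < n" for j
  proof -
    have "0 \<le> \<tau> j" "0 \<le> \<tau> (Suc j)" "\<tau> j \<le> \<tau> n" "\<tau> (Suc j) \<le> \<tau> n"
      using D(1)[of j n] D(2)[of j] D(2)[of "Suc j"] D(1)[of "Suc j" n] that assms(2) by auto
    then show ?thesis
      using measurable_F_mono[OF D(4)[OF that]] measurable_F_mono[OF adapted]
      by (intro borel_measurable_times borel_measurable_diff) auto
  qed
  then show ?thesis
    unfolding simple_ito_integral_def[abs_def] by (intro borel_measurable_sum) auto
qed

lemma simple_height_measurable:
  "simple_data M F a b n \<tau> \<xi> \<Longrightarrow> j < n \<Longrightarrow> \<xi> j \<in> borel_measurable M"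
  using simple_dataD(4) measurable_from_F by blast

lemma simple_ito_measurable:
  "simple_data M F a b n \<tau> \<xi> \<Longrightarrow> 0 \<le> a \<Longrightarrow> simple_ito_integral B n \<tau> \<xi> \<in> borel_measurable M"
  using simple_ito_adapted measurable_from_F by blast

lemma energy_measurable:
  "simple_data M F a b n \<tau> \<xi> \<Longrightarrow> energy n \<tau> \<xi> \<in> borel_measurable M"
  unfolding energy_def[abs_def]
  by (intro borel_measurable_sum borel_measurable_times borel_measurable_power)
    (auto intro: simple_height_measurable)

lemma integrable_bounded_mult:
  assumes "integrable M f" "g \<in> borel_measurable M" "\<exists>C. \<forall>\<omega>\<in>space M. \<bar>g \<omega>\<bar> \<le> C"
  shows "integrable M (\<lambda>\<omega>. g \<omega> * f \<omega> :: real)"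
proof -
  obtain C where C: "\<forall>\<omega>\<in>space M. \<bar>g \<omega>\<bar> \<le> C" using assms(3) by auto
  show ?thesis
  proof (rule Bochner_Integration.integrable_bound[of M "\<lambda>\<omega>. C * f \<omega>"])
    show "AE x in M. norm (g x * f x) \<le> norm (C * f x)"
      using C by (intro AE_I2) (auto simp: abs_mult intro!: mult_right_mono intro: order_trans)
  qed (use assms in auto)
qed

text \<open>Induction on the number of steps: the partial integral and the last height are both
  known at \<open>\<tau> n\<close>, so the mixed term has mean 0 and the new square contributes its
  height squared times the step length. The integrability claims are carried along because the next
  mixed term needs them.\<close>

lemma simple_ito_isometry:
  assumes "simple_data M F a b n \<tau> \<xi>" "0 \<le> a"
  shows "square_integrable M (simple_ito_integral B n \<tau> \<xi>) \<and> integrable M (energy n \<tau> \<xi>) \<and>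
    (mean_square M (simple_ito_integral B n \<tau> \<xi>)) = (\<integral>\<omega>. energy n \<tau> \<xi> \<omega> \<partial>M)"
  using assms(1)
proof (induction n)
  case (Suc n)
  note D = simple_dataD[OF Suc.prems]
  have S: "simple_data M F a b n \<tau> \<xi>"
    using Suc.prems D(3)[of n] by (auto simp: simple_data_def)
  define I where "I = simple_ito_integral B n \<tau> \<xi>"
  define d where "d = (\<lambda>\<omega>. B (\<tau> (Suc n)) \<omega> - B (\<tau> n) \<omega>)"
  have t: "0 \<le> \<tau> n" "\<tau> n \<le> \<tau> (Suc n)" using D(2)[of n] assms(2) D(1)[of n "Suc n"] by auto
  have Im: "I \<in> borel_measurable (F (\<tau> n))" "I \<in> borel_measurable M"
    using simple_ito_adapted[OF S assms(2)] measurable_from_F by (auto simp: I_def)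
  have I2: "square_integrable M I" using Suc.IH[OF S] by (simp add: I_def)
  then have I1: "integrable M I" using square_integrable_imp_integrable[OF Im(2)] by auto
  have xm: "\<xi> n \<in> borel_measurable (F (\<tau> n))" "\<xi> n \<in> borel_measurable M"
    and xb: "\<exists>C. \<forall>\<omega>\<in>space M. \<bar>\<xi> n \<omega>\<bar> \<le> C"
    using D(4,5)[of n] measurable_from_F by auto
  have x1: "integrable M (\<xi> n)"
    using integrable_bounded_mult[of "\<lambda>_. 1", OF _ xm(2) xb] by simp
  have x2: "square_integrable M (\<xi> n)"
    using integrable_bounded_mult[OF x1 xm(2) xb] by (simp add: power2_eq_square)
  have xI: "integrable M (\<lambda>\<omega>. \<xi> n \<omega> * I \<omega>)" by (rule integrable_bounded_mult[OF I1 xm(2) xb])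
  have c: "integrable M (\<lambda>\<omega>. (\<xi> n \<omega> * I \<omega>) * d \<omega>)" "(\<integral>\<omega>. (\<xi> n \<omega> * I \<omega>) * d \<omega> \<partial>M) = 0"
    unfolding d_def using increment_product[OF t _ xI] xm Im by auto
  have q: "integrable M (\<lambda>\<omega>. (\<xi> n \<omega>)\<^sup>2 * (d \<omega>)\<^sup>2)"
     "(\<integral>\<omega>. (\<xi> n \<omega>)\<^sup>2 * (d \<omega>)\<^sup>2 \<partial>M) = mean_square M (\<xi> n) * (\<tau> (Suc n) - \<tau> n)"
    unfolding d_def using increment_product[OF t _ x2] xm by auto
  have eq: "(simple_ito_integral B (Suc n) \<tau> \<xi> \<omega>)\<^sup>2
      = (I \<omega>)\<^sup>2 + 2 * ((\<xi> n \<omega> * I \<omega>) * d \<omega>) + (\<xi> n \<omega>)\<^sup>2 * (d \<omega>)\<^sup>2" for \<omega>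
    by (simp add: simple_ito_integral_def I_def d_def power2_eq_square algebra_simps)
  have en: "energy (Suc n) \<tau> \<xi> = (\<lambda>\<omega>. energy n \<tau> \<xi> \<omega> + (\<xi> n \<omega>)\<^sup>2 * (\<tau> (Suc n) - \<tau> n))"
    by (auto simp: energy_def)
  have IH: "mean_square M I = (\<integral>\<omega>. energy n \<tau> \<xi> \<omega> \<partial>M)" "integrable M (energy n \<tau> \<xi>)"
    using Suc.IH[OF S] by (auto simp: I_def)
  show ?case
    unfolding eq en using I2 c q IH x2 by auto
qed (simp add: simple_ito_integral_def energy_def[abs_def])

text \<open>A factor known at time \<open>a\<close> can be absorbed into each height without
  spoiling its measurability at \<open>\<tau> j \<ge> a\<close>.\<close>

lemma simple_ito_mean:
  assumes S: "simple_data M F a b n \<tau> \<xi>" "0 \<le> a"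
    and G: "G \<in> borel_measurable (F a)" "\<exists>C. \<forall>\<omega>\<in>space M. \<bar>G \<omega>\<bar> \<le> C"
  shows "(\<integral>\<omega>. G \<omega> * simple_ito_integral B n \<tau> \<xi> \<omega> \<partial>M) = 0"
proof -
  note D = simple_dataD[OF S(1)]
  have "integrable M (\<lambda>\<omega>. (G \<omega> * \<xi> j \<omega>) * (B (\<tau> (Suc j)) \<omega> - B (\<tau> j) \<omega>)) \<and>
     (\<integral>\<omega>. (G \<omega> * \<xi> j \<omega>) * (B (\<tau> (Suc j)) \<omega> - B (\<tau> j) \<omega>) \<partial>M) = 0" if j: "j < n" for j
  proof -
    have t: "0 \<le> \<tau> j" "a \<le> \<tau> j" "\<tau> j \<le> \<tau> (Suc j)" using D(1,2) j assms(2) by (auto intro: order_trans)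
    have G': "G \<in> borel_measurable (F (\<tau> j))" using measurable_F_mono[OF G(1) t(2)] .
    have "integrable M (\<xi> j)"
      using integrable_bounded_mult[of "\<lambda>_. 1", OF _ simple_height_measurable[OF S(1) j] D(5)[OF j]] by simp
    then have "integrable M (\<lambda>\<omega>. G \<omega> * \<xi> j \<omega>)"
      by (rule integrable_bounded_mult[OF _ measurable_from_F[OF G(1)] G(2)])
    then show ?thesis
      using increment_product(1,2)[OF t(1,3), of "\<lambda>\<omega>. G \<omega> * \<xi> j \<omega>"] G' D(4)[OF j] by auto
  qed
  then show ?thesis
    by (simp add: simple_ito_integral_def sum_distrib_left mult.assoc[symmetric])
qed

end

section \<open>Truncating, refining, subtracting and splitting simple processes\<close>

lemma energy_mono:
  assumes "\<And>j. j < n \<Longrightarrow> \<tau> j \<le> \<tau> (Suc j)" "m \<le> n"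
  shows "energy m \<tau> \<xi> \<omega> \<le> energy n \<tau> \<xi> \<omega>"
  unfolding energy_def using assms by (intro sum_mono2 mult_nonneg_nonneg) auto

text \<open>The energy through step \<open>j\<close> is already known at its left endpoint, so switching off the steps at
  which it exceeds \<open>N\<close> preserves adaptedness.\<close>

lemma (in brownian) simple_truncate:
  assumes S: "simple_data M F a b n \<tau> \<xi>" and N: "0 \<le> N"
  obtains \<xi>' where "simple_data M F a b n \<tau> \<xi>'"
    "\<And>\<omega>. energy n \<tau> \<xi>' \<omega> \<le> min N (energy n \<tau> \<xi> \<omega>)"
    "\<And>j \<omega>. j < n \<Longrightarrow> energy n \<tau> \<xi> \<omega> \<le> N \<Longrightarrow> \<xi>' j \<omega> = \<xi> j \<omega>"
proof
  note D = simple_dataD[OF S]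
  have mono: "\<tau> j \<le> \<tau> (Suc j)" if "j < n" for j using D(1)[of j "Suc j"] that by auto
  \<comment> \<open>The index \<open>Suc j\<close> counts step \<open>j\<close> itself, so a step
    that would push the energy beyond \<open>N\<close> is already off and the level is never
    overshot. As the partial energies increase, all later steps are off as well.\<close>
  define \<xi>' where "\<xi>' = (\<lambda>j \<omega>. if energy (Suc j) \<tau> \<xi> \<omega> \<le> N then \<xi> j \<omega> else 0)"
  have em: "energy (Suc j) \<tau> \<xi> \<in> borel_measurable (F (\<tau> j))" if j: "j < n" for j
    unfolding energy_def[abs_def]
  proof (intro borel_measurable_sum borel_measurable_times borel_measurable_power borel_measurable_const)
    fix i assume "i \<in> {..<Suc j}"
    then show "\<xi> i \<in> borel_measurable (F (\<tau> j))"
      using measurable_F_mono[OF D(4)[of i] D(1)[of i j]] j by auto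
  qed
  show "simple_data M F a b n \<tau> \<xi>'"
    unfolding simple_data_def
  proof (intro conjI allI impI)
    fix j assume j: "j < n"
    have "Measurable.pred (F (\<tau> j)) (\<lambda>\<omega>. energy (Suc j) \<tau> \<xi> \<omega> \<le> N)"
      using em[OF j] by measurable
    then show "\<xi>' j \<in> borel_measurable (F (\<tau> j))"
      unfolding \<xi>'_def using D(4)[OF j] by measurable
    obtain C where "\<forall>\<omega>\<in>space M. \<bar>\<xi> j \<omega>\<bar> \<le> C" using D(5)[OF j] by auto
    then show "\<exists>C. \<forall>\<omega>\<in>space M. \<bar>\<xi>' j \<omega>\<bar> \<le> C"
      by (intro exI[of _ "max C 0"]) (auto simp: \<xi>'_def)
  qed (use D(2)[of 0] D(3)[of n] mono in auto)
  show same: "\<xi>' j \<omega> = \<xi> j \<omega>" if "j < n" "energy n \<tau> \<xi> \<omega> \<le> N" for j \<omega>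
    using energy_mono[of n \<tau> "Suc j" \<xi> \<omega>, OF mono] that by (auto simp: \<xi>'_def)
  show "energy n \<tau> \<xi>' \<omega> \<le> min N (energy n \<tau> \<xi> \<omega>)" for \<omega>
  proof (rule min.boundedI)
    show "energy n \<tau> \<xi>' \<omega> \<le> energy n \<tau> \<xi> \<omega>"
      unfolding energy_def by (intro sum_mono mult_right_mono) (use mono in \<open>auto simp: \<xi>'_def\<close>)
    have "energy m \<tau> \<xi>' \<omega> \<le> N" if "m \<le> n" for m
      using that
    proof (induction m)
      case (Suc m)
      show ?case
      proof (cases "energy (Suc m) \<tau> \<xi> \<omega> \<le> N")
        case True
        have "energy (Suc m) \<tau> \<xi>' \<omega> = energy (Suc m) \<tau> \<xi> \<omega>"
          unfolding energy_def
        proof (intro sum.cong refl)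
          fix j assume "j \<in> {..<Suc m}"
          then have "energy (Suc j) \<tau> \<xi> \<omega> \<le> energy (Suc m) \<tau> \<xi> \<omega>"
            using Suc.prems by (intro energy_mono mono) auto
          then show "(\<xi>' j \<omega>)\<^sup>2 * (\<tau> (Suc j) - \<tau> j) = (\<xi> j \<omega>)\<^sup>2 * (\<tau> (Suc j) - \<tau> j)"
            using True by (auto simp: \<xi>'_def)
        qed
        with True show ?thesis by simp
      next
        case False
        then have "energy (Suc m) \<tau> \<xi>' \<omega> = energy m \<tau> \<xi>' \<omega>"
          by (simp add: energy_def \<xi>'_def)
        with Suc show ?thesis by simp
      qed
    qed (simp add: energy_def N)
    then show "energy n \<tau> \<xi>' \<omega> \<le> N" by simp
  qed
qed

text \<open>By strict monotonicity \<open>p (Suc j)\<close> lies in the half-open interval exactly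
  for \<open>u \<le> j < v\<close>, and the sum over these indices telescopes. The right endpoint is
  tested because steps are open on the left and closed on the right.\<close>

lemma telescope_indicator:
  fixes f p :: "_ \<Rightarrow> real"
  assumes p: "\<And>i j. i < j \<Longrightarrow> j \<le> m \<Longrightarrow> p i < p j" and uv: "u \<le> v" "v \<le> m"
  shows "(\<Sum>j<m. indicator {p u<..p v} (p (Suc j)) * (f (p (Suc j)) - f (p j))) = f (p v) - f (p u)"
proof -
  have "p (Suc j) \<in> {p u<..p v} \<longleftrightarrow> j \<in> {u..<v}" if "j < m" for j
    using p[of u "Suc j"] p[of "Suc j" v] p[of v "Suc j"] p[of "Suc j" u] that uv
    by (cases "Suc j" u rule: linorder_cases; cases "Suc j" v rule: linorder_cases) auto
  then have "(\<Sum>j<m. indicator {p u<..p v} (p (Suc j)) * (f (p (Suc j)) - f (p j)))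
      = (\<Sum>j<m. if j \<in> {u..<v} then f (p (Suc j)) - f (p j) else 0)"
    by (intro sum.cong) (auto simp: indicator_def)
  also have "\<dots> = (\<Sum>j\<in>{u..<v}. f (p (Suc j)) - f (p j))"
    using uv by (subst sum.If_cases) (auto intro!: sum.cong)
  also have "\<dots> = f (p v) - f (p u)"
    using sum_Suc_diff'[OF uv(1), of "\<lambda>j. f (p j)"] by simp
  finally show ?thesis .
qed

text \<open>On a cell of a finer grid the process is constant, so its value at the right endpoint
  serves as height. One summation identity, valid for every function \<open>f\<close> of time,
  covers both conclusions: \<open>f = B\<close> gives the integral and \<open>f\<close> a step
  function gives the process.\<close>

lemma (in brownian) simple_refine:
  assumes S: "simple_data M F a b n \<tau> \<xi>"
    and sm: "strict_mono_on {..m} p" and ab: "a \<le> p 0" "p m \<le> b"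
    and sub: "\<tau> ` {..n} \<subseteq> p ` {..m}"
  defines "\<eta> \<equiv> \<lambda>j. simple_process n \<tau> \<xi> (p (Suc j))"
  shows "simple_data M F a b m p \<eta>" "simple_process m p \<eta> s \<omega> = simple_process n \<tau> \<xi> s \<omega>"
    "simple_ito_integral B m p \<eta> \<omega> = simple_ito_integral B n \<tau> \<xi> \<omega>"
proof -
  note D = simple_dataD[OF S]
  have p: "p i < p j" if "i < j" "j \<le> m" for i j
    using strict_mono_onD[OF sm] that by auto
  have idx: "\<exists>u v. u \<le> v \<and> v \<le> m \<and> \<tau> i = p u \<and> \<tau> (Suc i) = p v" if i: "i < n" for i
  proof -
    obtain u v where uv: "u \<le> m" "v \<le> m" "\<tau> i = p u" "\<tau> (Suc i) = p v"
    proof -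
      have "\<tau> i \<in> p ` {..m}" "\<tau> (Suc i) \<in> p ` {..m}" using sub i by auto
      then show ?thesis using that by auto
    qed
    moreover have "u \<le> v"
      using p[of v u] D(1)[of i "Suc i"] uv i by (cases "u \<le> v") auto
    ultimately show ?thesis by blast
  qed
  have tel: "(\<Sum>j<m. \<eta> j \<omega> * (f (p (Suc j)) - f (p j))) = (\<Sum>i<n. \<xi> i \<omega> * (f (\<tau> (Suc i)) - f (\<tau> i)))"
    for f \<omega>
  proof -
    have "(\<Sum>j<m. \<eta> j \<omega> * (f (p (Suc j)) - f (p j)))
      = (\<Sum>j<m. \<Sum>i<n. \<xi> i \<omega> * (indicator {\<tau> i<..\<tau> (Suc i)} (p (Suc j)) * (f (p (Suc j)) - f (p j))))"
      by (simp only: \<eta>_def simple_process_def sum_distrib_right mult.assoc)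
    also have "\<dots> = (\<Sum>i<n. \<xi> i \<omega> *
        (\<Sum>j<m. indicator {\<tau> i<..\<tau> (Suc i)} (p (Suc j)) * (f (p (Suc j)) - f (p j))))"
      by (subst sum.swap) (simp only: sum_distrib_left)
    also have "\<dots> = (\<Sum>i<n. \<xi> i \<omega> * (f (\<tau> (Suc i)) - f (\<tau> i)))"
    proof (intro sum.cong refl arg_cong2[where f="(*)"])
      fix i assume "i \<in> {..<n}"
      then obtain u v where uv: "u \<le> v" "v \<le> m" "\<tau> i = p u" "\<tau> (Suc i) = p v" using idx[of i] by auto
      show "(\<Sum>j<m. indicator {\<tau> i<..\<tau> (Suc i)} (p (Suc j)) * (f (p (Suc j)) - f (p j)))
        = f (\<tau> (Suc i)) - f (\<tau> i)"
        unfolding uv(3,4) using telescope_indicator[of m p u v f, OF p uv(1,2)] by simp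
    qed
    finally show ?thesis .
  qed
  show "simple_ito_integral B m p \<eta> \<omega> = simple_ito_integral B n \<tau> \<xi> \<omega>"
    unfolding simple_ito_integral_def using tel[of \<omega> "\<lambda>t. B t \<omega>"] .
  have pm: "p j \<le> p (Suc j)" if "j < m" for j using p[of j "Suc j"] that by auto
  \<comment> \<open>The indicator of a half-open interval at \<open>s\<close> is an increment of
    \<open>g\<close>, which makes the process itself an instance of \<open>tel\<close>.\<close>
  define g where "g x = (if s \<le> x then 1 else (0::real))" for x
  have ind: "indicator {x<..y} s = g y - g x" if "x \<le> y" for x y
    using that by (auto simp: indicator_def g_def)
  have "simple_process m p \<eta> s \<omega> = (\<Sum>j<m. \<eta> j \<omega> * (g (p (Suc j)) - g (p j)))"
    unfolding simple_process_def using ind pm by (intro sum.cong refl) auto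
  also have "\<dots> = (\<Sum>i<n. \<xi> i \<omega> * (g (\<tau> (Suc i)) - g (\<tau> i)))"
    by (rule tel)
  also have "\<dots> = simple_process n \<tau> \<xi> s \<omega>"
    unfolding simple_process_def using ind D(1)[of _ "Suc _"] by (intro sum.cong refl) auto
  finally show "simple_process m p \<eta> s \<omega> = simple_process n \<tau> \<xi> s \<omega>" .
  show "simple_data M F a b m p \<eta>"
    unfolding simple_data_def
  proof (intro conjI allI impI ab pm)
    fix j assume j: "j < m"
    show "\<eta> j \<in> borel_measurable (F (p j))"
      unfolding \<eta>_def simple_process_def[abs_def]
    proof (intro borel_measurable_sum)
      fix i assume i: "i \<in> {..<n}"
      then obtain u v where uv: "u \<le> v" "v \<le> m" "\<tau> i = p u" "\<tau> (Suc i) = p v" using idx[of i] by auto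
      show "(\<lambda>\<omega>. \<xi> i \<omega> * indicator {\<tau> i<..\<tau> (Suc i)} (p (Suc j))) \<in> borel_measurable (F (p j))"
      proof (cases "p (Suc j) \<in> {\<tau> i<..\<tau> (Suc i)}")
        case True
        \<comment> \<open>The height is sampled at \<open>p (Suc j)\<close> but must be known at
          \<open>p j\<close>: as \<open>\<tau> i\<close> is a grid point strictly below
          \<open>p (Suc j)\<close>, it is at most \<open>p j\<close>.\<close>
        then have "u \<le> j" using p[of "Suc j" u] uv j by (cases "Suc j" u rule: linorder_cases) auto
        then have "\<tau> i \<le> p j" using p[of u j] uv j by (cases "u = j") auto
        then show ?thesis using measurable_F_mono[OF D(4)[of i]] i True by simp
      qed auto
    qed
    define C where "C = (\<lambda>i. SOME C. \<forall>\<omega>\<in>space M. \<bar>\<xi> i \<omega>\<bar> \<le> C)"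
    have C: "\<forall>\<omega>\<in>space M. \<bar>\<xi> i \<omega>\<bar> \<le> C i" if "i < n" for i
      unfolding C_def by (rule someI_ex) (rule D(5)[OF that])
    show "\<exists>C. \<forall>\<omega>\<in>space M. \<bar>\<eta> j \<omega>\<bar> \<le> C"
    proof (intro exI ballI)
      fix \<omega> assume w: "\<omega> \<in> space M"
      show "\<bar>\<eta> j \<omega>\<bar> \<le> (\<Sum>i<n. C i)"
        unfolding \<eta>_def simple_process_def
      proof (rule order_trans[OF sum_abs], rule sum_mono)
        fix i assume "i \<in> {..<n}"
        with C[of i] w have "\<bar>\<xi> i \<omega>\<bar> \<le> C i" by auto
        then show "\<bar>\<xi> i \<omega> * indicator {\<tau> i<..\<tau> (Suc i)} (p (Suc j))\<bar> \<le> C i"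
          by (auto simp: indicator_def)
      qed
    qed
  qed
qed

text \<open>Both processes are rewritten over the sorted union of their time points; with a common
  grid the heights subtract.\<close>

lemma (in brownian) simple_diff:
  assumes S: "simple_data M F a b n \<tau> \<xi>" and S': "simple_data M F a b n' \<tau>' \<xi>'"
  obtains m p \<eta> where "simple_data M F a b m p \<eta>"
    "\<And>s \<omega>. simple_process m p \<eta> s \<omega> = simple_process n \<tau> \<xi> s \<omega> - simple_process n' \<tau>' \<xi>' s \<omega>"
    "\<And>\<omega>. simple_ito_integral B m p \<eta> \<omega> = simple_ito_integral B n \<tau> \<xi> \<omega> - simple_ito_integral B n' \<tau>' \<xi>' \<omega>"
proof -
  note D = simple_dataD[OF S] and D' = simple_dataD[OF S']
  define P where "P = \<tau> ` {..n} \<union> \<tau>' ` {..n'}"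
  have P: "finite P" "P \<noteq> {}" "P \<subseteq> {a..b}"
    using D(2,3) D'(2,3) by (auto simp: P_def)
  define p where "p j = sorted_list_of_set P ! j" for j
  \<comment> \<open>\<open>P\<close> is nonempty, so the indices \<open>0\<close> to
    \<open>m\<close> enumerate exactly its \<open>card P\<close> points.\<close>
  define m where "m = card P - 1"
  have len: "length (sorted_list_of_set P) = Suc m"
    using P by (simp add: m_def card_gt_0_iff)
  have pm: "strict_mono_on {..m} p"
    using strict_sorted_list_of_set[of P] len
    by (intro strict_mono_onI) (simp add: p_def sorted_wrt_iff_nth_less)
  have pP: "p ` {..m} = P"
  proof -
    have "P = set (sorted_list_of_set P)" using P by simp
    also have "\<dots> = p ` {..m}" unfolding set_conv_nth len p_def by (auto simp: less_Suc_eq_le)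
    finally show ?thesis by simp
  qed
  have ab: "a \<le> p 0" "p m \<le> b" using pP P(3) by (auto simp: image_subset_iff)
  have sub: "\<tau> ` {..n} \<subseteq> p ` {..m}" "\<tau>' ` {..n'} \<subseteq> p ` {..m}" unfolding pP P_def by auto
  note R = simple_refine[OF S pm ab sub(1)] and R' = simple_refine[OF S' pm ab sub(2)]
  define \<eta> where "\<eta> = (\<lambda>j. simple_process n \<tau> \<xi> (p (Suc j)))"
  define \<eta>' where "\<eta>' = (\<lambda>j. simple_process n' \<tau>' \<xi>' (p (Suc j)))"
  show thesis
  proof (rule that[of m p "\<lambda>j \<omega>. \<eta> j \<omega> - \<eta>' j \<omega>"])
    have bd: "\<exists>C. \<forall>\<omega>\<in>space M. \<bar>\<eta> j \<omega> - \<eta>' j \<omega>\<bar> \<le> C" if j: "j < m" for j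
    proof -
      obtain C C' where "\<forall>\<omega>\<in>space M. \<bar>\<eta> j \<omega>\<bar> \<le> C" "\<forall>\<omega>\<in>space M. \<bar>\<eta>' j \<omega>\<bar> \<le> C'"
        using simple_dataD(5)[OF R(1) j] simple_dataD(5)[OF R'(1) j] by (auto simp: \<eta>_def \<eta>'_def)
      then show ?thesis by (intro exI[of _ "C + C'"]) (smt (verit))
    qed
    show "simple_data M F a b m p (\<lambda>j \<omega>. \<eta> j \<omega> - \<eta>' j \<omega>)"
      using R(1) R'(1) bd unfolding \<eta>_def[symmetric] \<eta>'_def[symmetric] simple_data_def
      by (auto intro: borel_measurable_diff)
    show "simple_process m p (\<lambda>j \<omega>. \<eta> j \<omega> - \<eta>' j \<omega>) s \<omega>
        = simple_process n \<tau> \<xi> s \<omega> - simple_process n' \<tau>' \<xi>' s \<omega>" for s \<omega>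
      unfolding R(2)[of s \<omega>, symmetric] R'(2)[of s \<omega>, symmetric] \<eta>_def \<eta>'_def
      unfolding simple_process_def[of m] by (simp add: left_diff_distrib sum_subtractf)
    show "simple_ito_integral B m p (\<lambda>j \<omega>. \<eta> j \<omega> - \<eta>' j \<omega>) \<omega>
        = simple_ito_integral B n \<tau> \<xi> \<omega> - simple_ito_integral B n' \<tau>' \<xi>' \<omega>" for \<omega>
      unfolding R(3)[of \<omega>, symmetric] R'(3)[of \<omega>, symmetric] \<eta>_def \<eta>'_def
      unfolding simple_ito_integral_def[of B m] by (simp add: left_diff_distrib sum_subtractf)
  qed
qed

text \<open>The times are clipped at \<open>s\<close> from above and from below. A height set after
  \<open>s\<close> is not known at the clipped time \<open>s\<close>, so in the first part it is
  replaced by 0; its step has length 0 there anyway. In the second part clipping only delays a step,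
  which keeps its height measurable.\<close>

lemma (in brownian) simple_split:
  assumes S: "simple_data M F a b n \<tau> \<xi>" and s: "a \<le> s" "s \<le> b"
  obtains \<tau>1 \<xi>1 \<tau>2 \<xi>2 where "simple_data M F a s n \<tau>1 \<xi>1" "simple_data M F s b n \<tau>2 \<xi>2"
    "\<And>r \<omega>. r \<le> s \<Longrightarrow> simple_process n \<tau>1 \<xi>1 r \<omega> = simple_process n \<tau> \<xi> r \<omega>"
    "\<And>\<omega>. simple_ito_integral B n \<tau> \<xi> \<omega> = simple_ito_integral B n \<tau>1 \<xi>1 \<omega> + simple_ito_integral B n \<tau>2 \<xi>2 \<omega>"
proof
  note D = simple_dataD[OF S]
  have mono: "\<tau> j \<le> \<tau> (Suc j)" if "j < n" for j using D(1)[of j "Suc j"] that by auto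
  let ?\<tau>1 = "\<lambda>j. min (\<tau> j) s" and ?\<tau>2 = "\<lambda>j. max (\<tau> j) s"
  let ?\<xi>1 = "\<lambda>j \<omega>. if \<tau> j \<le> s then \<xi> j \<omega> else 0"
  show "simple_data M F a s n ?\<tau>1 ?\<xi>1"
    unfolding simple_data_def
  proof (intro conjI allI impI)
    fix j assume j: "j < n"
    show "?\<xi>1 j \<in> borel_measurable (F (?\<tau>1 j))" using D(4)[OF j] by (cases "\<tau> j \<le> s") (auto simp: min_def)
    show "\<exists>C. \<forall>\<omega>\<in>space M. \<bar>?\<xi>1 j \<omega>\<bar> \<le> C" using D(5)[OF j] by (cases "\<tau> j \<le> s") auto
    show "?\<tau>1 j \<le> ?\<tau>1 (Suc j)" using mono[OF j] by auto
  qed (use s D(2)[of 0] in auto)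
  show "simple_data M F s b n ?\<tau>2 \<xi>"
    unfolding simple_data_def
  proof (intro conjI allI impI)
    fix j assume j: "j < n"
    show "\<xi> j \<in> borel_measurable (F (?\<tau>2 j))" by (rule measurable_F_mono[OF D(4)[OF j]]) auto
    show "\<exists>C. \<forall>\<omega>\<in>space M. \<bar>\<xi> j \<omega>\<bar> \<le> C" using D(5)[OF j] .
    show "?\<tau>2 j \<le> ?\<tau>2 (Suc j)" using mono[OF j] by auto
  qed (use s D(3)[of n] in auto)
  show "simple_process n ?\<tau>1 ?\<xi>1 r \<omega> = simple_process n \<tau> \<xi> r \<omega>" if "r \<le> s" for r \<omega>
    unfolding simple_process_def using that by (intro sum.cong) (auto simp: indicator_def)
  show "simple_ito_integral B n \<tau> \<xi> \<omega> = simple_ito_integral B n ?\<tau>1 ?\<xi>1 \<omega> + simple_ito_integral B n ?\<tau>2 \<xi> \<omega>" for \<omega>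
    unfolding simple_ito_integral_def sum.distrib[symmetric]
  proof (intro sum.cong refl)
    fix j assume "j \<in> {..<n}"
    then show "\<xi> j \<omega> * (B (\<tau> (Suc j)) \<omega> - B (\<tau> j) \<omega>)
      = ?\<xi>1 j \<omega> * (B (?\<tau>1 (Suc j)) \<omega> - B (?\<tau>1 j) \<omega>) + \<xi> j \<omega> * (B (?\<tau>2 (Suc j)) \<omega> - B (?\<tau>2 j) \<omega>)"
      using mono[of j] by (auto simp: min_def max_def right_diff_distrib)
  qed
qed

subsection \<open>The Ito integral\<close>

text \<open>Indices are chosen so that the value exceeds \<open>(1/2) ^ k\<close> with probability
  below \<open>(1/2) ^ k\<close>; by Borel-Cantelli almost every outcome violates this only finitely
  often.\<close>

lemma (in prob_space) tends_to_0_in_prob_AE_subseq: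
  assumes [measurable]: "\<And>p. Z p \<in> borel_measurable M" and Z: "tends_to_0_in_prob M Z"
  obtains r :: "nat \<Rightarrow> nat" where "strict_mono r" "AE \<omega> in M. (\<lambda>p. Z (r p) \<omega>) \<longlonglongrightarrow> 0"
proof -
  let ?e = "\<lambda>k::nat. ennreal ((1/2) ^ k)"
  have "\<exists>r. \<forall>k. measure M {\<omega> \<in> space M. ?e k < Z (r k) \<omega>} < (1/2) ^ k \<and> r k < r (Suc k)"
  proof (rule dependent_nat_choice)
    have ev: "\<forall>\<^sub>F p in sequentially. measure M {\<omega> \<in> space M. ?e k < Z p \<omega>} < (1/2) ^ k" for k
      using Z[unfolded tends_to_0_in_prob_def, rule_format, of "?e k"]
      by (intro order_tendstoD(2)[where y = 0]) auto
    show "\<exists>x. measure M {\<omega> \<in> space M. ?e 0 < Z x \<omega>} < (1/2) ^ 0"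
      using eventually_happens[OF ev[of 0]] by auto
    fix x k
    show "\<exists>y. measure M {\<omega> \<in> space M. ?e (Suc k) < Z y \<omega>} < (1/2) ^ Suc k \<and> x < y"
      using eventually_happens[OF eventually_conj[OF ev[of "Suc k"] eventually_gt_at_top[of x]]] by auto
  qed
  then obtain r where r: "\<And>k. measure M {\<omega> \<in> space M. ?e k < Z (r k) \<omega>} < (1/2) ^ k" "\<And>k. r k < r (Suc k)"
    by blast
  let ?A = "\<lambda>k. {\<omega> \<in> space M. ?e k < Z (r k) \<omega>}"
  have "summable (\<lambda>k. measure M (?A k))"
  proof (rule summable_comparison_test')
    show "summable (\<lambda>k. (1/2::real) ^ k)" by (intro summable_geometric) auto
    show "norm (measure M (?A k)) \<le> (1/2) ^ k" for k using r(1)[of k] by simp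
  qed
  then have "AE \<omega> in M. eventually (\<lambda>k. \<omega> \<in> space M - ?A k) sequentially"
    by (intro borel_cantelli_AE1) (auto simp: emeasure_eq_measure)
  then have "AE \<omega> in M. (\<lambda>p. Z (r p) \<omega>) \<longlonglongrightarrow> 0"
  proof eventually_elim
    case (elim \<omega>)
    have e: "?e \<longlonglongrightarrow> 0"
      using tendsto_ennrealI[OF LIMSEQ_realpow_zero[of "1/2"]] by simp
    show ?case
      by (rule tendsto_sandwich[OF _ _ tendsto_const e]) (use elim in \<open>auto elim!: eventually_mono\<close>)
  qed
  with r(2) show thesis by (intro that[of r]) (auto simp: strict_mono_Suc_iff)
qed

lemma tends_to_0_in_prob_subseq:
  "tends_to_0_in_prob M Z \<Longrightarrow> strict_mono r \<Longrightarrow> tends_to_0_in_prob M (\<lambda>p. Z (r p))"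
  unfolding tends_to_0_in_prob_def
  using LIMSEQ_subseq_LIMSEQ[unfolded comp_def] by blast

text \<open>The two sides differ by a perfect square. The free weight \<open>e\<close> allows a
  leading factor arbitrarily close to 1, which the limsup estimate and the second moment bound along
  the grid both rely on.\<close>

lemma sq_le_weighted:
  fixes x y :: real
  assumes "0 < e"
  shows "x\<^sup>2 \<le> (1 + e) * y\<^sup>2 + (1 + 1 / e) * (x - y)\<^sup>2"
proof -
  have "(1 + e) * y\<^sup>2 + (1 + 1 / e) * (x - y)\<^sup>2 - x\<^sup>2 = (sqrt e * y - (x - y) / sqrt e)\<^sup>2"
    using assms by (simp add: power2_diff power_divide power_mult_distrib) (simp add: field_simps power2_eq_square)
  then show ?thesis by (metis diff_ge_0_iff_ge zero_le_power2)
qed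

lemma nn_integral_sq_le_weighted:
  fixes f g :: "'b \<Rightarrow> real"
  assumes [measurable]: "f \<in> borel_measurable N" "g \<in> borel_measurable N" and "0 < e"
  shows "nn_square N f \<le> ennreal (1 + e) * nn_square N g
    + ennreal (1 + 1 / e) * nn_square N (\<lambda>x. f x - g x)"
proof -
  have "nn_square N f
      \<le> (\<integral>\<^sup>+x. ennreal (1 + e) * ennreal ((g x)\<^sup>2) + ennreal (1 + 1 / e) * ennreal ((f x - g x)\<^sup>2) \<partial>N)"
    using sq_le_weighted[OF assms(3)] assms(3)
    by (intro nn_integral_mono) (simp flip: ennreal_mult ennreal_plus)
  also have "\<dots> = ennreal (1 + e) * nn_square N g
    + ennreal (1 + 1 / e) * nn_square N (\<lambda>x. f x - g x)"
    by (subst nn_integral_add) (auto simp: nn_integral_cmult)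
  finally show ?thesis .
qed

lemma nn_integral_sq_diff_le:
  fixes f g :: "'b \<Rightarrow> real"
  assumes [measurable]: "f \<in> borel_measurable N" "g \<in> borel_measurable N"
  shows "nn_square N (\<lambda>x. f x - g x) \<le> 2 * nn_square N f + 2 * nn_square N g"
  using nn_integral_sq_le_weighted[of "\<lambda>x. f x - g x" N "f" 1] by simp

text \<open>For a fixed weight the error term vanishes in the limit and leaves the factor
  \<open>1 + e\<close>; afterwards \<open>e = 1 / (k + 1)\<close> is sent to 0. Finiteness of the
  limit energy is used in this last passage.\<close>

lemma limsup_nn_integral_sq_le:
  fixes f :: "nat \<Rightarrow> 'b \<Rightarrow> real"
  assumes [measurable]: "\<And>p. f p \<in> borel_measurable N" "g \<in> borel_measurable N"
    and lim: "(\<lambda>p. \<integral>\<^sup>+x. ennreal ((f p x - g x)\<^sup>2) \<partial>N) \<longlonglongrightarrow> 0"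
    and fin: "nn_square N g < \<infinity>"
  shows "limsup (\<lambda>p. \<integral>\<^sup>+x. ennreal ((f p x)\<^sup>2) \<partial>N) \<le> nn_square N g"
proof -
  let ?G = "\<integral>\<^sup>+x. ennreal ((g x)\<^sup>2) \<partial>N"
  have *: "limsup (\<lambda>p. \<integral>\<^sup>+x. ennreal ((f p x)\<^sup>2) \<partial>N) \<le> ennreal (1 + 1 / real (Suc k)) * ?G" for k
  proof -
    let ?e = "1 / real (Suc k)"
    let ?u = "\<lambda>p. ennreal (1 + ?e) * ?G + ennreal (1 + 1 / ?e) * nn_square N (\<lambda>x. f p x - g x)"
    have "limsup (\<lambda>p. \<integral>\<^sup>+x. ennreal ((f p x)\<^sup>2) \<partial>N) \<le> limsup ?u"
      by (intro Limsup_mono always_eventually allI nn_integral_sq_le_weighted) auto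
    also have "?u \<longlonglongrightarrow> ennreal (1 + ?e) * ?G + ennreal (1 + 1 / ?e) * 0"
      by (intro tendsto_add tendsto_const ennreal_tendsto_cmult lim) auto
    then have "limsup ?u = ennreal (1 + ?e) * ?G" by (simp add: lim_imp_Limsup)
    finally show ?thesis .
  qed
  have "(\<lambda>k. ennreal (1 + 1 / real (Suc k)) * ?G) \<longlonglongrightarrow> ennreal (1 + 0) * ?G"
  proof (intro tendsto_mult_ennreal tendsto_ennrealI tendsto_add tendsto_const)
    show "(\<lambda>k. 1 / real (Suc k)) \<longlonglongrightarrow> 0" using LIMSEQ_inverse_real_of_nat by (simp add: inverse_eq_divide)
  qed (use fin in auto)
  then show ?thesis using * by (intro LIMSEQ_le_const[where a = "limsup _"]) auto
qed

section \<open>Almost sure approximation by simple processes\<close>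

context brownian
begin

text \<open>Here the integrand is defined on the whole time axis (extended by \<open>0\<close>), and limits in probability
  are replaced by almost sure limits along a subsequence.\<close>

definition ito_limit :: "real \<Rightarrow> real \<Rightarrow> (real \<Rightarrow> 'a \<Rightarrow> real) \<Rightarrow> ('a \<Rightarrow> real) \<Rightarrow> bool" where
  "ito_limit a b H J \<longleftrightarrow>
     (\<lambda>(s, \<omega>). H s \<omega>) \<in> borel_measurable (borel \<Otimes>\<^sub>M M) \<and> J \<in> borel_measurable M \<and>
     (AE \<omega> in M. nn_square lborel (\<lambda>s. H s \<omega>) < \<infinity>) \<and>
     (\<exists>n \<tau> \<xi>. (\<forall>p::nat. simple_data M F a b (n p) (\<tau> p) (\<xi> p)) \<and>
        (AE \<omega> in M. (\<lambda>p. \<integral>\<^sup>+s. ennreal ((simple_process (n p) (\<tau> p) (\<xi> p) s \<omega> - H s \<omega>)\<^sup>2) \<partial>lborel) \<longlonglongrightarrow> 0) \<and>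
        (AE \<omega> in M. (\<lambda>p. simple_ito_integral B (n p) (\<tau> p) (\<xi> p) \<omega>) \<longlonglongrightarrow> J \<omega>))"

lemma simple_process_measurable:
  assumes "simple_data M F a b n \<tau> \<xi>"
  shows "(\<lambda>(s, \<omega>). simple_process n \<tau> \<xi> s \<omega>) \<in> borel_measurable (borel \<Otimes>\<^sub>M M)"
  unfolding simple_process_def split_beta'
proof (intro borel_measurable_sum borel_measurable_times)
  fix j assume "j \<in> {..<n}"
  then have [measurable]: "\<xi> j \<in> borel_measurable M" using simple_height_measurable[OF assms] by auto
  show "(\<lambda>x. \<xi> j (snd x)) \<in> borel_measurable (borel \<Otimes>\<^sub>M M)" by measurable
  show "(\<lambda>x. indicator {\<tau> j<..\<tau> (Suc j)} (fst x)) \<in> borel_measurable (borel \<Otimes>\<^sub>M M)" by measurable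
qed

lemma measurable_slice:
  assumes "(\<lambda>(s, \<omega>). H s \<omega>) \<in> borel_measurable (borel \<Otimes>\<^sub>M M)" "\<omega> \<in> space M"
  shows "(\<lambda>s. H s \<omega>) \<in> borel_measurable lborel"
  using measurable_compose[OF measurable_Pair2'[OF assms(2), of borel] assms(1)]
  by simp

lemma measurable_sq_integral:
  assumes "(\<lambda>(s, \<omega>). H s \<omega>) \<in> borel_measurable (borel \<Otimes>\<^sub>M M)"
  shows "(\<lambda>\<omega>. \<integral>\<^sup>+s. ennreal ((H s \<omega>)\<^sup>2) \<partial>lborel) \<in> borel_measurable M"
proof -
  have "(\<lambda>(s, \<omega>). H s \<omega>) \<in> borel_measurable (lborel \<Otimes>\<^sub>M M)"
    using assms by (simp cong: measurable_cong_sets sets_pair_measure_cong)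
  from measurable_compose[OF measurable_pair_swap' this]
  have [measurable]: "(\<lambda>(\<omega>, s). H s \<omega>) \<in> borel_measurable (M \<Otimes>\<^sub>M lborel)"
    by (simp add: split_beta')
  show ?thesis by measurable
qed

text \<open>The two limits in probability need not become almost sure along the same subsequence, so
  one is extracted for the integrands and a further one from it for the integrals.\<close>

lemma has_ito_integral_imp_ito_limit:
  assumes I: "has_ito_integral M F B H a b J" and ab: "0 \<le> a" "a \<le> b"
  shows "ito_limit a b (\<lambda>s \<omega>. indicator {a..b} s * H s \<omega>) J"
proof -
  let ?H = "\<lambda>s \<omega>. indicator {a..b} s * H s \<omega>"
  obtain n \<tau> \<xi> where S: "\<And>p::nat. simple_data M F a b (n p) (\<tau> p) (\<xi> p)"
    and Z: "tends_to_0_in_prob M (\<lambda>p \<omega>. \<integral>\<^sup>+s\<in>{a..b}.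
           ennreal ((simple_process (n p) (\<tau> p) (\<xi> p) s \<omega> - H s \<omega>)\<^sup>2) \<partial>lborel)"
    and J: "tends_to_0_in_prob M (\<lambda>p \<omega>. ennreal \<bar>simple_ito_integral B (n p) (\<tau> p) (\<xi> p) \<omega> - J \<omega>\<bar>)"
    using I unfolding has_ito_integral_def by blast
  have Jm [measurable]: "J \<in> borel_measurable M" using I by (simp add: has_ito_integral_def)
  have H: "(\<lambda>(s, \<omega>). ?H s \<omega>) \<in> borel_measurable (borel \<Otimes>\<^sub>M M)"
  proof -
    have 1: "(\<lambda>(s, \<omega>). H s \<omega>) \<in> borel_measurable (restrict_space borel {a..b} \<Otimes>\<^sub>M F b)"
      using I ab by (auto simp: has_ito_integral_def progressively_measurable_def)
    \<comment> \<open>Progressive measurability at \<open>b\<close> concerns times in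
      \<open>{a..b}\<close> only. Clamping the time into this interval and multiplying by its
      indicator extends it to the whole axis.\<close>
    have 2: "(\<lambda>x. (max a (min b (fst x)), snd x)) \<in> measurable (borel \<Otimes>\<^sub>M M) (restrict_space borel {a..b} \<Otimes>\<^sub>M F b)"
    proof (rule measurable_Pair)
      show "(\<lambda>x. max a (min b (fst x))) \<in> measurable (borel \<Otimes>\<^sub>M M) (restrict_space borel {a..b})"
        using ab by (intro measurable_restrict_space2) auto
      show "snd \<in> measurable (borel \<Otimes>\<^sub>M M) (F b)"
      proof (rule measurable_compose[OF measurable_snd])
        show "(\<lambda>x. x) \<in> measurable M (F b)"
          using subalg[of b] sets.sets_into_space[of _ "F b"]
          by (auto simp: measurable_def subalgebra_def Int_absorb2)
      qed
    qed
    have "(\<lambda>x. indicator {a..b} (fst x) * (case (max a (min b (fst x)), snd x) of (s, \<omega>) \<Rightarrow> H s \<omega>))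
        \<in> borel_measurable (borel \<Otimes>\<^sub>M M)"
      by (intro borel_measurable_times measurable_compose[OF 2 1]) measurable
    moreover have "(\<lambda>x. indicator {a..b} (fst x) * (case (max a (min b (fst x)), snd x) of (s, \<omega>) \<Rightarrow> H s \<omega>))
        = (\<lambda>(s, \<omega>). ?H s \<omega>)"
      by (auto simp: fun_eq_iff indicator_def)
    ultimately show ?thesis by simp
  qed
  let ?Z = "\<lambda>p \<omega>. \<integral>\<^sup>+s. ennreal ((simple_process (n p) (\<tau> p) (\<xi> p) s \<omega> - ?H s \<omega>)\<^sup>2) \<partial>lborel"
  have Zeq: "(\<integral>\<^sup>+s\<in>{a..b}. ennreal ((simple_process (n p) (\<tau> p) (\<xi> p) s \<omega> - H s \<omega>)\<^sup>2) \<partial>lborel) = ?Z p \<omega>" for p \<omega>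
    by (intro nn_integral_cong) (auto simp: indicator_def simple_process_outside[OF S])
  have Zm: "?Z p \<in> borel_measurable M" for p
    using measurable_sq_integral[of "\<lambda>s \<omega>. simple_process (n p) (\<tau> p) (\<xi> p) s \<omega> - ?H s \<omega>"]
      borel_measurable_diff[OF simple_process_measurable[OF S[of p]] H] by (simp add: split_beta')
  obtain r where r: "strict_mono r" "AE \<omega> in M. (\<lambda>p. ?Z (r p) \<omega>) \<longlonglongrightarrow> 0"
    using tends_to_0_in_prob_AE_subseq[of ?Z, OF Zm] Z unfolding Zeq by blast
  have Im: "(\<lambda>\<omega>. ennreal \<bar>simple_ito_integral B (n (r p)) (\<tau> (r p)) (\<xi> (r p)) \<omega> - J \<omega>\<bar>) \<in> borel_measurable M" for p
    using simple_ito_measurable[OF S[of "r p"] ab(1)] by measurable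
  obtain q where q: "strict_mono q" "AE \<omega> in M. (\<lambda>p. ennreal \<bar>simple_ito_integral B (n (r (q p))) (\<tau> (r (q p))) (\<xi> (r (q p))) \<omega> - J \<omega>\<bar>) \<longlonglongrightarrow> 0"
    using tends_to_0_in_prob_AE_subseq[OF Im tends_to_0_in_prob_subseq[OF J r(1)]] by blast
  show ?thesis
    unfolding ito_limit_def
  proof (intro conjI exI allI)
    show "simple_data M F a b (n (r (q p))) (\<tau> (r (q p))) (\<xi> (r (q p)))" for p by (rule S)
    show "AE \<omega> in M. (\<lambda>p. ?Z (r (q p)) \<omega>) \<longlonglongrightarrow> 0"
      using r(2)
    proof eventually_elim
      case (elim \<omega>)
      then show ?case using LIMSEQ_subseq_LIMSEQ[OF elim q(1)] by (simp add: comp_def)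
    qed
    show "AE \<omega> in M. (\<lambda>p. simple_ito_integral B (n (r (q p))) (\<tau> (r (q p))) (\<xi> (r (q p))) \<omega>) \<longlonglongrightarrow> J \<omega>"
      using q(2)
    proof eventually_elim
      case (elim \<omega>)
      then have "(\<lambda>p. \<bar>simple_ito_integral B (n (r (q p))) (\<tau> (r (q p))) (\<xi> (r (q p))) \<omega> - J \<omega>\<bar>) \<longlonglongrightarrow> 0"
        by (subst (asm) ennreal_0[symmetric], subst (asm) tendsto_ennreal_iff) auto
      then show ?case by (rule LIM_zero_cancel[OF tendsto_rabs_zero_cancel])
    qed
    show "AE \<omega> in M. nn_square lborel (\<lambda>s. ?H s \<omega>) < \<infinity>"
    proof -
      have "(\<integral>\<^sup>+s\<in>{a..b}. ennreal ((H s \<omega>)\<^sup>2) \<partial>lborel) = nn_square lborel (\<lambda>s. ?H s \<omega>)" for \<omega>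
        by (intro nn_integral_cong) (auto simp: indicator_def)
      then show ?thesis using I by (simp add: has_ito_integral_def)
    qed
  qed (use H Jm in auto)
qed

text \<open>Where \<open>Q < N\<close>, the strict inequality forces the approximating energies
  below \<open>N\<close> from some index on, so truncation changes nothing in the limit. Elsewhere
  no convergence is claimed, but all truncated energies stay below \<open>N\<close>; this constant
  dominates them in the reverse Fatou lemma, which together with the isometry gives the limsup
  bound.\<close>

lemma ito_limit_truncated:
  assumes I: "ito_limit a b H J" and a: "0 \<le> a" and N: "0 < N"
  defines "Q \<equiv> \<lambda>\<omega>. \<integral>\<^sup>+s. ennreal ((H s \<omega>)\<^sup>2) \<partial>lborel"
  obtains n \<tau> \<xi> where "\<And>p::nat. simple_data M F a b (n p) (\<tau> p) (\<xi> p)"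
    "\<And>p \<omega>. energy (n p) (\<tau> p) (\<xi> p) \<omega> \<le> N"
    "limsup (\<lambda>p. \<integral>\<^sup>+\<omega>. ennreal ((simple_ito_integral B (n p) (\<tau> p) (\<xi> p) \<omega>)\<^sup>2) \<partial>M) \<le> (\<integral>\<^sup>+\<omega>. min (ennreal N) (Q \<omega>) \<partial>M)"
    "AE \<omega> in M. Q \<omega> < ennreal N \<longrightarrow> (\<lambda>p. simple_ito_integral B (n p) (\<tau> p) (\<xi> p) \<omega>) \<longlonglongrightarrow> J \<omega>"
    "AE \<omega> in M. Q \<omega> < ennreal N \<longrightarrow>
      (\<lambda>p. \<integral>\<^sup>+s. ennreal ((simple_process (n p) (\<tau> p) (\<xi> p) s \<omega> - H s \<omega>)\<^sup>2) \<partial>lborel) \<longlonglongrightarrow> 0"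
proof -
  obtain n \<tau> \<xi> where S: "\<And>p::nat. simple_data M F a b (n p) (\<tau> p) (\<xi> p)"
    and Z: "AE \<omega> in M. (\<lambda>p. \<integral>\<^sup>+s. ennreal ((simple_process (n p) (\<tau> p) (\<xi> p) s \<omega> - H s \<omega>)\<^sup>2) \<partial>lborel) \<longlonglongrightarrow> 0"
    and J: "AE \<omega> in M. (\<lambda>p. simple_ito_integral B (n p) (\<tau> p) (\<xi> p) \<omega>) \<longlonglongrightarrow> J \<omega>"
    using I unfolding ito_limit_def by blast
  have H: "(\<lambda>(s, \<omega>). H s \<omega>) \<in> borel_measurable (borel \<Otimes>\<^sub>M M)" and fin: "AE \<omega> in M. Q \<omega> < \<infinity>"
    using I by (auto simp: ito_limit_def Q_def)
  have "\<forall>p. \<exists>\<xi>'. simple_data M F a b (n p) (\<tau> p) \<xi>' \<and>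
      (\<forall>\<omega>. energy (n p) (\<tau> p) \<xi>' \<omega> \<le> min N (energy (n p) (\<tau> p) (\<xi> p) \<omega>)) \<and>
      (\<forall>j \<omega>. j < n p \<longrightarrow> energy (n p) (\<tau> p) (\<xi> p) \<omega> \<le> N \<longrightarrow> \<xi>' j \<omega> = \<xi> p j \<omega>)"
    using simple_truncate[OF S less_imp_le[OF N]] by metis
  then obtain \<xi>' where S': "\<And>p. simple_data M F a b (n p) (\<tau> p) (\<xi>' p)"
    and E': "\<And>p \<omega>. energy (n p) (\<tau> p) (\<xi>' p) \<omega> \<le> min N (energy (n p) (\<tau> p) (\<xi> p) \<omega>)"
    and same: "\<And>p j \<omega>. j < n p \<Longrightarrow> energy (n p) (\<tau> p) (\<xi> p) \<omega> \<le> N \<Longrightarrow> \<xi>' p j \<omega> = \<xi> p j \<omega>"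
    by metis
  have ls: "AE \<omega> in M. limsup (\<lambda>p. ennreal (energy (n p) (\<tau> p) (\<xi> p) \<omega>)) \<le> Q \<omega>"
    using Z fin AE_space
  proof eventually_elim
    case (elim \<omega>)
    show ?case
      using limsup_nn_integral_sq_le[of "\<lambda>p s. simple_process (n p) (\<tau> p) (\<xi> p) s \<omega>" lborel "\<lambda>s. H s \<omega>"]
        measurable_slice[OF H elim(3)] measurable_slice[OF simple_process_measurable[OF S] elim(3)] elim(1,2)
      by (simp add: energy_eq_nn_integral[OF S] Q_def)
  qed
  have ev: "\<forall>\<^sub>F p in sequentially. energy (n p) (\<tau> p) (\<xi> p) \<omega> \<le> N"
    if "limsup (\<lambda>p. ennreal (energy (n p) (\<tau> p) (\<xi> p) \<omega>)) \<le> Q \<omega>" "Q \<omega> < ennreal N" for \<omega>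
    using Limsup_lessD[OF le_less_trans[OF that]] N by (auto elim!: eventually_mono) (meson ennreal_leI linorder_le_cases not_less)
  show thesis
  proof (rule that[of n \<tau> \<xi>'])
    show "simple_data M F a b (n p) (\<tau> p) (\<xi>' p)" for p by (rule S')
    show "energy (n p) (\<tau> p) (\<xi>' p) \<omega> \<le> N" for p \<omega> using E'[of p \<omega>] by simp
    show "AE \<omega> in M. Q \<omega> < ennreal N \<longrightarrow> (\<lambda>p. simple_ito_integral B (n p) (\<tau> p) (\<xi>' p) \<omega>) \<longlonglongrightarrow> J \<omega>"
      using J ls
    proof eventually_elim
      case (elim \<omega>)
      show ?case
      proof
        assume q: "Q \<omega> < ennreal N"
        have "\<forall>\<^sub>F p in sequentially. simple_ito_integral B (n p) (\<tau> p) (\<xi> p) \<omega> = simple_ito_integral B (n p) (\<tau> p) (\<xi>' p) \<omega>"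
          using ev[OF elim(2) q] by eventually_elim (simp add: simple_ito_integral_def same)
        from Lim_transform_eventually[OF elim(1) this] show "(\<lambda>p. simple_ito_integral B (n p) (\<tau> p) (\<xi>' p) \<omega>) \<longlonglongrightarrow> J \<omega>" .
      qed
    qed
    show "AE \<omega> in M. Q \<omega> < ennreal N \<longrightarrow>
      (\<lambda>p. \<integral>\<^sup>+s. ennreal ((simple_process (n p) (\<tau> p) (\<xi>' p) s \<omega> - H s \<omega>)\<^sup>2) \<partial>lborel) \<longlonglongrightarrow> 0"
      using Z ls
    proof eventually_elim
      case (elim \<omega>)
      show ?case
      proof
        assume q: "Q \<omega> < ennreal N"
        have "\<forall>\<^sub>F p in sequentially. nn_square lborel (\<lambda>s. simple_process (n p) (\<tau> p) (\<xi> p) s \<omega> - H s \<omega>)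
            = nn_square lborel (\<lambda>s. simple_process (n p) (\<tau> p) (\<xi>' p) s \<omega> - H s \<omega>)"
          using ev[OF elim(2) q] by eventually_elim (simp add: simple_process_def same)
        from Lim_transform_eventually[OF elim(1) this] show "(\<lambda>p. \<integral>\<^sup>+s. ennreal ((simple_process (n p) (\<tau> p) (\<xi>' p) s \<omega> - H s \<omega>)\<^sup>2) \<partial>lborel) \<longlonglongrightarrow> 0" .
      qed
    qed
    have [measurable]: "energy (n p) (\<tau> p) (\<xi> p) \<in> borel_measurable M" for p by (rule energy_measurable[OF S])
    have iso: "nn_square M (simple_ito_integral B (n p) (\<tau> p) (\<xi>' p))
        \<le> (\<integral>\<^sup>+\<omega>. min (ennreal N) (ennreal (energy (n p) (\<tau> p) (\<xi> p) \<omega>)) \<partial>M)" for p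
    proof -
      note iso = simple_ito_isometry[OF S'[of p] a]
      have m: "\<tau> p j \<le> \<tau> p (Suc j)" if "j < n p" for j using S[of p] that by (simp add: simple_data_def)
      have nn: "0 \<le> energy (n p) (\<tau> p) (\<xi>' p) \<omega>" for \<omega> by (rule energy_nonneg) (rule m)
      have "nn_square M (simple_ito_integral B (n p) (\<tau> p) (\<xi>' p))
          = (\<integral>\<^sup>+\<omega>. ennreal (energy (n p) (\<tau> p) (\<xi>' p) \<omega>) \<partial>M)"
        using iso nn by (simp add: nn_integral_eq_integral)
      also have "\<dots> \<le> (\<integral>\<^sup>+\<omega>. min (ennreal N) (ennreal (energy (n p) (\<tau> p) (\<xi> p) \<omega>)) \<partial>M)"
        using E'[of p] by (intro nn_integral_mono) (auto intro: ennreal_leI)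
      finally show ?thesis .
    qed
    have "limsup (\<lambda>p. \<integral>\<^sup>+\<omega>. ennreal ((simple_ito_integral B (n p) (\<tau> p) (\<xi>' p) \<omega>)\<^sup>2) \<partial>M)
        \<le> limsup (\<lambda>p. \<integral>\<^sup>+\<omega>. min (ennreal N) (ennreal (energy (n p) (\<tau> p) (\<xi> p) \<omega>)) \<partial>M)"
      by (intro Limsup_mono always_eventually allI iso)
    also have "\<dots> \<le> (\<integral>\<^sup>+\<omega>. limsup (\<lambda>p. min (ennreal N) (ennreal (energy (n p) (\<tau> p) (\<xi> p) \<omega>))) \<partial>M)"
      by (rule nn_integral_limsup[where w="\<lambda>_. ennreal N"]) (auto simp: emeasure_space_1)
    also have "\<dots> \<le> (\<integral>\<^sup>+\<omega>. min (ennreal N) (Q \<omega>) \<partial>M)"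
    proof (rule nn_integral_mono_AE)
      show "AE \<omega> in M. limsup (\<lambda>p. min (ennreal N) (ennreal (energy (n p) (\<tau> p) (\<xi> p) \<omega>))) \<le> min (ennreal N) (Q \<omega>)"
        using ls
      proof eventually_elim
        case (elim \<omega>)
        have "limsup (\<lambda>p. min (ennreal N) (ennreal (energy (n p) (\<tau> p) (\<xi> p) \<omega>))) \<le> Q \<omega>"
          by (rule order_trans[OF Limsup_mono elim]) auto
        moreover have "limsup (\<lambda>p. min (ennreal N) (ennreal (energy (n p) (\<tau> p) (\<xi> p) \<omega>))) \<le> ennreal N"
          by (rule Limsup_bounded) auto
        ultimately show ?case by simp
      qed
    qed
    finally show "limsup (\<lambda>p. \<integral>\<^sup>+\<omega>. ennreal ((simple_ito_integral B (n p) (\<tau> p) (\<xi>' p) \<omega>)\<^sup>2) \<partial>M)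
      \<le> (\<integral>\<^sup>+\<omega>. min (ennreal N) (Q \<omega>) \<partial>M)" .
  qed
qed

end

section \<open>Second moment estimates on a probability space\<close>

lemma (in prob_space) square_integrable_boundI:
  fixes Z :: "'a \<Rightarrow> real"
  assumes [measurable]: "Z \<in> borel_measurable M" and le: "nn_square M Z \<le> ennreal e" and e: "0 \<le> e"
  shows "square_integrable M Z" "integrable M Z" "mean_square M Z \<le> e"
proof -
  show 1: "square_integrable M Z"
    using le by (intro integrableI_bounded) (auto intro: le_less_trans)
  then show "integrable M Z" by (rule square_integrable_imp_integrable[OF assms(1)])
  have "ennreal (mean_square M Z) \<le> ennreal e"
    using le by (subst nn_integral_eq_integral[OF 1, symmetric]) auto
  then show "mean_square M Z \<le> e" using e by simp
qed

text \<open>Nonnegativity of the variance of \<open>\<bar>Z\<bar>\<close>.\<close>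

lemma (in prob_space) abs_expectation_le_sqrt:
  fixes Z :: "'a \<Rightarrow> real"
  assumes Z: "Z \<in> borel_measurable M" "square_integrable M Z"
  shows "(\<integral>\<omega>. \<bar>Z \<omega>\<bar> \<partial>M) \<le> sqrt (mean_square M Z)" "\<bar>\<integral>\<omega>. Z \<omega> \<partial>M\<bar> \<le> sqrt (mean_square M Z)"
proof -
  have i: "integrable M Z" by (rule square_integrable_imp_integrable[OF Z])
  have "0 \<le> variance (\<lambda>\<omega>. \<bar>Z \<omega>\<bar>)" by (rule variance_positive)
  also have "\<dots> = mean_square M Z - (\<integral>\<omega>. \<bar>Z \<omega>\<bar> \<partial>M)\<^sup>2"
    using i Z by (subst variance_eq) auto
  finally show "(\<integral>\<omega>. \<bar>Z \<omega>\<bar> \<partial>M) \<le> sqrt (mean_square M Z)"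
    by (intro real_le_rsqrt) auto
  then show "\<bar>\<integral>\<omega>. Z \<omega> \<partial>M\<bar> \<le> sqrt (mean_square M Z)"
    using integral_abs_bound[of M Z] by linarith
qed

lemma (in prob_space) bounded_product_expectation_le:
  fixes Z G :: "'a \<Rightarrow> real"
  assumes Z: "Z \<in> borel_measurable M" "nn_square M Z \<le> ennreal e" "0 \<le> e"
    and G: "G \<in> borel_measurable M" "\<And>\<omega>. \<omega> \<in> space M \<Longrightarrow> \<bar>G \<omega>\<bar> \<le> C"
  shows "integrable M (\<lambda>\<omega>. G \<omega> * Z \<omega>)" "\<bar>\<integral>\<omega>. G \<omega> * Z \<omega> \<partial>M\<bar> \<le> C * sqrt e"
proof -
  note B = square_integrable_boundI[OF Z]
  obtain \<omega>0 where "\<omega>0 \<in> space M" using not_empty by auto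
  then have C: "0 \<le> C" using G(2)[of \<omega>0] by linarith
  show i: "integrable M (\<lambda>\<omega>. G \<omega> * Z \<omega>)"
  proof (rule Bochner_Integration.integrable_bound[of M "\<lambda>\<omega>. C * Z \<omega>"])
    show "AE \<omega> in M. norm (G \<omega> * Z \<omega>) \<le> norm (C * Z \<omega>)"
      using G(2) C by (intro AE_I2) (simp add: abs_mult mult_right_mono)
  qed (use B(2) G(1) Z(1) in auto)
  have "\<bar>\<integral>\<omega>. G \<omega> * Z \<omega> \<partial>M\<bar> \<le> (\<integral>\<omega>. \<bar>G \<omega> * Z \<omega>\<bar> \<partial>M)" by (rule integral_abs_bound)
  also have "\<dots> \<le> (\<integral>\<omega>. C * \<bar>Z \<omega>\<bar> \<partial>M)"
    using integrable_abs[OF i] B(2) G(2) by (intro integral_mono) (simp_all add: abs_mult mult_right_mono)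
  also have "\<dots> = C * (\<integral>\<omega>. \<bar>Z \<omega>\<bar> \<partial>M)" by simp
  also have "\<dots> \<le> C * sqrt e"
    using abs_expectation_le_sqrt(1)[OF Z(1) B(1)] B(3) C
    by (intro mult_left_mono) (auto intro: order_trans)
  finally show "\<bar>\<integral>\<omega>. G \<omega> * Z \<omega> \<partial>M\<bar> \<le> C * sqrt e" .
qed

text \<open>As \<open>Q\<close> is almost surely finite, the events \<open>Q < k + 1\<close> exhaust
  the space, and Fatou's lemma carries a bound uniform in \<open>k\<close> over to the full
  integral.\<close>

lemma nn_integral_le_truncated:
  assumes [measurable]: "f \<in> borel_measurable M" "Q \<in> borel_measurable M"
    and fin: "AE \<omega> in M. Q \<omega> < \<infinity>"
    and le: "\<And>k. (\<integral>\<^sup>+\<omega>. f \<omega> * indicator {\<omega>. Q \<omega> < ennreal (real (Suc k))} \<omega> \<partial>M) \<le> K"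
  shows "(\<integral>\<^sup>+\<omega>. f \<omega> \<partial>M) \<le> K"
proof -
  have "(\<integral>\<^sup>+\<omega>. f \<omega> \<partial>M)
      \<le> (\<integral>\<^sup>+\<omega>. liminf (\<lambda>k. f \<omega> * indicator {\<omega>. Q \<omega> < ennreal (real (Suc k))} \<omega>) \<partial>M)"
    using fin
  proof (intro nn_integral_mono_AE, eventually_elim)
    case (elim \<omega>)
    then obtain r where r: "Q \<omega> = ennreal r" "0 \<le> r" by (cases "Q \<omega>") auto
    obtain K where "r < real K" using reals_Archimedean2 by blast
    then have "\<forall>\<^sub>F k in sequentially. f \<omega> \<le> f \<omega> * indicator {\<omega>. Q \<omega> < ennreal (real (Suc k))} \<omega>"
      unfolding eventually_sequentially
    proof (intro exI[of _ K] allI impI)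
      fix k assume "K \<le> k"
      then have "Q \<omega> < ennreal (real (Suc k))"
        unfolding r(1) using r(2) \<open>r < real K\<close> by (subst ennreal_less_iff) auto
      then show "f \<omega> \<le> f \<omega> * indicator {\<omega>. Q \<omega> < ennreal (real (Suc k))} \<omega>"
        by (simp only: indicator_def mem_Collect_eq of_bool_eq mult_1_right order_refl)
    qed
    then show ?case by (rule Liminf_bounded)
  qed
  also have "\<dots> \<le> liminf (\<lambda>k. \<integral>\<^sup>+\<omega>. f \<omega> * indicator {\<omega>. Q \<omega> < ennreal (real (Suc k))} \<omega> \<partial>M)"
    by (intro nn_integral_liminf) measurable
  also have "\<dots> \<le> liminf (\<lambda>k::nat. K)"
    by (intro Liminf_mono always_eventually allI le)
  also have "\<dots> = K" by (simp add: Liminf_const)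
  finally show ?thesis .
qed

section \<open>Energy bounds, differences and density\<close>

context brownian
begin

text \<open>Fatou's lemma along the truncated approximations. They converge to \<open>J\<close> only
  where \<open>Q < N\<close>, and outside this event the integrand on the left is 0.\<close>

lemma ito_limit_stopped_bound:
  assumes I: "ito_limit a b H J" and a: "0 \<le> a" and N: "0 < N"
  defines "Q \<equiv> \<lambda>\<omega>. \<integral>\<^sup>+s. ennreal ((H s \<omega>)\<^sup>2) \<partial>lborel"
  shows "(\<integral>\<^sup>+\<omega>. ennreal ((J \<omega>)\<^sup>2) * indicator {\<omega>. Q \<omega> < ennreal N} \<omega> \<partial>M) \<le> (\<integral>\<^sup>+\<omega>. min (ennreal N) (Q \<omega>) \<partial>M)"
proof -
  obtain n \<tau> \<xi> where S: "\<And>p::nat. simple_data M F a b (n p) (\<tau> p) (\<xi> p)"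
    and ls: "limsup (\<lambda>p. \<integral>\<^sup>+\<omega>. ennreal ((simple_ito_integral B (n p) (\<tau> p) (\<xi> p) \<omega>)\<^sup>2) \<partial>M) \<le> (\<integral>\<^sup>+\<omega>. min (ennreal N) (Q \<omega>) \<partial>M)"
    and J: "AE \<omega> in M. Q \<omega> < ennreal N \<longrightarrow> (\<lambda>p. simple_ito_integral B (n p) (\<tau> p) (\<xi> p) \<omega>) \<longlonglongrightarrow> J \<omega>"
    unfolding Q_def by (rule ito_limit_truncated[OF I a N]) blast
  have [measurable]: "simple_ito_integral B (n p) (\<tau> p) (\<xi> p) \<in> borel_measurable M" for p
    by (rule simple_ito_measurable[OF S a])
  have "(\<integral>\<^sup>+\<omega>. ennreal ((J \<omega>)\<^sup>2) * indicator {\<omega>. Q \<omega> < ennreal N} \<omega> \<partial>M)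
      \<le> (\<integral>\<^sup>+\<omega>. liminf (\<lambda>p. ennreal ((simple_ito_integral B (n p) (\<tau> p) (\<xi> p) \<omega>)\<^sup>2)) \<partial>M)"
    using J
  proof (intro nn_integral_mono_AE, eventually_elim)
    case (elim \<omega>)
    show ?case
    proof (cases "Q \<omega> < ennreal N")
      case True
      with elim have "(\<lambda>p. ennreal ((simple_ito_integral B (n p) (\<tau> p) (\<xi> p) \<omega>)\<^sup>2)) \<longlonglongrightarrow> ennreal ((J \<omega>)\<^sup>2)"
        by (intro tendsto_ennrealI tendsto_power) auto
      from lim_imp_Liminf[OF _ this] True show ?thesis by simp
    qed auto
  qed
  also have "\<dots> \<le> liminf (\<lambda>p. \<integral>\<^sup>+\<omega>. ennreal ((simple_ito_integral B (n p) (\<tau> p) (\<xi> p) \<omega>)\<^sup>2) \<partial>M)"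
    by (intro nn_integral_liminf) auto
  also have "\<dots> \<le> limsup (\<lambda>p. \<integral>\<^sup>+\<omega>. ennreal ((simple_ito_integral B (n p) (\<tau> p) (\<xi> p) \<omega>)\<^sup>2) \<partial>M)"
    by (intro Liminf_le_Limsup) auto
  also note ls
  finally show ?thesis .
qed

text \<open>One half of the Ito isometry, obtained by letting the truncation level tend to infinity.
  Applied to differences of integrals it measures how well a simple integral approximates
  \<open>J\<close>.\<close>

lemma ito_limit_square_bound:
  assumes I: "ito_limit a b H J" and a: "0 \<le> a"
  shows "nn_square M J \<le> (\<integral>\<^sup>+\<omega>. nn_square lborel (\<lambda>s. H s \<omega>) \<partial>M)"
proof (rule nn_integral_le_truncated)
  let ?Q = "\<lambda>\<omega>. \<integral>\<^sup>+s. ennreal ((H s \<omega>)\<^sup>2) \<partial>lborel"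
  show "?Q \<in> borel_measurable M" "(\<lambda>\<omega>. ennreal ((J \<omega>)\<^sup>2)) \<in> borel_measurable M" "AE \<omega> in M. ?Q \<omega> < \<infinity>"
    using I measurable_sq_integral by (auto simp: ito_limit_def)
  fix k :: nat
  have "(\<integral>\<^sup>+\<omega>. ennreal ((J \<omega>)\<^sup>2) * indicator {\<omega>. ?Q \<omega> < ennreal (real (Suc k))} \<omega> \<partial>M) \<le> (\<integral>\<^sup>+\<omega>. min (ennreal (real (Suc k))) (?Q \<omega>) \<partial>M)"
    by (rule ito_limit_stopped_bound[OF I a]) simp
  also have "\<dots> \<le> (\<integral>\<^sup>+\<omega>. ?Q \<omega> \<partial>M)" by (intro nn_integral_mono) auto
  finally show "(\<integral>\<^sup>+\<omega>. ennreal ((J \<omega>)\<^sup>2) * indicator {\<omega>. ?Q \<omega> < ennreal (real (Suc k))} \<omega> \<partial>M) \<le> (\<integral>\<^sup>+\<omega>. ?Q \<omega> \<partial>M)" .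
qed

lemma ito_limit_diff:
  assumes I: "ito_limit a b H J" and I': "ito_limit a b H' J'"
  shows "ito_limit a b (\<lambda>s \<omega>. H s \<omega> - H' s \<omega>) (\<lambda>\<omega>. J \<omega> - J' \<omega>)"
proof -
  obtain n \<tau> \<xi> where S: "\<And>p::nat. simple_data M F a b (n p) (\<tau> p) (\<xi> p)"
    and Z: "AE \<omega> in M. (\<lambda>p. \<integral>\<^sup>+s. ennreal ((simple_process (n p) (\<tau> p) (\<xi> p) s \<omega> - H s \<omega>)\<^sup>2) \<partial>lborel) \<longlonglongrightarrow> 0"
    and J: "AE \<omega> in M. (\<lambda>p. simple_ito_integral B (n p) (\<tau> p) (\<xi> p) \<omega>) \<longlonglongrightarrow> J \<omega>"
    using I unfolding ito_limit_def by blast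
  obtain n' \<tau>' \<xi>' where S': "\<And>p::nat. simple_data M F a b (n' p) (\<tau>' p) (\<xi>' p)"
    and Z': "AE \<omega> in M. (\<lambda>p. \<integral>\<^sup>+s. ennreal ((simple_process (n' p) (\<tau>' p) (\<xi>' p) s \<omega> - H' s \<omega>)\<^sup>2) \<partial>lborel) \<longlonglongrightarrow> 0"
    and J': "AE \<omega> in M. (\<lambda>p. simple_ito_integral B (n' p) (\<tau>' p) (\<xi>' p) \<omega>) \<longlonglongrightarrow> J' \<omega>"
    using I' unfolding ito_limit_def by blast
  have H: "(\<lambda>(s, \<omega>). H s \<omega>) \<in> borel_measurable (borel \<Otimes>\<^sub>M M)" "(\<lambda>(s, \<omega>). H' s \<omega>) \<in> borel_measurable (borel \<Otimes>\<^sub>M M)"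
    and fin: "AE \<omega> in M. nn_square lborel (\<lambda>s. H s \<omega>) < \<infinity>" "AE \<omega> in M. nn_square lborel (\<lambda>s. H' s \<omega>) < \<infinity>"
    and Jm: "J \<in> borel_measurable M" "J' \<in> borel_measurable M"
    using I I' by (auto simp: ito_limit_def)
  have "\<forall>p. \<exists>m q \<eta>. simple_data M F a b m q \<eta> \<and>
    (\<forall>s \<omega>. simple_process m q \<eta> s \<omega> = simple_process (n p) (\<tau> p) (\<xi> p) s \<omega> - simple_process (n' p) (\<tau>' p) (\<xi>' p) s \<omega>) \<and>
    (\<forall>\<omega>. simple_ito_integral B m q \<eta> \<omega> = simple_ito_integral B (n p) (\<tau> p) (\<xi> p) \<omega> - simple_ito_integral B (n' p) (\<tau>' p) (\<xi>' p) \<omega>)"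
  proof
    fix p
    show "\<exists>m q \<eta>. simple_data M F a b m q \<eta> \<and>
    (\<forall>s \<omega>. simple_process m q \<eta> s \<omega> = simple_process (n p) (\<tau> p) (\<xi> p) s \<omega> - simple_process (n' p) (\<tau>' p) (\<xi>' p) s \<omega>) \<and>
    (\<forall>\<omega>. simple_ito_integral B m q \<eta> \<omega> = simple_ito_integral B (n p) (\<tau> p) (\<xi> p) \<omega> - simple_ito_integral B (n' p) (\<tau>' p) (\<xi>' p) \<omega>)"
      by (rule simple_diff[OF S[of p] S'[of p]]) blast
  qed
  then obtain m q \<eta> where D: "\<And>p. simple_data M F a b (m p) (q p) (\<eta> p)"
    and Dp: "\<And>p s \<omega>. simple_process (m p) (q p) (\<eta> p) s \<omega> = simple_process (n p) (\<tau> p) (\<xi> p) s \<omega> - simple_process (n' p) (\<tau>' p) (\<xi>' p) s \<omega>"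
    and Di: "\<And>p \<omega>. simple_ito_integral B (m p) (q p) (\<eta> p) \<omega> = simple_ito_integral B (n p) (\<tau> p) (\<xi> p) \<omega> - simple_ito_integral B (n' p) (\<tau>' p) (\<xi>' p) \<omega>"
    by metis
  show ?thesis
    unfolding ito_limit_def
  proof (intro conjI exI allI)
    show "(\<lambda>(s, \<omega>). H s \<omega> - H' s \<omega>) \<in> borel_measurable (borel \<Otimes>\<^sub>M M)"
      using borel_measurable_diff[OF H] by (simp add: split_beta')
    show "(\<lambda>\<omega>. J \<omega> - J' \<omega>) \<in> borel_measurable M" using Jm by measurable
    show "AE \<omega> in M. nn_square lborel (\<lambda>s. H s \<omega> - H' s \<omega>) < \<infinity>"
      using fin AE_space
    proof eventually_elim
      case (elim \<omega>)
      show ?case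
        by (rule le_less_trans[OF nn_integral_sq_diff_le])
          (use elim measurable_slice[OF H(1) elim(3)] measurable_slice[OF H(2) elim(3)] in \<open>auto simp: ennreal_mult_less_top\<close>)
    qed
    show "simple_data M F a b (m p) (q p) (\<eta> p)" for p by (rule D)
    show "AE \<omega> in M. (\<lambda>p. simple_ito_integral B (m p) (q p) (\<eta> p) \<omega>) \<longlonglongrightarrow> J \<omega> - J' \<omega>"
      using J J' by eventually_elim (auto simp: Di intro: tendsto_diff)
    show "AE \<omega> in M. (\<lambda>p. \<integral>\<^sup>+s. ennreal ((simple_process (m p) (q p) (\<eta> p) s \<omega> - (H s \<omega> - H' s \<omega>))\<^sup>2) \<partial>lborel) \<longlonglongrightarrow> 0"
      using Z Z' AE_space
    proof eventually_elim
      case (elim \<omega>)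
      let ?u = "\<lambda>p. \<integral>\<^sup>+s. ennreal ((simple_process (n p) (\<tau> p) (\<xi> p) s \<omega> - H s \<omega>)\<^sup>2) \<partial>lborel"
      let ?v = "\<lambda>p. \<integral>\<^sup>+s. ennreal ((simple_process (n' p) (\<tau>' p) (\<xi>' p) s \<omega> - H' s \<omega>)\<^sup>2) \<partial>lborel"
      have "(\<lambda>p. 2 * ?u p + 2 * ?v p) \<longlonglongrightarrow> 2 * 0 + 2 * 0"
        using elim by (intro tendsto_add ennreal_tendsto_cmult) auto
      then have lim: "(\<lambda>p. 2 * ?u p + 2 * ?v p) \<longlonglongrightarrow> 0" by simp
      note [measurable] = measurable_slice[OF H(1) elim(3)] measurable_slice[OF H(2) elim(3)]
        measurable_slice[OF simple_process_measurable[OF S] elim(3)] measurable_slice[OF simple_process_measurable[OF S'] elim(3)]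
      have le: "nn_square lborel (\<lambda>s. simple_process (m p) (q p) (\<eta> p) s \<omega> - (H s \<omega> - H' s \<omega>)) \<le> 2 * ?u p + 2 * ?v p" for p
        using nn_integral_sq_diff_le[of "\<lambda>s. simple_process (n p) (\<tau> p) (\<xi> p) s \<omega> - H s \<omega>" lborel
            "\<lambda>s. simple_process (n' p) (\<tau>' p) (\<xi>' p) s \<omega> - H' s \<omega>"]
        by (simp add: Dp algebra_simps)
      show ?case
        by (rule tendsto_sandwich[OF _ _ tendsto_const lim]) (auto intro: always_eventually le)
    qed
  qed
qed

lemma simple_ito_limit:
  assumes S: "simple_data M F a b n \<tau> \<xi>" and a: "0 \<le> a"
  shows "ito_limit a b (simple_process n \<tau> \<xi>) (simple_ito_integral B n \<tau> \<xi>)"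
  unfolding ito_limit_def
  using simple_process_measurable[OF S] simple_ito_measurable[OF S a] S
  by (auto simp: energy_eq_nn_integral[OF S] intro!: exI[of _ "\<lambda>_. n"] exI[of _ "\<lambda>_. \<tau>"] exI[of _ "\<lambda>_. \<xi>"])

lemma ito_limit_mono:
  assumes I: "ito_limit a b H J" and "b \<le> c"
  shows "ito_limit a c H J"
proof -
  have "simple_data M F a b n \<tau> \<xi> \<Longrightarrow> simple_data M F a c n \<tau> \<xi>" for n \<tau> \<xi>
    using assms(2) by (auto simp: simple_data_def)
  with I show ?thesis unfolding ito_limit_def by meson
qed

text \<open>The approximations converge only path by path, and mean square convergence needs a
  dominating function. The level \<open>N\<close> is first chosen so that paths with energy at least
  \<open>N\<close> carry little energy in total; with the approximations truncated at
  \<open>N\<close>, the squared distances are dominated by \<open>2 * Q + 2 * N\<close>.\<close>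

lemma ito_limit_simple_dense:
  assumes I: "ito_limit a b H J" and a: "0 \<le> a" and e: "0 < e"
    and fin: "(\<integral>\<^sup>+\<omega>. nn_square lborel (\<lambda>s. H s \<omega>) \<partial>M) < \<infinity>"
  obtains n \<tau> \<xi> where "simple_data M F a b n \<tau> \<xi>"
    "(\<integral>\<^sup>+\<omega>. nn_square lborel (\<lambda>s. H s \<omega> - simple_process n \<tau> \<xi> s \<omega>) \<partial>M) < e"
proof -
  define Q where "Q = (\<lambda>\<omega>. \<integral>\<^sup>+s. ennreal ((H s \<omega>)\<^sup>2) \<partial>lborel)"
  have H: "(\<lambda>(s, \<omega>). H s \<omega>) \<in> borel_measurable (borel \<Otimes>\<^sub>M M)" using I by (simp add: ito_limit_def)
  have Qm [measurable]: "Q \<in> borel_measurable M" using measurable_sq_integral[OF H] by (simp add: Q_def)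
  have fin': "(\<integral>\<^sup>+\<omega>. Q \<omega> \<partial>M) < \<infinity>" using fin by (simp add: Q_def)
  have Qfin: "AE \<omega> in M. Q \<omega> < \<infinity>" using I by (simp add: ito_limit_def Q_def)
  \<comment> \<open>The factor 4 anticipates that where \<open>N \<le> Q\<close> the dominating
    function \<open>2 * Q + 2 * N\<close> is at most \<open>4 * Q\<close>.\<close>
  let ?T = "\<lambda>k \<omega>. 4 * Q \<omega> * indicator {\<omega>. ennreal (real (Suc k)) \<le> Q \<omega>} \<omega>"
  have "(\<lambda>k. \<integral>\<^sup>+\<omega>. ?T k \<omega> \<partial>M) \<longlonglongrightarrow> (\<integral>\<^sup>+\<omega>. 0 \<partial>M)"
  proof (rule nn_integral_dominated_convergence[where w="\<lambda>\<omega>. 4 * Q \<omega>"])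
    show "(\<integral>\<^sup>+\<omega>. 4 * Q \<omega> \<partial>M) < \<infinity>" using fin' by (simp add: nn_integral_cmult ennreal_mult_less_top)
    show "AE \<omega> in M. (\<lambda>k. ?T k \<omega>) \<longlonglongrightarrow> 0"
      using Qfin
    proof eventually_elim
      case (elim \<omega>)
      then obtain r where r: "Q \<omega> = ennreal r" "0 \<le> r" by (cases "Q \<omega>") auto
      obtain K where "r < real K" using reals_Archimedean2 by blast
      then have "\<forall>\<^sub>F k in sequentially. 0 = ?T k \<omega>"
        unfolding eventually_sequentially
      proof (intro exI[of _ K] allI impI)
        fix k assume "K \<le> k"
        then have "Q \<omega> < ennreal (real (Suc k))"
          unfolding r(1) using r(2) \<open>r < real K\<close> by (subst ennreal_less_iff) auto
        then show "0 = ?T k \<omega>"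
          by (simp only: indicator_def mem_Collect_eq not_le[symmetric] of_bool_eq mult_zero_right)
      qed
      from Lim_transform_eventually[OF tendsto_const this] show ?case .
    qed
    show "AE \<omega> in M. ?T k \<omega> \<le> 4 * Q \<omega>" for k by (auto simp: indicator_def)
  qed auto
  then have "\<forall>\<^sub>F k in sequentially. (\<integral>\<^sup>+\<omega>. ?T k \<omega> \<partial>M) < e"
    using e by (intro order_tendstoD(2)) auto
  then obtain k where k: "(\<integral>\<^sup>+\<omega>. ?T k \<omega> \<partial>M) < e" using eventually_happens by force
  define N where "N = real (Suc k)"
  have N: "0 < N" by (simp add: N_def)
  obtain n \<tau> \<xi> where S: "\<And>p::nat. simple_data M F a b (n p) (\<tau> p) (\<xi> p)"
    and E: "\<And>p \<omega>. energy (n p) (\<tau> p) (\<xi> p) \<omega> \<le> N"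
    and Z: "AE \<omega> in M. Q \<omega> < ennreal N \<longrightarrow>
      (\<lambda>p. \<integral>\<^sup>+s. ennreal ((simple_process (n p) (\<tau> p) (\<xi> p) s \<omega> - H s \<omega>)\<^sup>2) \<partial>lborel) \<longlonglongrightarrow> 0"
    unfolding Q_def by (rule ito_limit_truncated[OF I a N]) blast
  define D where "D = (\<lambda>p \<omega>. \<integral>\<^sup>+s. ennreal ((H s \<omega> - simple_process (n p) (\<tau> p) (\<xi> p) s \<omega>)\<^sup>2) \<partial>lborel)"
  have Dm [measurable]: "D p \<in> borel_measurable M" for p
    using measurable_sq_integral[of "\<lambda>s \<omega>. H s \<omega> - simple_process (n p) (\<tau> p) (\<xi> p) s \<omega>"]
      borel_measurable_diff[OF H simple_process_measurable[OF S[of p]]] by (simp add: split_beta' D_def)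
  have Dle: "D p \<omega> \<le> 2 * Q \<omega> + 2 * ennreal N" if "\<omega> \<in> space M" for p \<omega>
  proof -
    have "D p \<omega> \<le> 2 * Q \<omega> + 2 * ennreal (energy (n p) (\<tau> p) (\<xi> p) \<omega>)"
      unfolding D_def Q_def energy_eq_nn_integral[OF S, symmetric]
      by (intro nn_integral_sq_diff_le measurable_slice[OF H that] measurable_slice[OF simple_process_measurable[OF S] that])
    also have "\<dots> \<le> 2 * Q \<omega> + 2 * ennreal N"
      using E[of p \<omega>] by (intro add_left_mono mult_left_mono ennreal_leI) auto
    finally show ?thesis .
  qed
  have "limsup (\<lambda>p. \<integral>\<^sup>+\<omega>. D p \<omega> \<partial>M) \<le> (\<integral>\<^sup>+\<omega>. limsup (\<lambda>p. D p \<omega>) \<partial>M)"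
  proof (rule nn_integral_limsup[where w="\<lambda>\<omega>. 2 * Q \<omega> + 2 * ennreal N"])
    show "(\<integral>\<^sup>+\<omega>. 2 * Q \<omega> + 2 * ennreal N \<partial>M) < \<infinity>"
      using fin' by (subst nn_integral_add) (auto simp: nn_integral_cmult ennreal_mult_less_top emeasure_space_1)
    show "AE \<omega> in M. D p \<omega> \<le> 2 * Q \<omega> + 2 * ennreal N" for p using Dle by (intro AE_I2)
  qed auto
  also have "\<dots> \<le> (\<integral>\<^sup>+\<omega>. ?T k \<omega> \<partial>M)"
    using Z AE_space[of M]
  proof (intro nn_integral_mono_AE, eventually_elim)
    case (elim \<omega>)
    show ?case
    proof (cases "Q \<omega> < ennreal N")
      case True
      with elim have "(\<lambda>p. D p \<omega>) \<longlonglongrightarrow> 0" by (simp add: D_def power2_commute)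
      then show ?thesis by (simp add: lim_imp_Limsup)
    next
      case False
      then have NQ: "ennreal N \<le> Q \<omega>" by simp
      have "limsup (\<lambda>p. D p \<omega>) \<le> 2 * Q \<omega> + 2 * ennreal N"
        by (intro Limsup_bounded always_eventually allI Dle elim)
      also have "\<dots> \<le> 2 * Q \<omega> + 2 * Q \<omega>" using NQ by (intro add_left_mono mult_left_mono) auto
      also have "\<dots> = ?T k \<omega>" using NQ by (simp add: N_def flip: distrib_right)
      finally show ?thesis .
    qed
  qed
  also note k
  finally have "\<forall>\<^sub>F p in sequentially. (\<integral>\<^sup>+\<omega>. D p \<omega> \<partial>M) < e" by (rule Limsup_lessD)
  then obtain p where "(\<integral>\<^sup>+\<omega>. D p \<omega> \<partial>M) < e" using eventually_happens by force
  with S[of p] show thesis unfolding D_def by (rule that)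
qed

end

lemma (in prob_space) Cauchy_Schwarz_expectation:
  fixes f g :: "'a \<Rightarrow> real"
  assumes [measurable]: "f \<in> borel_measurable M" "g \<in> borel_measurable M"
    and f: "square_integrable M f" and g: "square_integrable M g"
  shows "integrable M (\<lambda>\<omega>. f \<omega> * g \<omega>)"
    "\<bar>\<integral>\<omega>. f \<omega> * g \<omega> \<partial>M\<bar> \<le> sqrt (mean_square M f) * sqrt (mean_square M g)"
proof -
  show i: "integrable M (\<lambda>\<omega>. f \<omega> * g \<omega>)"
  proof (rule Bochner_Integration.integrable_bound[of M "\<lambda>\<omega>. (f \<omega>)\<^sup>2 + (g \<omega>)\<^sup>2"])
    have "\<bar>x * y\<bar> \<le> x\<^sup>2 + y\<^sup>2" for x y :: real
    proof -
      have "2 * (\<bar>x\<bar> * \<bar>y\<bar>) \<le> \<bar>x\<bar>\<^sup>2 + \<bar>y\<bar>\<^sup>2" using sum_squares_bound[of "\<bar>x\<bar>" "\<bar>y\<bar>"] by simp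
      moreover have "0 \<le> \<bar>x\<bar> * \<bar>y\<bar>" by simp
      ultimately show ?thesis unfolding abs_mult power2_abs by linarith
    qed
    then show "AE \<omega> in M. norm (f \<omega> * g \<omega>) \<le> norm ((f \<omega>)\<^sup>2 + (g \<omega>)\<^sup>2)" by simp
  qed (use f g in auto)
  have "(ennreal (\<integral>\<omega>. \<bar>f \<omega> * g \<omega>\<bar> \<partial>M))\<^sup>2 = (\<integral>\<^sup>+\<omega>. ennreal \<bar>f \<omega>\<bar> * ennreal \<bar>g \<omega>\<bar> \<partial>M)\<^sup>2"
    using integrable_abs[OF i] by (subst nn_integral_eq_integral[symmetric]) (auto simp: abs_mult ennreal_mult)
  also have "\<dots> \<le> (\<integral>\<^sup>+\<omega>. (ennreal \<bar>f \<omega>\<bar>)\<^sup>2 \<partial>M) * (\<integral>\<^sup>+\<omega>. (ennreal \<bar>g \<omega>\<bar>)\<^sup>2 \<partial>M)"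
    by (rule Cauchy_Schwarz_nn_integral) auto
  also have "\<dots> = ennreal (mean_square M f * mean_square M g)"
    using f g by (simp add: ennreal_power nn_integral_eq_integral ennreal_mult)
  finally have "(\<integral>\<omega>. \<bar>f \<omega> * g \<omega>\<bar> \<partial>M)\<^sup>2 \<le> mean_square M f * mean_square M g"
    by (simp add: ennreal_power)
  then have "(\<integral>\<omega>. \<bar>f \<omega> * g \<omega>\<bar> \<partial>M) \<le> sqrt (mean_square M f * mean_square M g)"
    by (rule real_le_rsqrt)
  then show "\<bar>\<integral>\<omega>. f \<omega> * g \<omega> \<partial>M\<bar> \<le> sqrt (mean_square M f) * sqrt (mean_square M g)"
    using integral_abs_bound[of M "\<lambda>\<omega>. f \<omega> * g \<omega>"] unfolding real_sqrt_mult by linarith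
qed

section \<open>Increments of the Ito integral and their orthogonality to the past\<close>

context brownian
begin

text \<open>\<open>Js\<close> and \<open>Jt\<close> come with unrelated approximating sequences.
  Viewing both as integrals over \<open>{a..t}\<close> makes their difference an integral whose
  integrand cancels up to time \<open>s\<close>.\<close>

lemma ito_increment_limit:
  assumes Is: "has_ito_integral M F B H a s Js" and It: "has_ito_integral M F B H a t Jt"
    and ast: "0 \<le> a" "a \<le> s" "s \<le> t"
  shows "ito_limit a t (\<lambda>r \<omega>. indicator {s<..t} r * H r \<omega>) (\<lambda>\<omega>. Jt \<omega> - Js \<omega>)"
proof -
  have "ito_limit a t (\<lambda>r \<omega>. indicator {a..t} r * H r \<omega> - indicator {a..s} r * H r \<omega>) (\<lambda>\<omega>. Jt \<omega> - Js \<omega>)"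
    using ast by (intro ito_limit_diff has_ito_integral_imp_ito_limit[OF It] ito_limit_mono[OF has_ito_integral_imp_ito_limit[OF Is]]) auto
  also have "(\<lambda>r \<omega>. indicator {a..t} r * H r \<omega> - indicator {a..s} r * H r \<omega>) = (\<lambda>r \<omega>. indicator {s<..t} r * H r \<omega>)"
    using ast by (auto simp: fun_eq_iff indicator_def)
  finally show ?thesis .
qed

lemma ito_increment_square_bound:
  assumes "has_ito_integral M F B H a s Js" "has_ito_integral M F B H a t Jt" "0 \<le> a" "a \<le> s" "s \<le> t"
  shows "nn_square M (\<lambda>\<omega>. Jt \<omega> - Js \<omega>) \<le> (\<integral>\<^sup>+\<omega>. nn_square lborel (\<lambda>r. indicator {s<..t} r * H r \<omega>) \<partial>M)"
  using ito_limit_square_bound[OF ito_increment_limit[OF assms] assms(3)] .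

lemma simple_ito_energy:
  assumes S: "simple_data M F a b n \<tau> \<xi>" and a: "0 \<le> a"
  shows "nn_square M (simple_ito_integral B n \<tau> \<xi>)
    \<le> (\<integral>\<^sup>+\<omega>. nn_square lborel (\<lambda>r. simple_process n \<tau> \<xi> r \<omega>) \<partial>M)"
  using ito_limit_square_bound[OF simple_ito_limit[OF S a] a] .

text \<open>\<open>J\<close> is replaced by a simple integral within mean square distance
  \<open>e\<close>, which is then split at \<open>s\<close>. The later part has mean 0 against
  \<open>G\<close>; the approximation error and the earlier part contribute at most
  \<open>C * sqrt e\<close> each.\<close>

lemma ito_increment_orthogonal_bounded:
  assumes Is: "has_ito_integral M F B H a s Js" and It: "has_ito_integral M F B H a t Jt"
    and ast: "0 \<le> a" "a \<le> s" "s \<le> t"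
    and fin: "(\<integral>\<^sup>+\<omega>. nn_square lborel (\<lambda>r. indicator {s<..t} r * H r \<omega>) \<partial>M) < \<infinity>"
    and G: "G \<in> borel_measurable (F s)" "\<And>\<omega>. \<omega> \<in> space M \<Longrightarrow> \<bar>G \<omega>\<bar> \<le> C"
  shows "(\<integral>\<omega>. G \<omega> * (Jt \<omega> - Js \<omega>) \<partial>M) = 0"
proof -
  let ?K = "\<lambda>r \<omega>. indicator {s<..t} r * H r \<omega>"
  let ?J = "\<lambda>\<omega>. Jt \<omega> - Js \<omega>"
  note I = ito_increment_limit[OF Is It ast]
  have Jm [measurable]: "?J \<in> borel_measurable M" using I by (simp add: ito_limit_def)
  note Gm [measurable] = measurable_from_F[OF G(1)]
  obtain \<omega>0 where "\<omega>0 \<in> space M" using not_empty by auto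
  then have C: "0 \<le> C" using G(2)[of \<omega>0] by linarith
  have le: "\<bar>\<integral>\<omega>. G \<omega> * ?J \<omega> \<partial>M\<bar> \<le> 2 * C * sqrt e" if e: "0 < e" for e
  proof -
    obtain n \<tau> \<xi> where S: "simple_data M F a t n \<tau> \<xi>"
      and D: "(\<integral>\<^sup>+\<omega>. nn_square lborel (\<lambda>r. ?K r \<omega> - simple_process n \<tau> \<xi> r \<omega>) \<partial>M) < ennreal e"
      by (rule ito_limit_simple_dense[OF I ast(1) _ fin, of "ennreal e"]) (use e in auto)
    define Z where "Z = (\<lambda>\<omega>. ?J \<omega> - simple_ito_integral B n \<tau> \<xi> \<omega>)"
    have Zm: "Z \<in> borel_measurable M" using simple_ito_measurable[OF S ast(1)] by (auto simp: Z_def)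
    have Z2: "nn_square M Z \<le> ennreal e"
      using ito_limit_square_bound[OF ito_limit_diff[OF I simple_ito_limit[OF S ast(1)]] ast(1)] D
      by (simp add: Z_def)
    \<comment> \<open>The approximation need not vanish before \<open>s\<close>, but its part \<open>I1\<close> there has energy below \<open>e\<close>.\<close>
    obtain \<tau>1 \<xi>1 \<tau>2 \<xi>2 where S1: "simple_data M F a s n \<tau>1 \<xi>1" and S2: "simple_data M F s t n \<tau>2 \<xi>2"
      and p1: "\<And>r \<omega>. r \<le> s \<Longrightarrow> simple_process n \<tau>1 \<xi>1 r \<omega> = simple_process n \<tau> \<xi> r \<omega>"
      and sum: "\<And>\<omega>. simple_ito_integral B n \<tau> \<xi> \<omega> = simple_ito_integral B n \<tau>1 \<xi>1 \<omega> + simple_ito_integral B n \<tau>2 \<xi>2 \<omega>"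
      by (rule simple_split[OF S ast(2,3)]) blast
    define I1 where "I1 = simple_ito_integral B n \<tau>1 \<xi>1"
    define I2 where "I2 = simple_ito_integral B n \<tau>2 \<xi>2"
    have s0: "0 \<le> s" using ast by simp
    have I1m: "I1 \<in> borel_measurable M" and I2m: "I2 \<in> borel_measurable M"
      using simple_ito_measurable[OF S1 ast(1)] simple_ito_measurable[OF S2 s0] by (auto simp: I1_def I2_def)
    have "nn_square M I1 \<le> (\<integral>\<^sup>+\<omega>. nn_square lborel (\<lambda>r. simple_process n \<tau>1 \<xi>1 r \<omega>) \<partial>M)"
      unfolding I1_def by (rule simple_ito_energy[OF S1 ast(1)])
    also have "\<dots> \<le> (\<integral>\<^sup>+\<omega>. nn_square lborel (\<lambda>r. ?K r \<omega> - simple_process n \<tau> \<xi> r \<omega>) \<partial>M)"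
    proof (intro nn_integral_mono ennreal_leI)
      fix \<omega> r
      show "(simple_process n \<tau>1 \<xi>1 r \<omega>)\<^sup>2 \<le> (?K r \<omega> - simple_process n \<tau> \<xi> r \<omega>)\<^sup>2"
        using p1[of r \<omega>] simple_process_outside[OF S1, of r \<omega>] by (cases "r \<le> s") auto
    qed
    finally have I12: "nn_square M I1 \<le> ennreal e" using D by simp
    have GI2: "(\<integral>\<omega>. G \<omega> * I2 \<omega> \<partial>M) = 0"
      unfolding I2_def using simple_ito_mean[OF S2 s0 G(1)] G(2) by blast
    have i2: "square_integrable M I2" using simple_ito_isometry[OF S2 s0] by (simp add: I2_def)
    have iGI2: "integrable M (\<lambda>\<omega>. G \<omega> * I2 \<omega>)"
      using integrable_bounded_mult[OF square_integrable_imp_integrable[OF I2m i2] Gm] G(2) by blast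
    note bZ = bounded_product_expectation_le[OF Zm Z2 less_imp_le[OF e] Gm G(2)]
    note bI = bounded_product_expectation_le[OF I1m I12 less_imp_le[OF e] Gm G(2)]
    have "(\<integral>\<omega>. G \<omega> * ?J \<omega> \<partial>M) = (\<integral>\<omega>. G \<omega> * Z \<omega> + G \<omega> * I1 \<omega> + G \<omega> * I2 \<omega> \<partial>M)"
      by (intro Bochner_Integration.integral_cong refl) (simp add: Z_def sum I1_def I2_def algebra_simps)
    also have "\<dots> = (\<integral>\<omega>. G \<omega> * Z \<omega> \<partial>M) + (\<integral>\<omega>. G \<omega> * I1 \<omega> \<partial>M)"
      using bZ(1) bI(1) iGI2 GI2 by simp
    finally show ?thesis using bZ(2) bI(2) by linarith
  qed
  have "(\<lambda>k. 2 * C * sqrt (inverse (real (Suc k)))) \<longlonglongrightarrow> 2 * C * sqrt 0"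
    by (intro tendsto_intros LIMSEQ_inverse_real_of_nat)
  moreover have "\<bar>\<integral>\<omega>. G \<omega> * ?J \<omega> \<partial>M\<bar> \<le> 2 * C * sqrt (inverse (real (Suc k)))" for k
    by (rule le) simp
  ultimately have "\<bar>\<integral>\<omega>. G \<omega> * ?J \<omega> \<partial>M\<bar> \<le> 2 * C * sqrt 0"
    using LIMSEQ_le_const by blast
  then show ?thesis by simp
qed

text \<open>Setting \<open>G\<close> to 0 where it exceeds \<open>k\<close> keeps it known at time
  \<open>s\<close>, and the products are dominated by the absolute value of the full product, which
  is integrable by Cauchy-Schwarz.\<close>

lemma ito_increment_orthogonal:
  assumes Is: "has_ito_integral M F B H a s Js" and It: "has_ito_integral M F B H a t Jt"
    and ast: "0 \<le> a" "a \<le> s" "s \<le> t"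
    and fin: "(\<integral>\<^sup>+\<omega>. nn_square lborel (\<lambda>r. indicator {s<..t} r * H r \<omega>) \<partial>M) < \<infinity>"
    and G: "G \<in> borel_measurable (F s)" "square_integrable M G"
  shows "(\<integral>\<omega>. G \<omega> * (Jt \<omega> - Js \<omega>) \<partial>M) = 0"
proof -
  let ?J = "\<lambda>\<omega>. Jt \<omega> - Js \<omega>"
  have Jm [measurable]: "?J \<in> borel_measurable M"
    using Is It by (auto simp: has_ito_integral_def)
  note Gm [measurable] = measurable_from_F[OF G(1)]
  note J2 = le_less_trans[OF ito_increment_square_bound[OF Is It ast] fin]
  have J2i: "square_integrable M ?J" using J2 by (intro integrableI_bounded) auto
  define g where "g = (\<lambda>k::nat. \<lambda>\<omega>. if \<bar>G \<omega>\<bar> \<le> real k then G \<omega> else 0)"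
  have gF: "g k \<in> borel_measurable (F s)" for k unfolding g_def using G(1) by measurable
  note [measurable] = measurable_from_F[OF gF]
  have "(\<lambda>k. \<integral>\<omega>. g k \<omega> * ?J \<omega> \<partial>M) \<longlonglongrightarrow> (\<integral>\<omega>. G \<omega> * ?J \<omega> \<partial>M)"
  proof (rule integral_dominated_convergence[where w="\<lambda>\<omega>. \<bar>G \<omega> * ?J \<omega>\<bar>"])
    show "integrable M (\<lambda>\<omega>. \<bar>G \<omega> * ?J \<omega>\<bar>)"
      using Cauchy_Schwarz_expectation(1)[OF Gm Jm G(2) J2i] by (rule integrable_abs)
    show "AE \<omega> in M. norm (g k \<omega> * ?J \<omega>) \<le> \<bar>G \<omega> * ?J \<omega>\<bar>" for k by (auto simp: g_def)
    show "AE \<omega> in M. (\<lambda>k. g k \<omega> * ?J \<omega>) \<longlonglongrightarrow> G \<omega> * ?J \<omega>"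
    proof (intro AE_I2 tendsto_mult tendsto_const)
      fix \<omega>
      obtain K where "\<bar>G \<omega>\<bar> \<le> real K" using real_arch_simple by blast
      then have "\<forall>\<^sub>F k in sequentially. G \<omega> = g k \<omega>"
        unfolding eventually_sequentially g_def by (intro exI[of _ K]) auto
      from Lim_transform_eventually[OF tendsto_const this] show "(\<lambda>k. g k \<omega>) \<longlonglongrightarrow> G \<omega>" .
    qed
  qed auto
  moreover have "(\<integral>\<omega>. g k \<omega> * ?J \<omega> \<partial>M) = 0" for k
    by (rule ito_increment_orthogonal_bounded[OF Is It ast fin gF, of _ "real k"]) (auto simp: g_def)
  ultimately show ?thesis by (simp add: LIMSEQ_const_iff)
qed

end

subsection \<open>Moments of the linear equation\<close>

text \<open>Cauchy-Schwarz against the indicator of the interval. If \<open>f\<close> is not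
  integrable there, its Bochner integral is 0 by convention and the bound is trivial.\<close>

lemma ennreal_set_integral_sq_le:
  fixes f :: "real \<Rightarrow> real"
  assumes m: "(\<lambda>r. indicator {s..t} r * f r) \<in> borel_measurable lborel" and st: "s \<le> t"
  shows "ennreal ((LINT r:{s..t}|lborel. f r)\<^sup>2) \<le> ennreal (t - s) * nn_square lborel (\<lambda>r. indicator {s..t} r * f r)"
proof -
  let ?g = "\<lambda>r. indicator {s..t} r * f r"
  have "ennreal \<bar>LINT r:{s..t}|lborel. f r\<bar> \<le> (\<integral>\<^sup>+r. ennreal \<bar>?g r\<bar> \<partial>lborel)"
  proof (cases "integrable lborel ?g")
    case True
    then show ?thesis using integral_norm_bound_ennreal[OF True] by (simp add: set_lebesgue_integral_def)
  next
    case False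
    then show ?thesis using not_integrable_integral_eq[OF False] by (simp add: set_lebesgue_integral_def)
  qed
  also have "(\<integral>\<^sup>+r. ennreal \<bar>?g r\<bar> \<partial>lborel) = (\<integral>\<^sup>+r. ennreal \<bar>?g r\<bar> * indicator {s..t} r \<partial>lborel)"
    by (intro nn_integral_cong) (auto simp: indicator_def)
  finally have "(ennreal \<bar>LINT r:{s..t}|lborel. f r\<bar>)\<^sup>2 \<le> (\<integral>\<^sup>+r. ennreal \<bar>?g r\<bar> * indicator {s..t} r \<partial>lborel)\<^sup>2"
    by (intro power_mono) auto
  also have "\<dots> \<le> (\<integral>\<^sup>+r. (ennreal \<bar>?g r\<bar>)\<^sup>2 \<partial>lborel) * (\<integral>\<^sup>+r. (indicator {s..t} r)\<^sup>2 \<partial>lborel)"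
    using m by (intro Cauchy_Schwarz_nn_integral) auto
  also have "(\<integral>\<^sup>+r. (indicator {s..t} r)\<^sup>2 \<partial>lborel) = (\<integral>\<^sup>+r. indicator {s..t} r \<partial>(lborel :: real measure))"
    by (intro nn_integral_cong) (auto simp: indicator_def)
  finally show ?thesis
    using st by (simp add: ennreal_power mult.commute)
qed

text \<open>Let \<open>c\<close> be the first time at which the running integral reaches
  \<open>N\<close>. Before \<open>c\<close> stopping has no effect, and by continuity of the running
  integral the part up to \<open>c\<close> already amounts to \<open>N\<close>. If the level is
  never reached, nothing is stopped at all.\<close>

lemma min_integral_le_stopped_integral:
  fixes f :: "real \<Rightarrow> ennreal"
  assumes [measurable]: "f \<in> borel_measurable lborel"
    and fin: "(\<integral>\<^sup>+r\<in>{a..t}. f r \<partial>lborel) < \<infinity>"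
  shows "min N (\<integral>\<^sup>+r\<in>{a..t}. f r \<partial>lborel)
    \<le> (\<integral>\<^sup>+r\<in>{a..t}. f r * indicator {r. (\<integral>\<^sup>+u\<in>{a..r}. f u \<partial>lborel) < N} r \<partial>lborel)"
proof -
  define Q where "Q r = (\<integral>\<^sup>+u\<in>{a..r}. f u \<partial>lborel)" for r
  define C where "C = {r \<in> {a..t}. N \<le> Q r}"
  show ?thesis
  proof (cases "C = {}")
    case True
    then have lt: "Q r < N" if "r \<in> {a..t}" for r using that by (force simp: C_def)
    have "(\<integral>\<^sup>+r\<in>{a..t}. f r \<partial>lborel) = (\<integral>\<^sup>+r\<in>{a..t}. f r * indicator {r. Q r < N} r \<partial>lborel)"
      by (intro nn_integral_cong) (use lt in \<open>auto simp: indicator_def\<close>)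
    then show ?thesis by (simp add: Q_def)
  next
    case False
    have bdd: "bdd_below C" by (auto simp: C_def)
    define c where "c = Inf C"
    have "\<exists>u\<in>C. u < c + inverse (real (Suc n))" for n
      using False unfolding c_def by (intro cInf_lessD) auto
    then obtain u where u: "\<And>n. u n \<in> C" "\<And>n. u n < c + inverse (real (Suc n))" by metis
    have cu: "c \<le> u n" for n unfolding c_def using u(1) bdd by (intro cInf_lower)
    have lim: "u \<longlonglongrightarrow> c"
    proof (rule tendsto_sandwich[where f="\<lambda>_. c"])
      show "(\<lambda>n. c + inverse (real (Suc n))) \<longlonglongrightarrow> c"
        using LIMSEQ_inverse_real_of_nat_add by auto
      show "\<forall>\<^sub>F n in sequentially. u n \<le> c + inverse (real (Suc n))"
        using u(2) by (intro always_eventually allI less_imp_le)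
    qed (use cu in auto)
    have ac: "a \<le> c" unfolding c_def using False by (intro cInf_greatest) (auto simp: C_def)
    have ct: "c \<le> t" using cu[of 0] u(1)[of 0] by (auto simp: C_def)
    have "(\<lambda>n. Q (u n)) \<longlonglongrightarrow> Q c"
      unfolding Q_def
    proof (rule nn_integral_dominated_convergence[where w="\<lambda>r. f r * indicator {a..t} r"])
      show "AE r in lborel. f r * indicator {a..u n} r \<le> f r * indicator {a..t} r" for n
        using u(1)[of n] by (auto simp: C_def indicator_def)
      show "AE r in lborel. (\<lambda>n. f r * indicator {a..u n} r) \<longlonglongrightarrow> f r * indicator {a..c} r"
      proof (intro AE_I2)
        fix r
        have "\<forall>\<^sub>F n in sequentially. f r * indicator {a..c} r = f r * indicator {a..u n} r"
        proof (cases "r \<le> c")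
          case True
          then have "r \<le> u n" for n using cu[of n] by linarith
          with True show ?thesis by (intro always_eventually) (auto simp: indicator_def)
        next
          case False
          then have "\<forall>\<^sub>F n in sequentially. u n < r" by (intro order_tendstoD(2)[OF lim]) auto
          then show ?thesis by eventually_elim (use False in \<open>auto simp: indicator_def\<close>)
        qed
        from Lim_transform_eventually[OF tendsto_const this]
        show "(\<lambda>n. f r * indicator {a..u n} r) \<longlonglongrightarrow> f r * indicator {a..c} r" .
      qed
    qed (use fin in auto)
    \<comment> \<open>The infimum is attained: the running integral is continuous from the right at
      \<open>c\<close>, and \<open>u\<close> approaches \<open>c\<close> from above within
      \<open>C\<close>.\<close>
    then have "N \<le> Q c" using u(1) by (intro LIMSEQ_le_const[where a=N]) (auto simp: C_def)
    \<comment> \<open>The point \<open>c\<close> is removed since the running integral is below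
      \<open>N\<close> only strictly before \<open>c\<close>; a single point has measure 0.\<close>
    also have "Q c = (\<integral>\<^sup>+r. f r * indicator {a..<c} r \<partial>lborel)"
      unfolding Q_def
    proof (rule nn_integral_cong_AE)
      show "AE r in lborel. f r * indicator {a..c} r = f r * indicator {a..<c} r"
        using AE_lborel_singleton[of c] by eventually_elim (auto simp: indicator_def)
    qed
    also have "\<dots> \<le> (\<integral>\<^sup>+r\<in>{a..t}. f r * indicator {r. Q r < N} r \<partial>lborel)"
    proof (rule nn_integral_mono)
      fix r
      show "f r * indicator {a..<c} r \<le> f r * indicator {r. Q r < N} r * indicator {a..t} r"
      proof (cases "r \<in> {a..<c}")
        case True
        then have "r \<notin> C" using bdd cInf_lower[of r C] by (auto simp: c_def)
        then have "Q r < N" using True ct by (auto simp: C_def)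
        with True ct show ?thesis by (auto simp: indicator_def)
      qed auto
    qed
    finally show ?thesis unfolding Q_def by (rule min.coboundedI1)
  qed
qed

lemma (in prob_space) nn_integral_Fubini_lborel:
  fixes f :: "real \<Rightarrow> 'a \<Rightarrow> ennreal"
  assumes "(\<lambda>(r, \<omega>). f r \<omega>) \<in> borel_measurable (borel \<Otimes>\<^sub>M M)"
  shows "(\<integral>\<^sup>+\<omega>. (\<integral>\<^sup>+r. f r \<omega> \<partial>lborel) \<partial>M) = (\<integral>\<^sup>+r. (\<integral>\<^sup>+\<omega>. f r \<omega> \<partial>M) \<partial>lborel)"
proof -
  interpret P: pair_sigma_finite "lborel :: real measure" M ..
  have "(\<lambda>(r, \<omega>). f r \<omega>) \<in> borel_measurable (lborel \<Otimes>\<^sub>M M)"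
    using assms by (simp cong: measurable_cong_sets sets_pair_measure_cong)
  from P.Fubini[OF this] show ?thesis by simp
qed

section \<open>A priori second moment bound for the linear equation\<close>

locale linear_sde = brownian M F B for M :: "'a measure" and F B +
  fixes Y :: "real \<Rightarrow> 'a \<Rightarrow> real" and a b lam \<sigma> :: real
  assumes a_nonneg: "0 \<le> a" and a_less_b: "a < b"
    and continuous_paths: "AE \<omega> in M. continuous_on {a..b} (\<lambda>t. Y t \<omega>)"
    and Y_adapted: "\<And>t. t \<in> {a..b} \<Longrightarrow> Y t \<in> borel_measurable (F t)"
    and initial: "square_integrable M (Y a)"
    and sde: "\<And>t. t \<in> {a..<b} \<Longrightarrow> \<exists>J. has_ito_integral M F B Y a t J \<and>
      (AE \<omega> in M. Y t \<omega> = Y a \<omega> - lam * (LINT r:{a..t}|lborel. Y r \<omega>) + \<sigma> * J \<omega>)"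
begin

text \<open>The equation only provides, for each time separately, some version of the integral.
  Fixing one version per time is enough: increments are related through
  \<open>ito_increment_limit\<close>, and regularity of \<open>J\<close> in time is never asked
  for.\<close>

definition J :: "real \<Rightarrow> 'a \<Rightarrow> real" where
  "J t = (SOME J. has_ito_integral M F B Y a t J \<and>
      (AE \<omega> in M. Y t \<omega> = Y a \<omega> - lam * (LINT r:{a..t}|lborel. Y r \<omega>) + \<sigma> * J \<omega>))"

lemma J:
  assumes "t \<in> {a..<b}"
  shows "has_ito_integral M F B Y a t (J t)"
    "AE \<omega> in M. Y t \<omega> = Y a \<omega> - lam * (LINT r:{a..t}|lborel. Y r \<omega>) + \<sigma> * J t \<omega>"
  using someI_ex[OF sde[OF assms], folded J_def] by auto

lemma J_measurable [measurable]: "t \<in> {a..<b} \<Longrightarrow> J t \<in> borel_measurable M"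
  using J(1) by (auto simp: has_ito_integral_def)

lemma Y_measurable: "t \<in> {a..b} \<Longrightarrow> Y t \<in> borel_measurable M"
  using Y_adapted measurable_from_F by blast

lemma J_limit:
  "t \<in> {a..<b} \<Longrightarrow> ito_limit a t (\<lambda>s \<omega>. indicator {a..t} s * Y s \<omega>) (J t)"
  using has_ito_integral_imp_ito_limit[OF J(1) a_nonneg] by auto

lemma Y_joint_measurable:
  assumes "t \<in> {a..<b}"
  shows "(\<lambda>(s, \<omega>). indicator {a..t} s * Y s \<omega>) \<in> borel_measurable (borel \<Otimes>\<^sub>M M)"
  using J_limit[OF assms] by (simp add: ito_limit_def)

definition Q :: "real \<Rightarrow> 'a \<Rightarrow> ennreal" where
  "Q t \<omega> = nn_square lborel (\<lambda>r. indicator {a..t} r * Y r \<omega>)"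

lemma Q_measurable: "t \<in> {a..<b} \<Longrightarrow> Q t \<in> borel_measurable M"
  unfolding Q_def[abs_def] by (rule measurable_sq_integral[OF Y_joint_measurable])

lemma Q_finite: "t \<in> {a..<b} \<Longrightarrow> AE \<omega> in M. Q t \<omega> < \<infinity>"
  using J_limit by (simp add: ito_limit_def Q_def)

lemma drift_bound:
  assumes t: "t \<in> {a..<b}" and w: "\<omega> \<in> space M"
  shows "ennreal ((LINT r:{a..t}|lborel. Y r \<omega>)\<^sup>2) \<le> ennreal (b - a) * Q t \<omega>"
proof -
  have "ennreal ((LINT r:{a..t}|lborel. Y r \<omega>)\<^sup>2) \<le> ennreal (t - a) * Q t \<omega>"
    unfolding Q_def using t
    by (intro ennreal_set_integral_sq_le measurable_slice[OF Y_joint_measurable w]) auto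
  also have "\<dots> \<le> ennreal (b - a) * Q t \<omega>" using t by (intro mult_right_mono ennreal_leI) auto
  finally show ?thesis .
qed

text \<open>Stopping on the level of the energy \<open>Q\<close>, instead of the path, keeps every quantity in the
  Gronwall argument finite, as no integrability of \<open>Y t\<close> is known yet for \<open>t > a\<close>.\<close>

definition stopped_moment :: "real \<Rightarrow> real \<Rightarrow> ennreal" where
  "stopped_moment N t = (\<integral>\<^sup>+\<omega>. ennreal ((Y t \<omega>)\<^sup>2) * indicator {\<omega>. Q t \<omega> < ennreal N} \<omega> \<partial>M)"

text \<open>The threes come from the square of a sum of three terms, and \<open>b - a\<close> from
  Cauchy-Schwarz for the drift. Adding 1 makes the constant positive whatever \<open>lam\<close> and
  \<open>\<sigma>\<close> are, so that it may be divided by.\<close>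

definition gronwall_const :: real where
  "gronwall_const = 3 * lam\<^sup>2 * (b - a) + 3 * \<sigma>\<^sup>2 + 1"

lemma gronwall_const_pos: "0 < gronwall_const"
  unfolding gronwall_const_def using a_less_b by (intro add_nonneg_pos add_nonneg_nonneg) auto

text \<open>On the event \<open>Q t < N\<close> the minimum equals \<open>Q t\<close>, which bounds
  the squared drift up to the factor \<open>b - a\<close>; the noise is covered by
  \<open>ito_limit_stopped_bound\<close>. The right side is finite since the minimum is at most
  \<open>N\<close>.\<close>

lemma stopped_moment_le:
  assumes t: "t \<in> {a..<b}" and N: "0 < N"
  shows "stopped_moment N t \<le> ennreal (3 * mean_square M (Y a))
    + ennreal gronwall_const * (\<integral>\<^sup>+\<omega>. min (ennreal N) (Q t \<omega>) \<partial>M)"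
proof -
  note [measurable] = Q_measurable[OF t] J_measurable[OF t]
  have [measurable]: "Y a \<in> borel_measurable M" using Y_measurable a_less_b by auto
  let ?m = "\<lambda>\<omega>. min (ennreal N) (Q t \<omega>)" and ?i = "\<lambda>\<omega>. indicator {\<omega>. Q t \<omega> < ennreal N} \<omega> :: ennreal"
  have "stopped_moment N t \<le> (\<integral>\<^sup>+\<omega>. 3 * ennreal ((Y a \<omega>)\<^sup>2) + ennreal (3 * lam\<^sup>2 * (b - a)) * ?m \<omega>
      + ennreal (3 * \<sigma>\<^sup>2) * (ennreal ((J t \<omega>)\<^sup>2) * ?i \<omega>) \<partial>M)"
    unfolding stopped_moment_def
  proof (rule nn_integral_mono_AE)
    show "AE \<omega> in M. ennreal ((Y t \<omega>)\<^sup>2) * ?i \<omega> \<le> 3 * ennreal ((Y a \<omega>)\<^sup>2)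
      + ennreal (3 * lam\<^sup>2 * (b - a)) * ?m \<omega> + ennreal (3 * \<sigma>\<^sup>2) * (ennreal ((J t \<omega>)\<^sup>2) * ?i \<omega>)"
      using J(2)[OF t] AE_space
    proof eventually_elim
      case (elim \<omega>)
      show ?case
      proof (cases "Q t \<omega> < ennreal N")
        case True
        define P where "P = (LINT r:{a..t}|lborel. Y r \<omega>)"
        have "(x - lam * p + \<sigma> * j)\<^sup>2 \<le> 3 * x\<^sup>2 + 3 * lam\<^sup>2 * p\<^sup>2 + 3 * \<sigma>\<^sup>2 * j\<^sup>2" for x p j
        proof -
          have "0 \<le> (x + lam * p)\<^sup>2 + (x - \<sigma> * j)\<^sup>2 + (lam * p + \<sigma> * j)\<^sup>2" by simp
          then show ?thesis by (simp add: power2_eq_square algebra_simps)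
        qed
        then have "(Y t \<omega>)\<^sup>2 \<le> 3 * (Y a \<omega>)\<^sup>2 + 3 * lam\<^sup>2 * P\<^sup>2 + 3 * \<sigma>\<^sup>2 * (J t \<omega>)\<^sup>2"
          using elim(1) by (simp add: P_def)
        then have "ennreal ((Y t \<omega>)\<^sup>2) \<le> ennreal (3 * (Y a \<omega>)\<^sup>2 + 3 * lam\<^sup>2 * P\<^sup>2 + 3 * \<sigma>\<^sup>2 * (J t \<omega>)\<^sup>2)"
          by (rule ennreal_leI)
        also have "\<dots> = 3 * ennreal ((Y a \<omega>)\<^sup>2) + ennreal (3 * lam\<^sup>2) * ennreal (P\<^sup>2) + ennreal (3 * \<sigma>\<^sup>2) * ennreal ((J t \<omega>)\<^sup>2)"
          by (simp add: ennreal_mult)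
        also have "\<dots> \<le> 3 * ennreal ((Y a \<omega>)\<^sup>2) + ennreal (3 * lam\<^sup>2) * (ennreal (b - a) * Q t \<omega>) + ennreal (3 * \<sigma>\<^sup>2) * ennreal ((J t \<omega>)\<^sup>2)"
          unfolding P_def by (intro add_right_mono add_left_mono mult_left_mono drift_bound[OF t elim(2)]) auto
        finally show ?thesis
          using True a_less_b by (simp add: ennreal_mult mult.assoc[symmetric] min_absorb2)
      qed simp
    qed
  qed
  also have "\<dots> = 3 * nn_square M (Y a) + ennreal (3 * lam\<^sup>2 * (b - a)) * (\<integral>\<^sup>+\<omega>. ?m \<omega> \<partial>M)
      + ennreal (3 * \<sigma>\<^sup>2) * (\<integral>\<^sup>+\<omega>. ennreal ((J t \<omega>)\<^sup>2) * ?i \<omega> \<partial>M)"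
    by (simp add: nn_integral_add nn_integral_cmult)
  also have "\<dots> \<le> 3 * nn_square M (Y a) + ennreal (3 * lam\<^sup>2 * (b - a)) * (\<integral>\<^sup>+\<omega>. ?m \<omega> \<partial>M)
      + ennreal (3 * \<sigma>\<^sup>2) * (\<integral>\<^sup>+\<omega>. ?m \<omega> \<partial>M)"
    using ito_limit_stopped_bound[OF J_limit[OF t] a_nonneg N]
    by (intro add_left_mono mult_left_mono) (simp_all add: Q_def)
  also have "\<dots> \<le> ennreal (3 * mean_square M (Y a)) + ennreal gronwall_const * (\<integral>\<^sup>+\<omega>. ?m \<omega> \<partial>M)"
  proof -
    have "ennreal (3 * lam\<^sup>2 * (b - a)) + ennreal (3 * \<sigma>\<^sup>2) \<le> ennreal gronwall_const"
      using a_less_b by (subst ennreal_plus[symmetric]) (auto simp: gronwall_const_def intro!: ennreal_leI)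
    then have "ennreal (3 * lam\<^sup>2 * (b - a)) * (\<integral>\<^sup>+\<omega>. ?m \<omega> \<partial>M) + ennreal (3 * \<sigma>\<^sup>2) * (\<integral>\<^sup>+\<omega>. ?m \<omega> \<partial>M)
        \<le> ennreal gronwall_const * (\<integral>\<^sup>+\<omega>. ?m \<omega> \<partial>M)"
      unfolding distrib_right[symmetric] by (rule mult_right_mono) auto
    moreover have "3 * nn_square M (Y a) = ennreal (3 * mean_square M (Y a))"
      using initial by (simp add: nn_integral_eq_integral ennreal_mult)
    ultimately show ?thesis unfolding add.assoc by (metis add_left_mono)
  qed
  finally show ?thesis .
qed

text \<open>This closes the Gronwall loop. Path by path the minimum is at most the integral of
  \<open>(Y r)\<^sup>2\<close> over the times with \<open>Q r < N\<close>, that is, stopped at the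
  running energy and not at the terminal one; Fubini then turns the inner expectation into
  \<open>stopped_moment N r\<close>.\<close>

lemma min_Q_le_integral_stopped_moment:
  assumes t: "t \<in> {a..<b}"
  shows "(\<integral>\<^sup>+\<omega>. min (ennreal N) (Q t \<omega>) \<partial>M) \<le> (\<integral>\<^sup>+r\<in>{a..t}. stopped_moment N r \<partial>lborel)"
proof -
  define U where "U = (\<lambda>r \<omega>. ennreal ((indicator {a..t} r * Y r \<omega>)\<^sup>2))"
  \<comment> \<open>A jointly measurable substitute for \<open>Q\<close>: the path is cut off once
    at the fixed time \<open>t\<close>, up to which joint measurability is known, and
    \<open>q\<close> agrees with \<open>Q\<close> on \<open>{a..t}\<close>.\<close>
  define q where "q = (\<lambda>s \<omega>. \<integral>\<^sup>+r. U r \<omega> * indicator {a..s} r \<partial>lborel)"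
  have Um: "(\<lambda>(r, \<omega>). U r \<omega>) \<in> borel_measurable (borel \<Otimes>\<^sub>M M)"
    using Y_joint_measurable[OF t] by (simp add: U_def split_beta')
  have qm [measurable]: "(\<lambda>(s, \<omega>). q s \<omega>) \<in> borel_measurable (borel \<Otimes>\<^sub>M M)"
  proof -
    have "(\<lambda>x. (snd x, snd (fst x))) \<in> measurable ((borel \<Otimes>\<^sub>M M) \<Otimes>\<^sub>M lborel) (borel \<Otimes>\<^sub>M M)"
      by measurable
    from measurable_compose[OF this Um]
    have [measurable]: "(\<lambda>x. U (snd x) (snd (fst x))) \<in> borel_measurable ((borel \<Otimes>\<^sub>M M) \<Otimes>\<^sub>M lborel)"
      by simp
    have [measurable]: "(\<lambda>x. indicator {a..fst (fst x)} (snd x) :: ennreal) \<in> borel_measurable (((borel :: real measure) \<Otimes>\<^sub>M M) \<Otimes>\<^sub>M lborel)"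
    proof -
      have "(\<lambda>x. indicator {a..fst (fst x)} (snd x) :: ennreal)
          = (\<lambda>x::(real \<times> 'a) \<times> real. if a \<le> snd x \<and> snd x \<le> fst (fst x) then 1 else 0)"
        by (auto simp: indicator_def)
      also have "\<dots> \<in> borel_measurable (((borel :: real measure) \<Otimes>\<^sub>M M) \<Otimes>\<^sub>M lborel)" by measurable
      finally show ?thesis .
    qed
    have "(\<lambda>x. \<integral>\<^sup>+r. U r (snd x) * indicator {a..fst x} r \<partial>lborel) \<in> borel_measurable (borel \<Otimes>\<^sub>M M)"
      by (rule lborel.borel_measurable_nn_integral) (simp add: split_beta')
    then show ?thesis by (simp add: q_def split_beta')
  qed
  have qQ: "q s \<omega> = Q s \<omega>" if "s \<in> {a..t}" for s \<omega>
    unfolding q_def Q_def U_def using that by (intro nn_integral_cong) (auto simp: indicator_def)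
  have "(\<integral>\<^sup>+\<omega>. min (ennreal N) (Q t \<omega>) \<partial>M)
      \<le> (\<integral>\<^sup>+\<omega>. (\<integral>\<^sup>+r. U r \<omega> * indicator {r. q r \<omega> < ennreal N} r * indicator {a..t} r \<partial>lborel) \<partial>M)"
  proof (rule nn_integral_mono_AE)
    show "AE \<omega> in M. min (ennreal N) (Q t \<omega>)
      \<le> (\<integral>\<^sup>+r. U r \<omega> * indicator {r. q r \<omega> < ennreal N} r * indicator {a..t} r \<partial>lborel)"
      using Q_finite[OF t] AE_space
    proof eventually_elim
      case (elim \<omega>)
      have m: "(\<lambda>r. U r \<omega>) \<in> borel_measurable lborel"
        using measurable_slice[OF Y_joint_measurable[OF t] elim(2)] by (simp add: U_def)
      have "q t \<omega> = Q t \<omega>" using qQ t by auto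
      then show ?case
        using min_integral_le_stopped_integral[OF m, of a t "ennreal N"] elim(1)
        by (simp add: q_def)
    qed
  qed
  also have "\<dots> = (\<integral>\<^sup>+r. (\<integral>\<^sup>+\<omega>. U r \<omega> * indicator {r. q r \<omega> < ennreal N} r * indicator {a..t} r \<partial>M) \<partial>lborel)"
  proof (rule nn_integral_Fubini_lborel)
    have [measurable]: "(\<lambda>x. indicator {r. q r (snd x) < ennreal N} (fst x) :: ennreal) \<in> borel_measurable (borel \<Otimes>\<^sub>M M)"
    proof -
      have "(\<lambda>x. indicator {r. q r (snd x) < ennreal N} (fst x) :: ennreal)
          = (\<lambda>x. if (case x of (s, \<omega>) \<Rightarrow> q s \<omega>) < ennreal N then 1 else 0)"
        by (auto simp: indicator_def)
      also have "\<dots> \<in> borel_measurable (borel \<Otimes>\<^sub>M M)" by measurable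
      finally show ?thesis .
    qed
    show "(\<lambda>(r, \<omega>). U r \<omega> * indicator {r. q r \<omega> < ennreal N} r * indicator {a..t} r) \<in> borel_measurable (borel \<Otimes>\<^sub>M M)"
      using Um unfolding split_beta' by measurable
  qed
  also have "\<dots> = (\<integral>\<^sup>+r\<in>{a..t}. stopped_moment N r \<partial>lborel)"
  proof (intro nn_integral_cong)
    fix r
    show "(\<integral>\<^sup>+\<omega>. U r \<omega> * indicator {r. q r \<omega> < ennreal N} r * indicator {a..t} r \<partial>M)
        = stopped_moment N r * indicator {a..t} r"
      using qQ[of r] by (cases "r \<in> {a..t}") (auto simp: stopped_moment_def U_def indicator_def)
  qed
  finally show ?thesis .
qed

text \<open>What matters is that the bound does not involve \<open>N\<close>, so that it survives
  when the truncation level tends to infinity.\<close>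

lemma stopped_moment_bound:
  assumes t: "t \<in> {a..<b}" and N: "0 < N"
  shows "stopped_moment N t \<le> ennreal (6 * mean_square M (Y a) * exp (2 * gronwall_const * b))"
proof -
  define A where "A = 3 * mean_square M (Y a)"
  have A: "0 \<le> A" by (simp add: A_def)
  define c where "c = 2 * gronwall_const"
  have c: "0 < c" using gronwall_const_pos by (simp add: c_def)
  \<comment> \<open>Gronwall's inequality: the weight \<open>exp (- c r)\<close> makes \<open>S \<le> A + S / 2\<close> with \<open>S\<close> finite.\<close>
  define S where "S = (SUP r\<in>{a..t}. stopped_moment N r * ennreal (exp (- c * r)))"
  have Sle: "stopped_moment N r * ennreal (exp (- c * r)) \<le> S" if "r \<in> {a..t}" for r
    unfolding S_def using that by (rule SUP_upper)
  have Sexp: "stopped_moment N r \<le> S * ennreal (exp (c * r))" if "r \<in> {a..t}" for r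
  proof -
    have "stopped_moment N r = stopped_moment N r * ennreal (exp (- c * r)) * ennreal (exp (c * r))"
      by (simp add: mult.assoc exp_minus flip: ennreal_mult)
    also have "\<dots> \<le> S * ennreal (exp (c * r))" by (intro mult_right_mono Sle that) auto
    finally show ?thesis .
  qed
  have exp1: "exp (- c * r) \<le> 1" if "a \<le> r" for r using that a_nonneg c by simp
  have "S \<le> ennreal A + S * ennreal (1 / 2)"
    unfolding S_def
  proof (rule SUP_least)
    fix s assume s: "s \<in> {a..t}"
    then have s': "s \<in> {a..<b}" using t by auto
    have "(\<integral>\<^sup>+r\<in>{a..s}. stopped_moment N r \<partial>lborel) \<le> (\<integral>\<^sup>+r. S * (ennreal (exp (c * r)) * indicator {a..s} r) \<partial>lborel)"
      using s by (intro nn_integral_mono) (auto simp: indicator_def intro!: Sexp)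
    also have "\<dots> = S * (\<integral>\<^sup>+r. ennreal (exp (c * r)) * indicator {a..s} r \<partial>lborel)"
      by (intro nn_integral_cmult) auto
    also have "(\<integral>\<^sup>+r. ennreal (exp (c * r)) * indicator {a..s} r \<partial>lborel) = ennreal (exp (c * s) / c - exp (c * a) / c)"
      using s c by (intro nn_integral_FTC_Icc) (auto intro!: derivative_eq_intros)
    also have "S * \<dots> \<le> S * ennreal (exp (c * s) / c)"
      using c by (intro mult_left_mono ennreal_leI) auto
    finally have i: "(\<integral>\<^sup>+r\<in>{a..s}. stopped_moment N r \<partial>lborel) \<le> S * ennreal (exp (c * s) / c)" .
    have "stopped_moment N s \<le> ennreal A + ennreal gronwall_const * (\<integral>\<^sup>+\<omega>. min (ennreal N) (Q s \<omega>) \<partial>M)"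
      unfolding A_def by (rule stopped_moment_le[OF s' N])
    also have "\<dots> \<le> ennreal A + ennreal gronwall_const * (S * ennreal (exp (c * s) / c))"
      using order_trans[OF min_Q_le_integral_stopped_moment[OF s'] i] by (intro add_left_mono mult_left_mono) auto
    finally have "stopped_moment N s * ennreal (exp (- c * s))
        \<le> (ennreal A + ennreal gronwall_const * (S * ennreal (exp (c * s) / c))) * ennreal (exp (- c * s))"
      by (rule mult_right_mono) auto
    also have "\<dots> = ennreal A * ennreal (exp (- c * s)) + S * (ennreal gronwall_const * ennreal (exp (c * s) / c) * ennreal (exp (- c * s)))"
      by (simp add: ring_distribs mult_ac)
    also have "ennreal gronwall_const * ennreal (exp (c * s) / c) * ennreal (exp (- c * s)) = ennreal (1 / 2)"
      using c gronwall_const_pos by (simp add: c_def exp_minus field_simps flip: ennreal_mult)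
    also have "ennreal A * ennreal (exp (- c * s)) + S * ennreal (1 / 2) \<le> ennreal A + S * ennreal (1 / 2)"
      using mult_left_mono[of "ennreal (exp (- c * s))" 1 "ennreal A"] exp1[of s] s by (intro add_right_mono) auto
    finally show "stopped_moment N s * ennreal (exp (- c * s)) \<le> ennreal A + (SUP r\<in>{a..t}. stopped_moment N r * ennreal (exp (- c * r))) * ennreal (1 / 2)"
      unfolding S_def .
  qed
  \<comment> \<open>Finiteness allows \<open>S / 2\<close> to be subtracted. It comes from bounding
    the minimum by \<open>N\<close>; this bound depends on \<open>N\<close>, but it is only used
    qualitatively.\<close>
  moreover have "S < \<infinity>"
  proof -
    have "S \<le> ennreal A + ennreal gronwall_const * ennreal N"
      unfolding S_def
    proof (rule SUP_least)
      fix s assume s: "s \<in> {a..t}"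
      then have s': "s \<in> {a..<b}" using t by auto
      have "stopped_moment N s * ennreal (exp (- c * s)) \<le> stopped_moment N s * 1"
        using exp1[of s] s by (intro mult_left_mono) auto
      also have "\<dots> \<le> ennreal A + ennreal gronwall_const * (\<integral>\<^sup>+\<omega>. min (ennreal N) (Q s \<omega>) \<partial>M)"
        unfolding A_def using stopped_moment_le[OF s' N] by simp
      also have "\<dots> \<le> ennreal A + ennreal gronwall_const * (\<integral>\<^sup>+\<omega>. ennreal N \<partial>M)"
        by (intro add_left_mono mult_left_mono nn_integral_mono) auto
      finally show "stopped_moment N s * ennreal (exp (- c * s)) \<le> ennreal A + ennreal gronwall_const * ennreal N"
        by (simp add: emeasure_space_1)
    qed
    also have "\<dots> < \<infinity>" by (simp add: ennreal_mult_less_top)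
    finally show ?thesis .
  qed
  ultimately have S: "S \<le> ennreal (2 * A)"
  proof -
    assume le: "S \<le> ennreal A + S * ennreal (1 / 2)" and fin: "S < \<infinity>"
    obtain r where r: "S = ennreal r" "0 \<le> r" using fin by (cases S) auto
    have "ennreal A + S * ennreal (1 / 2) = ennreal (A + r * (1 / 2))"
      using r A by (simp only: ennreal_mult[symmetric] ennreal_plus[symmetric] mult_nonneg_nonneg)
    then have "ennreal r \<le> ennreal (A + r * (1 / 2))" using le r(1) by (simp only:)
    then have "r \<le> A + r * (1 / 2)" using r A by (subst (asm) ennreal_le_iff) auto
    then show ?thesis using r by (auto intro: ennreal_leI)
  qed
  have "stopped_moment N t \<le> S * ennreal (exp (c * t))" using Sexp t by auto
  also have "\<dots> \<le> ennreal (2 * A) * ennreal (exp (c * b))"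
    using S c t by (intro mult_mono ennreal_leI) auto
  also have "\<dots> = ennreal (6 * mean_square M (Y a) * exp (2 * gronwall_const * b))"
    using A by (simp add: A_def c_def flip: ennreal_mult)
  finally show ?thesis .
qed

lemma second_moment_bounded:
  obtains K where "0 < K" "\<And>t. t \<in> {a..<b} \<Longrightarrow> (nn_square M (Y t)) \<le> ennreal K"
proof -
  let ?K = "6 * mean_square M (Y a) * exp (2 * gronwall_const * b)"
  have bd: "nn_square M (Y t) \<le> ennreal ?K" if t: "t \<in> {a..<b}" for t
  proof (rule nn_integral_le_truncated[OF _ Q_measurable[OF t] Q_finite[OF t]])
    show "(\<lambda>\<omega>. ennreal ((Y t \<omega>)\<^sup>2)) \<in> borel_measurable M" using Y_measurable[of t] t by auto
    show "(\<integral>\<^sup>+\<omega>. ennreal ((Y t \<omega>)\<^sup>2) * indicator {\<omega>. Q t \<omega> < ennreal (real (Suc k))} \<omega> \<partial>M) \<le> ennreal ?K" for k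
      using stopped_moment_bound[OF t, of "real (Suc k)"] unfolding stopped_moment_def by simp
  qed
  have "nn_square M (Y t) \<le> ennreal (?K + 1)" if "t \<in> {a..<b}" for t
    by (rule order_trans[OF bd[OF that] ennreal_leI]) simp
  moreover have "0 < ?K + 1" by (intro add_nonneg_pos) auto
  ultimately show thesis by (rule that[rotated])
qed

end

text \<open>Over \<open>n + 1\<close> equal steps of length \<open>h\<close> the errors add up to
  \<open>C * (T - a) * sqrt h\<close>, which vanishes as \<open>n\<close> grows: an increment bound
  with exponent above 1 forbids any net growth.\<close>

lemma nonincreasing_of_Hoelder:
  fixes v :: "real \<Rightarrow> real"
  assumes le: "\<And>s t. a \<le> s \<Longrightarrow> s \<le> t \<Longrightarrow> t \<le> T \<Longrightarrow> v t - v s \<le> C * ((t - s) * sqrt (t - s))" and aT: "a \<le> T"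
  shows "v T \<le> v a"
proof -
  have bd: "v T - v a \<le> C * ((T - a) * sqrt ((T - a) * inverse (real (Suc n))))" for n
  proof -
    define h where "h = (T - a) * inverse (real (Suc n))"
    define x where "x i = a + real i * h" for i
    have h: "0 \<le> h" "real (Suc n) * h = T - a" using aT by (auto simp: h_def)
    have "v T - v a = v (x (Suc n)) - v (x 0)" using h(2) by (simp add: x_def)
    also have "\<dots> = (\<Sum>i<Suc n. v (x (Suc i)) - v (x i))" by (rule sum_lessThan_telescope[symmetric])
    also have "\<dots> \<le> (\<Sum>i<Suc n. C * (h * sqrt h))"
    proof (rule sum_mono)
      fix i assume "i \<in> {..<Suc n}"
      then have "real (Suc i) \<le> real (Suc n)" by simp
      then have "real (Suc i) * h \<le> real (Suc n) * h" using h by (intro mult_right_mono)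
      then have "x (Suc i) \<le> T" using h(2) by (simp add: x_def)
      moreover have "a \<le> x i" using h(1) by (simp add: x_def)
      moreover have "x (Suc i) - x i = h" by (simp add: x_def algebra_simps)
      ultimately show "v (x (Suc i)) - v (x i) \<le> C * (h * sqrt h)"
        using le[of "x i" "x (Suc i)"] h(1) by simp
    qed
    also have "\<dots> = C * (real (Suc n) * h * sqrt h)" by simp
    finally show ?thesis unfolding h(2) unfolding h_def .
  qed
  have "(\<lambda>n. C * ((T - a) * sqrt ((T - a) * inverse (real (Suc n))))) \<longlonglongrightarrow> C * ((T - a) * sqrt ((T - a) * 0))"
    by (intro tendsto_intros LIMSEQ_inverse_real_of_nat)
  then have "v T - v a \<le> C * ((T - a) * sqrt ((T - a) * 0))"
    using bd LIMSEQ_le_const by blast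
  then show ?thesis by simp
qed

lemma exp_mult_exp_mult: "exp x * (exp y * z) = exp (x + y) * (z :: real)"
  by (simp add: exp_add)

text \<open>With the integrating factor \<open>exp (- k * t)\<close> the claim becomes monotonicity.
  Since \<open>u \<ge> 0\<close>, the step factor \<open>1 + k * h\<close> may be replaced by the
  larger \<open>exp (k * h)\<close> for either sign of \<open>k\<close>.\<close>

lemma Euler_upper_bound:
  fixes u :: "real \<Rightarrow> real"
  assumes le: "\<And>s t. a \<le> s \<Longrightarrow> s \<le> t \<Longrightarrow> t \<le> T \<Longrightarrow> u t \<le> (1 + k * (t - s)) * u s + C * ((t - s) * sqrt (t - s))"
    and u: "\<And>t. a \<le> t \<Longrightarrow> t \<le> T \<Longrightarrow> 0 \<le> u t" and aT: "a \<le> T" and C: "0 \<le> C"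
  shows "u T \<le> exp (k * (T - a)) * u a"
proof -
  define E where "E = exp (\<bar>k\<bar> * (\<bar>a\<bar> + \<bar>T\<bar>))"
  have E: "exp (- k * t) \<le> E" if "a \<le> t" "t \<le> T" for t
  proof -
    have "- k * t \<le> \<bar>k\<bar> * \<bar>t\<bar>" by (metis abs_ge_self abs_minus_cancel abs_mult)
    also have "\<dots> \<le> \<bar>k\<bar> * (\<bar>a\<bar> + \<bar>T\<bar>)" using that by (intro mult_left_mono) auto
    finally show ?thesis by (simp add: E_def)
  qed
  have "exp (- k * T) * u T \<le> exp (- k * a) * u a"
  proof (rule nonincreasing_of_Hoelder[OF _ aT])
    fix s t assume st: "a \<le> s" "s \<le> t" "t \<le> T"
    define h where "h = t - s"
    have "(1 + k * h) * u s \<le> exp (k * h) * u s"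
      using st by (intro mult_right_mono exp_ge_add_one_self u) auto
    then have "u t \<le> exp (k * h) * u s + C * (h * sqrt h)"
      using le[OF st] by (simp add: h_def)
    then have "exp (- k * t) * u t \<le> exp (- k * t) * (exp (k * h) * u s + C * (h * sqrt h))"
      by (intro mult_left_mono) auto
    also have "\<dots> = exp (- k * s) * u s + exp (- k * t) * (C * (h * sqrt h))"
      unfolding distrib_left exp_mult_exp_mult by (simp add: h_def algebra_simps)
    also have "\<dots> \<le> exp (- k * s) * u s + E * (C * (h * sqrt h))"
      using E[of t] st C by (intro add_left_mono mult_right_mono) (auto simp: h_def)
    finally show "exp (- k * t) * u t - exp (- k * s) * u s \<le> E * C * ((t - s) * sqrt (t - s))"
      by (simp add: h_def mult.assoc)
  qed
  then have "exp (k * T) * (exp (- k * T) * u T) \<le> exp (k * T) * (exp (- k * a) * u a)"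
    by (intro mult_left_mono) auto
  then show ?thesis unfolding exp_mult_exp_mult by (simp add: algebra_simps)
qed

lemma exp_Euler_error:
  fixes x :: real
  shows "\<bar>1 + x - exp x\<bar> \<le> x\<^sup>2 * exp \<bar>x\<bar>"
proof -
  have "exp x - (1 + x) \<le> x\<^sup>2 * exp \<bar>x\<bar>"
  proof -
    have "1 - x \<le> exp (- x)" using exp_ge_add_one_self[of "- x"] by simp
    then have "(1 - x) * exp x \<le> exp (- x) * exp x" by (intro mult_right_mono) auto
    then have "exp x - 1 \<le> x * exp x" by (simp add: algebra_simps flip: exp_add)
    then have "exp x - (1 + x) \<le> x * (exp x - 1)" by (simp add: algebra_simps)
    also have "\<dots> \<le> x\<^sup>2 * exp \<bar>x\<bar>"
    proof (cases "0 \<le> x")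
      case True
      then have "x * (exp x - 1) \<le> x * (x * exp x)"
        using \<open>exp x - 1 \<le> x * exp x\<close> by (intro mult_left_mono) auto
      with True show ?thesis by (simp add: power2_eq_square)
    next
      case False
      have "x \<le> exp x - 1" using exp_ge_add_one_self[of x] by linarith
      then have "x * (exp x - 1) \<le> x * x" using False by (intro mult_left_mono_neg) auto
      also have "\<dots> \<le> x\<^sup>2 * exp \<bar>x\<bar>" by (simp add: power2_eq_square mult_le_cancel_left1)
      finally show ?thesis .
    qed
    finally show ?thesis .
  qed
  moreover have "1 + x \<le> exp x" by (rule exp_ge_add_one_self)
  ultimately show ?thesis by linarith
qed

text \<open>As \<open>m\<close> may change sign, \<open>1 + k * h\<close> and
  \<open>exp (k * h)\<close> must be compared in both directions. Their difference is quadratic in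
  \<open>h\<close>, hence of order \<open>h * sqrt h\<close> on a bounded interval; this is the
  second summand of \<open>C'\<close>. Monotonicity of the weighted function and of its negative
  gives equality.\<close>

lemma Euler_exact:
  fixes m :: "real \<Rightarrow> real"
  assumes le: "\<And>s t. a \<le> s \<Longrightarrow> s \<le> t \<Longrightarrow> t \<le> T \<Longrightarrow> \<bar>m t - (1 + k * (t - s)) * m s\<bar> \<le> C * ((t - s) * sqrt (t - s))"
    and bd: "\<And>t. a \<le> t \<Longrightarrow> t \<le> T \<Longrightarrow> \<bar>m t\<bar> \<le> D" and aT: "a \<le> T" and C: "0 \<le> C"
  shows "m T = exp (k * (T - a)) * m a"
proof -
  define E where "E = exp (\<bar>k\<bar> * (\<bar>a\<bar> + \<bar>T\<bar>))"
  have E: "exp (- k * t) \<le> E" if "a \<le> t" "t \<le> T" for t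
  proof -
    have "- k * t \<le> \<bar>k\<bar> * \<bar>t\<bar>" by (metis abs_ge_self abs_minus_cancel abs_mult)
    also have "\<dots> \<le> \<bar>k\<bar> * (\<bar>a\<bar> + \<bar>T\<bar>)" using that by (intro mult_left_mono) auto
    finally show ?thesis by (simp add: E_def)
  qed
  have D: "0 \<le> D" using bd[of a] aT by auto
  define C' where "C' = C + k\<^sup>2 * exp (\<bar>k\<bar> * (T - a)) * D * sqrt (T - a)"
  have main: "\<bar>exp (- k * t) * m t - exp (- k * s) * m s\<bar> \<le> E * C' * ((t - s) * sqrt (t - s))"
    if st: "a \<le> s" "s \<le> t" "t \<le> T" for s t
  proof -
    define h where "h = t - s"
    have h: "0 \<le> h" "h \<le> T - a" using st by (auto simp: h_def)
    have hh: "h\<^sup>2 \<le> sqrt (T - a) * (h * sqrt h)"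
    proof -
      have "h\<^sup>2 = sqrt h * (h * sqrt h)" using h by (simp add: power2_eq_square)
      also have "\<dots> \<le> sqrt (T - a) * (h * sqrt h)" using h by (intro mult_right_mono) auto
      finally show ?thesis .
    qed
    have "\<bar>(1 + k * h - exp (k * h)) * m s\<bar> \<le> ((k * h)\<^sup>2 * exp \<bar>k * h\<bar>) * D"
      unfolding abs_mult[of _ "m s"] using bd[of s] st D by (intro mult_mono exp_Euler_error) auto
    also have "\<dots> \<le> ((k * h)\<^sup>2 * exp (\<bar>k\<bar> * (T - a))) * D"
      using h D by (intro mult_right_mono mult_left_mono) (auto simp: abs_mult intro!: mult_left_mono)
    also have "\<dots> = (k\<^sup>2 * exp (\<bar>k\<bar> * (T - a)) * D) * h\<^sup>2" by (simp add: power_mult_distrib)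
    also have "\<dots> \<le> (k\<^sup>2 * exp (\<bar>k\<bar> * (T - a)) * D) * (sqrt (T - a) * (h * sqrt h))"
      using D by (intro mult_left_mono hh) auto
    finally have 1: "\<bar>(1 + k * h - exp (k * h)) * m s\<bar> \<le> (k\<^sup>2 * exp (\<bar>k\<bar> * (T - a)) * D) * (sqrt (T - a) * (h * sqrt h))" .
    have "\<bar>m t - exp (k * h) * m s\<bar> \<le> \<bar>m t - (1 + k * h) * m s\<bar> + \<bar>(1 + k * h - exp (k * h)) * m s\<bar>"
      using abs_triangle_ineq[of "m t - (1 + k * h) * m s" "(1 + k * h - exp (k * h)) * m s"]
      by (simp add: algebra_simps)
    also have "\<dots> \<le> C' * (h * sqrt h)"
      using le[OF st] 1 by (simp add: h_def[symmetric] C'_def algebra_simps)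
    finally have 2: "\<bar>m t - exp (k * h) * m s\<bar> \<le> C' * (h * sqrt h)" .
    have "exp (- k * t) * m t - exp (- k * s) * m s = exp (- k * t) * (m t - exp (k * h) * m s)"
      unfolding right_diff_distrib exp_mult_exp_mult by (simp add: h_def algebra_simps)
    then have "\<bar>exp (- k * t) * m t - exp (- k * s) * m s\<bar> = exp (- k * t) * \<bar>m t - exp (k * h) * m s\<bar>"
      by (simp add: abs_mult)
    also have "\<dots> \<le> E * (C' * (h * sqrt h))"
      using E[of t] st 2 by (intro mult_mono) (auto simp: E_def)
    finally show ?thesis by (simp add: h_def mult.assoc)
  qed
  have "exp (- k * T) * m T \<le> exp (- k * a) * m a"
    using main by (intro nonincreasing_of_Hoelder[OF _ aT, of "\<lambda>t. exp (- k * t) * m t" "E * C'"]) (simp add: abs_le_iff)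
  moreover have "- (exp (- k * T) * m T) \<le> - (exp (- k * a) * m a)"
    using main by (intro nonincreasing_of_Hoelder[OF _ aT, of "\<lambda>t. - (exp (- k * t) * m t)" "E * C'"]) (simp add: abs_le_iff)
  ultimately have "exp (- k * T) * m T = exp (- k * a) * m a" by simp
  then have "exp (k * T) * (exp (- k * T) * m T) = exp (k * T) * (exp (- k * a) * m a)" by simp
  then show ?thesis unfolding exp_mult_exp_mult by (simp add: algebra_simps)
qed

lemma (in prob_space) measurable_set_integral_param:
  fixes f :: "real \<Rightarrow> 'a \<Rightarrow> real"
  assumes "(\<lambda>(r, \<omega>). indicator S r * f r \<omega>) \<in> borel_measurable (borel \<Otimes>\<^sub>M M)"
  shows "(\<lambda>\<omega>. LINT r:S|lborel. f r \<omega>) \<in> borel_measurable M"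
proof -
  have "(\<lambda>(s, \<omega>). indicator S s * f s \<omega>) \<in> borel_measurable (lborel \<Otimes>\<^sub>M M)"
    using assms by (simp cong: measurable_cong_sets sets_pair_measure_cong)
  from measurable_compose[OF measurable_pair_swap' this]
  have "(\<lambda>(\<omega>, s). indicator S s * f s \<omega>) \<in> borel_measurable (M \<Otimes>\<^sub>M lborel)"
    by (simp add: split_beta')
  from lborel.borel_measurable_lebesgue_integral[OF this]
  show ?thesis by (simp add: set_lebesgue_integral_def)
qed

section \<open>Drift, noise and increments over a short interval\<close>

context linear_sde
begin

definition moment_bound :: real where
  "moment_bound = (SOME K. 0 < K \<and> (\<forall>t\<in>{a..<b}. nn_square M (Y t) \<le> ennreal K))"

lemma moment_bound_pos: "0 < moment_bound"
  and moment_bound: "t \<in> {a..<b} \<Longrightarrow> (nn_square M (Y t)) \<le> ennreal moment_bound"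
proof -
  have "\<exists>K. 0 < K \<and> (\<forall>t\<in>{a..<b}. nn_square M (Y t) \<le> ennreal K)"
    by (rule second_moment_bounded) blast
  note * = someI_ex[OF this, folded moment_bound_def]
  show "0 < moment_bound" using * by simp
  show "t \<in> {a..<b} \<Longrightarrow> (nn_square M (Y t)) \<le> ennreal moment_bound" using * by simp
qed

lemma Y_square_integrable:
  assumes "t \<in> {a..<b}"
  shows "square_integrable M (Y t)" "integrable M (Y t)" "mean_square M (Y t) \<le> moment_bound"
proof -
  have "Y t \<in> borel_measurable M" using Y_measurable assms by auto
  note * = square_integrable_boundI[OF this moment_bound[OF assms] less_imp_le[OF moment_bound_pos]]
  show "square_integrable M (Y t)" "integrable M (Y t)" "mean_square M (Y t) \<le> moment_bound"
    using * by auto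
qed

lemma Y_joint_measurable':
  assumes "a \<le> s" "t \<in> {a..<b}"
  shows "(\<lambda>(r, \<omega>). indicator {s..t} r * Y r \<omega>) \<in> borel_measurable (borel \<Otimes>\<^sub>M M)"
proof -
  have "(\<lambda>x. indicator {s..t} (fst x) * (case x of (r, \<omega>) \<Rightarrow> indicator {a..t} r * Y r \<omega>)) \<in> borel_measurable (borel \<Otimes>\<^sub>M M)"
    by (intro borel_measurable_times Y_joint_measurable[OF assms(2)]) measurable
  also have "(\<lambda>x. indicator {s..t} (fst x) * (case x of (r, \<omega>) \<Rightarrow> indicator {a..t} r * Y r \<omega>)) = (\<lambda>(r, \<omega>). indicator {s..t} r * Y r \<omega>)"
    using assms by (auto simp: fun_eq_iff indicator_def)
  finally show ?thesis .
qed

text \<open>The bound \<open>c\<close> is left open because it is used with two values: first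
  \<open>moment_bound\<close>, later a sharper one close to the second moment at \<open>s\<close>,
  which is what produces the correct rate.\<close>

lemma interval_energy_le:
  assumes st: "a \<le> s" "s \<le> t" "t < b" and c: "\<And>r. r \<in> {s..t} \<Longrightarrow> (mean_square M (Y r)) \<le> c"
  shows "(\<integral>\<^sup>+\<omega>. nn_square lborel (\<lambda>r. indicator {s..t} r * Y r \<omega>) \<partial>M) \<le> ennreal (c * (t - s))"
proof -
  have c0: "0 \<le> c" using order_trans[OF _ c[of s]] st by auto
  have "(\<integral>\<^sup>+\<omega>. nn_square lborel (\<lambda>r. indicator {s..t} r * Y r \<omega>) \<partial>M)
      = (\<integral>\<^sup>+r. nn_square M (\<lambda>\<omega>. indicator {s..t} r * Y r \<omega>) \<partial>lborel)"
  proof (rule nn_integral_Fubini_lborel)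
    show "(\<lambda>(r, \<omega>). ennreal ((indicator {s..t} r * Y r \<omega>)\<^sup>2)) \<in> borel_measurable (borel \<Otimes>\<^sub>M M)"
    proof -
      have "(\<lambda>(r, \<omega>). indicator {s..t} r * Y r \<omega>) \<in> borel_measurable (borel \<Otimes>\<^sub>M M)"
        using st by (intro Y_joint_measurable') auto
      then show ?thesis unfolding split_beta' by measurable
    qed
  qed
  also have "\<dots> \<le> (\<integral>\<^sup>+r. ennreal c * indicator {s..t} r \<partial>lborel)"
  proof (rule nn_integral_mono)
    fix r
    show "nn_square M (\<lambda>\<omega>. indicator {s..t} r * Y r \<omega>) \<le> ennreal c * indicator {s..t} r"
    proof (cases "r \<in> {s..t}")
      case True
      then have "nn_square M (Y r) = ennreal (mean_square M (Y r))"
        using Y_square_integrable(1)[of r] st by (intro nn_integral_eq_integral) auto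
      with True c[OF True] show ?thesis by (simp add: ennreal_leI)
    qed simp
  qed
  also have "\<dots> = ennreal (c * (t - s))" using st c0 by (simp add: nn_integral_cmult ennreal_mult)
  finally show ?thesis .
qed

lemma path_integrable:
  assumes "continuous_on {a..b} (\<lambda>t. Y t \<omega>)" "a \<le> s" "t \<le> b"
  shows "set_integrable lborel {s..t} (\<lambda>r. Y r \<omega>)"
  using continuous_on_subset[OF assms(1)] assms(2,3) by (intro borel_integrable_atLeastAtMost') auto

lemma increment_eq:
  assumes st: "a \<le> s" "s \<le> t" "t < b"
  shows "AE \<omega> in M. Y t \<omega> - Y s \<omega> = - lam * (LINT r:{s..t}|lborel. Y r \<omega>) + \<sigma> * (J t \<omega> - J s \<omega>)"
proof -
  have "s \<in> {a..<b}" "t \<in> {a..<b}" using st by auto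
  from J(2)[OF this(1)] J(2)[OF this(2)] continuous_paths show ?thesis
  proof eventually_elim
    case (elim \<omega>)
    have cont: "continuous_on {a..t} (\<lambda>r. Y r \<omega>)" using elim(3) st by (auto intro: continuous_on_subset)
    have "(LINT r:{a..t}|lborel. Y r \<omega>) = (LINT r:{a..s}|lborel. Y r \<omega>) + (LINT r:{s..t}|lborel. Y r \<omega>)"
      using Henstock_Kurzweil_Integration.integral_combine[OF st(1,2) integrable_continuous_interval[OF cont]]
        set_borel_integral_eq_integral(2)[OF path_integrable[OF elim(3)]] st by simp
    then show ?case using elim(1,2) by (simp add: algebra_simps)
  qed
qed

lemma drift_measurable:
  assumes "a \<le> s" "s \<le> t" "t < b"
  shows "(\<lambda>\<omega>. LINT r:{s..t}|lborel. Y r \<omega>) \<in> borel_measurable M"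
  using assms by (intro measurable_set_integral_param Y_joint_measurable') auto

lemma drift_square_integrable:
  assumes st: "a \<le> s" "s \<le> t" "t < b"
  shows "square_integrable M (\<lambda>\<omega>. LINT r:{s..t}|lborel. Y r \<omega>)"
    "mean_square M (\<lambda>\<omega>. LINT r:{s..t}|lborel. Y r \<omega>) \<le> moment_bound * (t - s)\<^sup>2"
proof -
  have jm: "(\<lambda>(r, \<omega>). indicator {s..t} r * Y r \<omega>) \<in> borel_measurable (borel \<Otimes>\<^sub>M M)"
    using Y_joint_measurable'[of s t] st by auto
  have "nn_square M (\<lambda>\<omega>. LINT r:{s..t}|lborel. Y r \<omega>)
      \<le> (\<integral>\<^sup>+\<omega>. ennreal (t - s) * nn_square lborel (\<lambda>r. indicator {s..t} r * Y r \<omega>) \<partial>M)"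
    using st by (intro nn_integral_mono ennreal_set_integral_sq_le measurable_slice[OF jm]) auto
  also have "\<dots> = ennreal (t - s) * (\<integral>\<^sup>+\<omega>. nn_square lborel (\<lambda>r. indicator {s..t} r * Y r \<omega>) \<partial>M)"
    by (intro nn_integral_cmult measurable_sq_integral jm)
  also have "\<dots> \<le> ennreal (t - s) * ennreal (moment_bound * (t - s))"
    using st by (intro mult_left_mono interval_energy_le st Y_square_integrable(3)) auto
  also have "\<dots> = ennreal (moment_bound * (t - s)\<^sup>2)"
    using st moment_bound_pos by (simp add: power2_eq_square mult_ac flip: ennreal_mult)
  finally have le: "nn_square M (\<lambda>\<omega>. LINT r:{s..t}|lborel. Y r \<omega>) \<le> ennreal (moment_bound * (t - s)\<^sup>2)"
    by (simp add: mult_left_mono)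
  have "0 \<le> moment_bound * (t - s)\<^sup>2" using moment_bound_pos by simp
  note * = square_integrable_boundI[OF drift_measurable[OF st] le this]
  show "square_integrable M (\<lambda>\<omega>. LINT r:{s..t}|lborel. Y r \<omega>)"
    "mean_square M (\<lambda>\<omega>. LINT r:{s..t}|lborel. Y r \<omega>) \<le> moment_bound * (t - s)\<^sup>2"
    using * by auto
qed

lemma noise_energy_le:
  assumes st: "a \<le> s" "s \<le> t" "t < b" and c: "\<And>r. r \<in> {s..t} \<Longrightarrow> (mean_square M (Y r)) \<le> c"
  shows "(\<integral>\<^sup>+\<omega>. nn_square lborel (\<lambda>r. indicator {s<..t} r * Y r \<omega>) \<partial>M) \<le> ennreal (c * (t - s))"
  by (rule order_trans[OF _ interval_energy_le[OF assms]])
    (auto intro!: nn_integral_mono simp: indicator_def)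

lemma noise_square_integrable:
  assumes st: "a \<le> s" "s \<le> t" "t < b" and c: "\<And>r. r \<in> {s..t} \<Longrightarrow> (mean_square M (Y r)) \<le> c"
  shows "square_integrable M (\<lambda>\<omega>. J t \<omega> - J s \<omega>)" "mean_square M (\<lambda>\<omega>. J t \<omega> - J s \<omega>) \<le> c * (t - s)"
proof -
  have s: "s \<in> {a..<b}" and t: "t \<in> {a..<b}" using st by auto
  have c0: "0 \<le> c" using order_trans[OF _ c[of s]] st by auto
  have "nn_square M (\<lambda>\<omega>. J t \<omega> - J s \<omega>) \<le> ennreal (c * (t - s))"
    using order_trans[OF ito_increment_square_bound[OF J(1)[OF s] J(1)[OF t] a_nonneg st(1,2)] noise_energy_le[OF assms]] .
  moreover have "(\<lambda>\<omega>. J t \<omega> - J s \<omega>) \<in> borel_measurable M"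
    by (intro borel_measurable_diff J_measurable s t)
  moreover have "0 \<le> c * (t - s)" using c0 st by simp
  ultimately show "square_integrable M (\<lambda>\<omega>. J t \<omega> - J s \<omega>)" "mean_square M (\<lambda>\<omega>. J t \<omega> - J s \<omega>) \<le> c * (t - s)"
    using square_integrable_boundI by blast+
qed

lemma noise_orthogonal:
  assumes st: "a \<le> s" "s \<le> t" "t < b" and G: "G \<in> borel_measurable (F s)" "square_integrable M G"
  shows "(\<integral>\<omega>. G \<omega> * (J t \<omega> - J s \<omega>) \<partial>M) = 0"
proof (rule ito_increment_orthogonal[OF J(1) J(1) a_nonneg st(1,2) _ G])
  show "(\<integral>\<^sup>+\<omega>. nn_square lborel (\<lambda>r. indicator {s<..t} r * Y r \<omega>) \<partial>M) < \<infinity>"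
    using Y_square_integrable(3) st by (intro le_less_trans[OF noise_energy_le[OF st, of moment_bound]]) auto
qed (use st in auto)

text \<open>Collects the two terms of the square of drift plus noise; one factor
  \<open>t - s\<close> of the squared drift is bounded by \<open>b - a\<close>, so that the total is
  linear in \<open>t - s\<close>.\<close>

definition increment_const :: real where
  "increment_const = 2 * lam\<^sup>2 * moment_bound * (b - a) + 2 * \<sigma>\<^sup>2 * moment_bound"

lemma increment_const_nonneg: "0 \<le> increment_const"
  unfolding increment_const_def using moment_bound_pos a_less_b
  by (intro add_nonneg_nonneg mult_nonneg_nonneg) auto

lemma increment_square_le:
  assumes st: "a \<le> s" "s \<le> t" "t < b"
  shows "square_integrable M (\<lambda>\<omega>. Y t \<omega> - Y s \<omega>)" "mean_square M (\<lambda>\<omega>. Y t \<omega> - Y s \<omega>) \<le> increment_const * (t - s)"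
proof -
  let ?P = "\<lambda>\<omega>. LINT r:{s..t}|lborel. Y r \<omega>" and ?D = "\<lambda>\<omega>. J t \<omega> - J s \<omega>"
  have [measurable]: "Y s \<in> borel_measurable M" "Y t \<in> borel_measurable M" using Y_measurable st by auto
  note P = drift_square_integrable[OF st]
  note D = noise_square_integrable[OF st Y_square_integrable(3)]
  have D': "square_integrable M ?D" "mean_square M ?D \<le> moment_bound * (t - s)" using D st by auto
  have le: "AE \<omega> in M. (Y t \<omega> - Y s \<omega>)\<^sup>2 \<le> 2 * lam\<^sup>2 * (?P \<omega>)\<^sup>2 + 2 * \<sigma>\<^sup>2 * (?D \<omega>)\<^sup>2"
    using increment_eq[OF st]
  proof eventually_elim
    case (elim \<omega>)
    have "(- lam * x + \<sigma> * y)\<^sup>2 \<le> 2 * lam\<^sup>2 * x\<^sup>2 + 2 * \<sigma>\<^sup>2 * y\<^sup>2" for x y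
    proof -
      have "0 \<le> (lam * x + \<sigma> * y)\<^sup>2" by simp
      then show ?thesis by (simp add: power2_eq_square algebra_simps)
    qed
    with elim show ?case by simp
  qed
  show i: "square_integrable M (\<lambda>\<omega>. Y t \<omega> - Y s \<omega>)"
  proof (rule Bochner_Integration.integrable_bound[of M "\<lambda>\<omega>. 2 * lam\<^sup>2 * (?P \<omega>)\<^sup>2 + 2 * \<sigma>\<^sup>2 * (?D \<omega>)\<^sup>2"])
    show "AE \<omega> in M. norm ((Y t \<omega> - Y s \<omega>)\<^sup>2) \<le> norm (2 * lam\<^sup>2 * (?P \<omega>)\<^sup>2 + 2 * \<sigma>\<^sup>2 * (?D \<omega>)\<^sup>2)"
      using le by eventually_elim auto
  qed (use P D' in auto)
  have "mean_square M (\<lambda>\<omega>. Y t \<omega> - Y s \<omega>) \<le> (\<integral>\<omega>. 2 * lam\<^sup>2 * (?P \<omega>)\<^sup>2 + 2 * \<sigma>\<^sup>2 * (?D \<omega>)\<^sup>2 \<partial>M)"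
    using i P D' le by (intro integral_mono_AE) auto
  also have "\<dots> = 2 * lam\<^sup>2 * mean_square M ?P + 2 * \<sigma>\<^sup>2 * mean_square M ?D"
    using P D' by simp
  also have "\<dots> \<le> 2 * lam\<^sup>2 * (moment_bound * (t - s)\<^sup>2) + 2 * \<sigma>\<^sup>2 * (moment_bound * (t - s))"
    using P(2) D'(2) by (intro add_mono mult_left_mono) auto
  also have "\<dots> \<le> 2 * lam\<^sup>2 * (moment_bound * ((b - a) * (t - s))) + 2 * \<sigma>\<^sup>2 * (moment_bound * (t - s))"
    unfolding power2_eq_square[of "t - s"]
    using st moment_bound_pos by (intro add_right_mono mult_left_mono mult_right_mono) auto
  also have "\<dots> = increment_const * (t - s)" by (simp add: increment_const_def algebra_simps)
  finally show "mean_square M (\<lambda>\<omega>. Y t \<omega> - Y s \<omega>) \<le> increment_const * (t - s)" .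
qed

text \<open>The error of freezing the drift at its left endpoint, almost surely the integral of
  \<open>Y r - Y s\<close> over the interval.\<close>

definition remainder :: "real \<Rightarrow> real \<Rightarrow> 'a \<Rightarrow> real" where
  "remainder s t \<omega> = (LINT r:{s..t}|lborel. Y r \<omega>) - (t - s) * Y s \<omega>"

lemma remainder_measurable:
  assumes "a \<le> s" "s \<le> t" "t < b"
  shows "remainder s t \<in> borel_measurable M"
  unfolding remainder_def[abs_def] using drift_measurable[OF assms] Y_measurable[of s] assms by auto

text \<open>The source of the exponent 3/2: increments of mean square size at most a multiple of
  \<open>t - s\<close> are integrated over an interval of length \<open>t - s\<close>, and
  Cauchy-Schwarz in time gives a cube before the root is taken.\<close>

lemma remainder_square_le:
  assumes st: "a \<le> s" "s \<le> t" "t < b"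
  shows "square_integrable M (remainder s t)"
    "sqrt (mean_square M (remainder s t)) \<le> sqrt increment_const * ((t - s) * sqrt (t - s))"
proof -
  let ?f = "\<lambda>r \<omega>. Y r \<omega> - Y s \<omega>"
  have [measurable]: "Y s \<in> borel_measurable M" using Y_measurable st by auto
  have jm: "(\<lambda>(r, \<omega>). indicator {s..t} r * ?f r \<omega>) \<in> borel_measurable (borel \<Otimes>\<^sub>M M)"
  proof -
    have "(\<lambda>x. (case x of (r, \<omega>) \<Rightarrow> indicator {s..t} r * Y r \<omega>) - indicator {s..t} (fst x) * Y s (snd x)) \<in> borel_measurable (borel \<Otimes>\<^sub>M M)"
    proof (rule borel_measurable_diff)
      show "(\<lambda>(r, \<omega>). indicator {s..t} r * Y r \<omega>) \<in> borel_measurable (borel \<Otimes>\<^sub>M M)"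
        using Y_joint_measurable'[of s t] st by auto
    qed measurable
    then show ?thesis by (simp add: split_beta' algebra_simps)
  qed
  have "nn_square M (remainder s t)
      \<le> (\<integral>\<^sup>+\<omega>. ennreal (t - s) * nn_square lborel (\<lambda>r. indicator {s..t} r * ?f r \<omega>) \<partial>M)"
  proof (rule nn_integral_mono_AE)
    show "AE \<omega> in M. ennreal ((remainder s t \<omega>)\<^sup>2)
      \<le> ennreal (t - s) * nn_square lborel (\<lambda>r. indicator {s..t} r * ?f r \<omega>)"
      using continuous_paths AE_space
    proof eventually_elim
      case (elim \<omega>)
      have "remainder s t \<omega> = (LINT r:{s..t}|lborel. ?f r \<omega>)"
        unfolding remainder_def using st
        by (subst set_integral_diff(2)[OF path_integrable[OF elim(1)]])
          (auto simp: set_integrable_def set_lebesgue_integral_def)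
      then show ?case
        using ennreal_set_integral_sq_le[OF measurable_slice[OF jm elim(2)] st(2)] by simp
    qed
  qed
  also have "\<dots> = ennreal (t - s) * (\<integral>\<^sup>+\<omega>. nn_square lborel (\<lambda>r. indicator {s..t} r * ?f r \<omega>) \<partial>M)"
    by (intro nn_integral_cmult measurable_sq_integral jm)
  also have "(\<integral>\<^sup>+\<omega>. nn_square lborel (\<lambda>r. indicator {s..t} r * ?f r \<omega>) \<partial>M)
      = (\<integral>\<^sup>+r. nn_square M (\<lambda>\<omega>. indicator {s..t} r * ?f r \<omega>) \<partial>lborel)"
  proof (rule nn_integral_Fubini_lborel)
    show "(\<lambda>(r, \<omega>). ennreal ((indicator {s..t} r * ?f r \<omega>)\<^sup>2)) \<in> borel_measurable (borel \<Otimes>\<^sub>M M)"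
      using jm unfolding split_beta' by measurable
  qed
  also have "\<dots> \<le> (\<integral>\<^sup>+r. ennreal (increment_const * (t - s)) * indicator {s..t} r \<partial>lborel)"
  proof (rule nn_integral_mono)
    fix r
    show "nn_square M (\<lambda>\<omega>. indicator {s..t} r * ?f r \<omega>) \<le> ennreal (increment_const * (t - s)) * indicator {s..t} r"
    proof (cases "r \<in> {s..t}")
      case True
      then have "nn_square M (?f r) = ennreal (mean_square M (?f r))"
        using increment_square_le(1)[of s r] st by (intro nn_integral_eq_integral) auto
      also have "\<dots> \<le> ennreal (increment_const * (t - s))"
      proof (rule ennreal_leI)
        have "mean_square M (?f r) \<le> increment_const * (r - s)"
          using increment_square_le(2)[of s r] True st by auto
        also have "\<dots> \<le> increment_const * (t - s)"
          using True increment_const_nonneg by (intro mult_left_mono) auto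
        finally show "mean_square M (?f r) \<le> increment_const * (t - s)" .
      qed
      finally show ?thesis using True by simp
    qed simp
  qed
  also have "\<dots> = ennreal (increment_const * (t - s) * (t - s))"
    using st increment_const_nonneg by (simp add: nn_integral_cmult ennreal_mult)
  also have "ennreal (t - s) * \<dots> = ennreal (increment_const * ((t - s) * (t - s) * (t - s)))"
    using st increment_const_nonneg by (simp add: mult_ac flip: ennreal_mult)
  finally have le: "nn_square M (remainder s t) \<le> ennreal (increment_const * ((t - s) * (t - s) * (t - s)))"
    by (auto simp: mult_left_mono)
  have nn: "0 \<le> increment_const * ((t - s) * (t - s) * (t - s))" using st increment_const_nonneg by auto
  note R = square_integrable_boundI[OF remainder_measurable[OF st] le nn]
  show "square_integrable M (remainder s t)" by (rule R)
  have "sqrt (mean_square M (remainder s t)) \<le> sqrt (increment_const * ((t - s) * (t - s) * (t - s)))"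
    using R(3) by simp
  also have "\<dots> = sqrt increment_const * ((t - s) * sqrt (t - s))"
    using st by (simp add: real_sqrt_mult)
  finally show "sqrt (mean_square M (remainder s t)) \<le> sqrt increment_const * ((t - s) * sqrt (t - s))" .
qed

end

section \<open>Euler steps for the moments and their exponential rates\<close>

context linear_sde
begin

lemma mean_step:
  assumes st: "a \<le> s" "s \<le> t" "t < b"
  shows "\<bar>(\<integral>\<omega>. Y t \<omega> \<partial>M) - (1 + - lam * (t - s)) * (\<integral>\<omega>. Y s \<omega> \<partial>M)\<bar>
    \<le> \<bar>lam\<bar> * sqrt increment_const * ((t - s) * sqrt (t - s))"
proof -
  let ?R = "remainder s t" and ?D = "\<lambda>\<omega>. J t \<omega> - J s \<omega>"
  have s: "s \<in> {a..<b}" and t: "t \<in> {a..<b}" using st by auto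
  note [measurable] = J_measurable[OF s] J_measurable[OF t] remainder_measurable[OF st]
  have D2: "square_integrable M ?D" using noise_square_integrable(1)[OF st, of moment_bound] Y_square_integrable(3) st by auto
  have D: "integrable M ?D" by (rule square_integrable_imp_integrable[OF _ D2]) measurable
  have R: "integrable M ?R" by (rule square_integrable_imp_integrable[OF _ remainder_square_le(1)[OF st]]) measurable
  have D0: "(\<integral>\<omega>. ?D \<omega> \<partial>M) = 0" using noise_orthogonal[OF st, of "\<lambda>_. 1"] by simp
  note Ys = Y_square_integrable(2)[OF s]
  have "(\<integral>\<omega>. Y t \<omega> \<partial>M) = (\<integral>\<omega>. Y s \<omega> + (- lam * (?R \<omega> + (t - s) * Y s \<omega>) + \<sigma> * ?D \<omega>) \<partial>M)"
  proof (rule integral_cong_AE)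
    show "AE \<omega> in M. Y t \<omega> = Y s \<omega> + (- lam * (?R \<omega> + (t - s) * Y s \<omega>) + \<sigma> * ?D \<omega>)"
      using increment_eq[OF st] by eventually_elim (simp add: remainder_def)
  qed (use Y_square_integrable(2)[OF s] Y_square_integrable(2)[OF t] in auto)
  also have "\<dots> = (\<integral>\<omega>. Y s \<omega> \<partial>M) - lam * (\<integral>\<omega>. ?R \<omega> \<partial>M) - lam * ((t - s) * (\<integral>\<omega>. Y s \<omega> \<partial>M))"
  proof -
    have "(\<integral>\<omega>. Y s \<omega> + (- lam * (?R \<omega> + (t - s) * Y s \<omega>) + \<sigma> * ?D \<omega>) \<partial>M)
        = (\<integral>\<omega>. Y s \<omega> \<partial>M) + (- lam * ((\<integral>\<omega>. ?R \<omega> \<partial>M) + (t - s) * (\<integral>\<omega>. Y s \<omega> \<partial>M)) + \<sigma> * (\<integral>\<omega>. ?D \<omega> \<partial>M))"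
      using Ys R D by (subst Bochner_Integration.integral_add; simp)+
    then show ?thesis unfolding D0 by (simp add: algebra_simps)
  qed
  finally have "(\<integral>\<omega>. Y t \<omega> \<partial>M) - (1 + - lam * (t - s)) * (\<integral>\<omega>. Y s \<omega> \<partial>M) = - lam * (\<integral>\<omega>. ?R \<omega> \<partial>M)"
    by (simp add: algebra_simps)
  then have "\<bar>(\<integral>\<omega>. Y t \<omega> \<partial>M) - (1 + - lam * (t - s)) * (\<integral>\<omega>. Y s \<omega> \<partial>M)\<bar> = \<bar>lam\<bar> * \<bar>\<integral>\<omega>. ?R \<omega> \<partial>M\<bar>"
    by (simp add: abs_mult)
  also have "\<dots> \<le> \<bar>lam\<bar> * (sqrt increment_const * ((t - s) * sqrt (t - s)))"
    using abs_expectation_le_sqrt(2)[OF remainder_measurable[OF st] remainder_square_le(1)[OF st]]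
      remainder_square_le(2)[OF st] by (intro mult_left_mono) auto
  finally show ?thesis by (simp add: mult.assoc)
qed

text \<open>\<open>Y s\<close> is known at time \<open>s\<close>, so the noise is orthogonal to it
  and only the drift is left, frozen up to the remainder.\<close>

lemma product_step:
  assumes st: "a \<le> s" "s \<le> t" "t < b"
  shows "\<bar>(\<integral>\<omega>. Y s \<omega> * (Y t \<omega> - Y s \<omega>) \<partial>M) + lam * (t - s) * mean_square M (Y s)\<bar>
    \<le> \<bar>lam\<bar> * (sqrt moment_bound * (sqrt increment_const * ((t - s) * sqrt (t - s))))"
proof -
  let ?R = "remainder s t" and ?D = "\<lambda>\<omega>. J t \<omega> - J s \<omega>"
  have s: "s \<in> {a..<b}" and t: "t \<in> {a..<b}" using st by auto
  have Ysm: "Y s \<in> borel_measurable M" and Ytm: "Y t \<in> borel_measurable M" using Y_measurable s t by auto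
  note [measurable] = J_measurable[OF s] J_measurable[OF t] remainder_measurable[OF st] Ysm Ytm
  have D2: "square_integrable M ?D" using noise_square_integrable(1)[OF st, of moment_bound] Y_square_integrable(3) st by auto
  note Y2 = Y_square_integrable(1)[OF s] and R2 = remainder_square_le(1)[OF st]
  have D0: "(\<integral>\<omega>. Y s \<omega> * ?D \<omega> \<partial>M) = 0"
    using noise_orthogonal[OF st Y_adapted Y2] s by auto
  have YD: "integrable M (\<lambda>\<omega>. Y s \<omega> * ?D \<omega>)" by (rule Cauchy_Schwarz_expectation(1)[OF _ _ Y2 D2]) auto
  note YR = Cauchy_Schwarz_expectation[OF Ysm remainder_measurable[OF st] Y2 R2]
  have "(\<integral>\<omega>. Y s \<omega> * (Y t \<omega> - Y s \<omega>) \<partial>M)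
      = (\<integral>\<omega>. - lam * (Y s \<omega> * ?R \<omega>) - lam * ((t - s) * (Y s \<omega>)\<^sup>2) + \<sigma> * (Y s \<omega> * ?D \<omega>) \<partial>M)"
  proof (rule integral_cong_AE)
    show "AE \<omega> in M. Y s \<omega> * (Y t \<omega> - Y s \<omega>)
        = - lam * (Y s \<omega> * ?R \<omega>) - lam * ((t - s) * (Y s \<omega>)\<^sup>2) + \<sigma> * (Y s \<omega> * ?D \<omega>)"
      using increment_eq[OF st]
    proof eventually_elim
      case (elim \<omega>)
      show ?case unfolding elim remainder_def by (simp add: power2_eq_square algebra_simps)
    qed
  qed measurable
  also have "\<dots> = - lam * (\<integral>\<omega>. Y s \<omega> * ?R \<omega> \<partial>M) - lam * ((t - s) * mean_square M (Y s))"
    using YR(1) Y2 YD D0 by simp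
  finally have "\<bar>(\<integral>\<omega>. Y s \<omega> * (Y t \<omega> - Y s \<omega>) \<partial>M) + lam * (t - s) * mean_square M (Y s)\<bar>
      = \<bar>lam\<bar> * \<bar>\<integral>\<omega>. Y s \<omega> * ?R \<omega> \<partial>M\<bar>"
    by (simp add: abs_mult)
  also have "\<dots> \<le> \<bar>lam\<bar> * (sqrt moment_bound * (sqrt increment_const * ((t - s) * sqrt (t - s))))"
  proof (intro mult_left_mono)
    show "\<bar>\<integral>\<omega>. Y s \<omega> * ?R \<omega> \<partial>M\<bar> \<le> sqrt moment_bound * (sqrt increment_const * ((t - s) * sqrt (t - s)))"
      by (rule order_trans[OF YR(2)])
        (use Y_square_integrable(3)[OF s] remainder_square_le(2)[OF st] moment_bound_pos in \<open>intro mult_mono, auto\<close>)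
  qed auto
  finally show ?thesis .
qed

lemma second_moment_split:
  assumes st: "a \<le> s" "s \<le> t" "t < b"
  shows "mean_square M (Y t) = mean_square M (Y s) + 2 * (\<integral>\<omega>. Y s \<omega> * (Y t \<omega> - Y s \<omega>) \<partial>M)
      + mean_square M (\<lambda>\<omega>. Y t \<omega> - Y s \<omega>)"
proof -
  have s: "s \<in> {a..<b}" and t: "t \<in> {a..<b}" using st by auto
  have [measurable]: "Y s \<in> borel_measurable M" "Y t \<in> borel_measurable M" using Y_measurable s t by auto
  note Y2 = Y_square_integrable(1)[OF s] and I2 = increment_square_le(1)[OF st]
  have YI: "integrable M (\<lambda>\<omega>. Y s \<omega> * (Y t \<omega> - Y s \<omega>))"
    by (rule Cauchy_Schwarz_expectation(1)[OF _ _ Y2 I2]) auto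
  have "mean_square M (Y t) = (\<integral>\<omega>. (Y s \<omega>)\<^sup>2 + 2 * (Y s \<omega> * (Y t \<omega> - Y s \<omega>)) + (Y t \<omega> - Y s \<omega>)\<^sup>2 \<partial>M)"
    by (intro Bochner_Integration.integral_cong refl) (simp add: power2_eq_square algebra_simps)
  also have "\<dots> = mean_square M (Y s) + 2 * (\<integral>\<omega>. Y s \<omega> * (Y t \<omega> - Y s \<omega>) \<partial>M) + mean_square M (\<lambda>\<omega>. Y t \<omega> - Y s \<omega>)"
    using Y2 I2 YI by simp
  finally show ?thesis .
qed

text \<open>Of order \<open>sqrt (t - s)\<close> only, but enough to compare the second moments
  inside a step with the one at its left endpoint: in the noise term the comparison error is
  multiplied by the step length, which restores the exponent 3/2.\<close>

lemma second_moment_rough: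
  assumes st: "a \<le> s" "s \<le> t" "t < b"
  shows "mean_square M (Y t) \<le> mean_square M (Y s)
    + (2 * sqrt moment_bound * sqrt increment_const + increment_const * sqrt (b - a)) * sqrt (t - s)"
proof -
  have s: "s \<in> {a..<b}" and t: "t \<in> {a..<b}" using st by auto
  have Ysm: "Y s \<in> borel_measurable M" and Ytm: "Y t \<in> borel_measurable M" using Y_measurable s t by auto
  note Y2 = Y_square_integrable(1)[OF s] and I2 = increment_square_le[OF st]
  have "(\<integral>\<omega>. Y s \<omega> * (Y t \<omega> - Y s \<omega>) \<partial>M) \<le> sqrt (mean_square M (Y s)) * sqrt (mean_square M (\<lambda>\<omega>. Y t \<omega> - Y s \<omega>))"
    using Cauchy_Schwarz_expectation(2)[OF Ysm borel_measurable_diff[OF Ytm Ysm] Y2 I2(1)] by simp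
  also have "\<dots> \<le> sqrt moment_bound * (sqrt increment_const * sqrt (t - s))"
    unfolding real_sqrt_mult[symmetric, of increment_const]
    using Y_square_integrable(3)[OF s] I2(2) moment_bound_pos by (intro mult_mono) auto
  finally have 1: "(\<integral>\<omega>. Y s \<omega> * (Y t \<omega> - Y s \<omega>) \<partial>M) \<le> sqrt moment_bound * (sqrt increment_const * sqrt (t - s))" .
  have "t - s = sqrt (t - s) * sqrt (t - s)" using st by simp
  also have "\<dots> \<le> sqrt (b - a) * sqrt (t - s)" using st by (intro mult_right_mono) auto
  finally have "increment_const * (t - s) \<le> increment_const * (sqrt (b - a) * sqrt (t - s))"
    using increment_const_nonneg by (rule mult_left_mono)
  then have 2: "mean_square M (\<lambda>\<omega>. Y t \<omega> - Y s \<omega>) \<le> increment_const * (sqrt (b - a) * sqrt (t - s))" using I2(2) by linarith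
  show ?thesis
    unfolding second_moment_split[OF st] using 1 2 by (simp add: algebra_simps)
qed

text \<open>To first order the mixed product contributes \<open>- 2 * lam * h\<close> and the
  squared noise \<open>\<sigma>\<^sup>2 * h\<close>, both times the second moment at
  \<open>s\<close>. The squared drift is of order \<open>h\<^sup>2\<close>, and the product of drift
  and noise of order \<open>h * sqrt h\<close>.\<close>

lemma second_moment_step:
  obtains C where "0 \<le> C" "\<And>s t. a \<le> s \<Longrightarrow> s \<le> t \<Longrightarrow> t < b \<Longrightarrow>
    (mean_square M (Y t)) \<le> (1 + (- 2 * lam + \<sigma>\<^sup>2) * (t - s)) * mean_square M (Y s) + C * ((t - s) * sqrt (t - s))"
proof -
  define K where "K = moment_bound"
  define C1 where "C1 = increment_const"
  define C3 where "C3 = 2 * sqrt K * sqrt C1 + C1 * sqrt (b - a)"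
  \<comment> \<open>In this order: the remainder of the mixed product, the squared drift, the
    product of drift and noise, and the variation of the second moment within the noise
    energy.\<close>
  define C where "C = 2 * (\<bar>lam\<bar> * (sqrt K * sqrt C1)) + lam\<^sup>2 * (K * sqrt (b - a)) + 2 * \<bar>lam * \<sigma>\<bar> * K + \<sigma>\<^sup>2 * C3"
  have K: "0 < K" using moment_bound_pos by (simp add: K_def)
  have C1: "0 \<le> C1" using increment_const_nonneg by (simp add: C1_def)
  have C3: "0 \<le> C3" unfolding C3_def using K C1 a_less_b by (intro add_nonneg_nonneg mult_nonneg_nonneg) auto
  have C: "0 \<le> C" unfolding C_def using K C1 C3 a_less_b by (intro add_nonneg_nonneg mult_nonneg_nonneg) auto
  have "mean_square M (Y t) \<le> (1 + (- 2 * lam + \<sigma>\<^sup>2) * (t - s)) * mean_square M (Y s) + C * ((t - s) * sqrt (t - s))"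
    if st: "a \<le> s" "s \<le> t" "t < b" for s t
  proof -
    define h where "h = t - s"
    define u where "u = mean_square M (Y s)"
    have h: "0 \<le> h" "h \<le> b - a" using st by (auto simp: h_def)
    let ?P = "\<lambda>\<omega>. LINT r:{s..t}|lborel. Y r \<omega>" and ?D = "\<lambda>\<omega>. J t \<omega> - J s \<omega>"
    have s: "s \<in> {a..<b}" and t: "t \<in> {a..<b}" using st by auto
    have Dm: "?D \<in> borel_measurable M" by (intro borel_measurable_diff J_measurable s t)
    note Pm = drift_measurable[OF st]
    have Ym: "Y s \<in> borel_measurable M" "Y t \<in> borel_measurable M" using Y_measurable s t by auto
    note P = drift_square_integrable[OF st]
    \<comment> \<open>The noise energy must refer to \<open>u\<close>, not to
      \<open>moment_bound\<close>: with the latter the term of order \<open>h\<close> would not be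
      proportional to the second moment, and no exponential rate would follow.\<close>
    have D: "square_integrable M ?D" "mean_square M ?D \<le> (u + C3 * sqrt h) * h"
    proof -
      have "mean_square M (Y r) \<le> u + C3 * sqrt h" if r: "r \<in> {s..t}" for r
      proof -
        have "mean_square M (Y r) \<le> u + C3 * sqrt (r - s)"
          using second_moment_rough[of s r] r st by (simp add: u_def C3_def K_def C1_def)
        also have "\<dots> \<le> u + C3 * sqrt h" using C3 r by (intro add_left_mono mult_left_mono) (auto simp: h_def)
        finally show ?thesis .
      qed
      from noise_square_integrable[OF st this] show "square_integrable M ?D" "mean_square M ?D \<le> (u + C3 * sqrt h) * h"
        by (auto simp: h_def)
    qed
    have DK: "mean_square M ?D \<le> K * h"
      using noise_square_integrable(2)[OF st, of K] Y_square_integrable(3) st by (auto simp: K_def h_def)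
    note PD = Cauchy_Schwarz_expectation[OF Pm Dm P(1) D(1)]
    have "\<bar>\<integral>\<omega>. ?P \<omega> * ?D \<omega> \<partial>M\<bar> \<le> sqrt (K * h\<^sup>2) * sqrt (K * h)"
      by (rule order_trans[OF PD(2)]) (use P(2) DK K h in \<open>intro mult_mono, auto simp: K_def h_def\<close>)
    also have "\<dots> = K * (h * sqrt h)" using K h by (simp add: real_sqrt_mult)
    finally have PD': "\<bar>\<integral>\<omega>. ?P \<omega> * ?D \<omega> \<partial>M\<bar> \<le> K * (h * sqrt h)" .
    have hh: "h\<^sup>2 \<le> sqrt (b - a) * (h * sqrt h)"
    proof -
      have "h\<^sup>2 = sqrt h * (h * sqrt h)" using h by (simp add: power2_eq_square)
      also have "\<dots> \<le> sqrt (b - a) * (h * sqrt h)" using h by (intro mult_right_mono) auto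
      finally show ?thesis .
    qed
    have "mean_square M (\<lambda>\<omega>. Y t \<omega> - Y s \<omega>)
        = (\<integral>\<omega>. lam\<^sup>2 * (?P \<omega>)\<^sup>2 - 2 * lam * \<sigma> * (?P \<omega> * ?D \<omega>) + \<sigma>\<^sup>2 * (?D \<omega>)\<^sup>2 \<partial>M)"
    proof (rule integral_cong_AE)
      show "AE \<omega> in M. (Y t \<omega> - Y s \<omega>)\<^sup>2 = lam\<^sup>2 * (?P \<omega>)\<^sup>2 - 2 * lam * \<sigma> * (?P \<omega> * ?D \<omega>) + \<sigma>\<^sup>2 * (?D \<omega>)\<^sup>2"
        using increment_eq[OF st]
      proof eventually_elim
        case (elim \<omega>)
        show ?case unfolding elim by (simp add: power2_eq_square algebra_simps)
      qed
    qed (use Ym Pm Dm in measurable)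
    also have "\<dots> = lam\<^sup>2 * mean_square M ?P - 2 * lam * \<sigma> * (\<integral>\<omega>. ?P \<omega> * ?D \<omega> \<partial>M) + \<sigma>\<^sup>2 * mean_square M ?D"
      using P(1) D(1) PD(1) by simp
    also have "\<dots> \<le> lam\<^sup>2 * (K * (sqrt (b - a) * (h * sqrt h))) + 2 * \<bar>lam * \<sigma>\<bar> * (K * (h * sqrt h)) + \<sigma>\<^sup>2 * ((u + C3 * sqrt h) * h)"
    proof -
      have "mean_square M ?P \<le> K * h\<^sup>2" using P(2) by (simp add: K_def h_def)
      also have "\<dots> \<le> K * (sqrt (b - a) * (h * sqrt h))" using hh K by (intro mult_left_mono) auto
      finally have "lam\<^sup>2 * mean_square M ?P \<le> lam\<^sup>2 * (K * (sqrt (b - a) * (h * sqrt h)))" by (rule mult_left_mono) auto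
      moreover have "- (2 * lam * \<sigma> * (\<integral>\<omega>. ?P \<omega> * ?D \<omega> \<partial>M)) \<le> 2 * \<bar>lam * \<sigma>\<bar> * (K * (h * sqrt h))"
      proof -
        have "- (2 * lam * \<sigma> * (\<integral>\<omega>. ?P \<omega> * ?D \<omega> \<partial>M)) \<le> \<bar>2 * lam * \<sigma> * (\<integral>\<omega>. ?P \<omega> * ?D \<omega> \<partial>M)\<bar>" by linarith
        also have "\<dots> = 2 * \<bar>lam * \<sigma>\<bar> * \<bar>\<integral>\<omega>. ?P \<omega> * ?D \<omega> \<partial>M\<bar>" by (simp add: abs_mult)
        also have "\<dots> \<le> 2 * \<bar>lam * \<sigma>\<bar> * (K * (h * sqrt h))" using PD' by (intro mult_left_mono) auto
        finally show ?thesis .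
      qed
      moreover have "\<sigma>\<^sup>2 * mean_square M ?D \<le> \<sigma>\<^sup>2 * ((u + C3 * sqrt h) * h)"
        using D(2) by (intro mult_left_mono) auto
      ultimately show ?thesis by linarith
    qed
    finally have I: "mean_square M (\<lambda>\<omega>. Y t \<omega> - Y s \<omega>) \<le> lam\<^sup>2 * (K * (sqrt (b - a) * (h * sqrt h)))
        + 2 * \<bar>lam * \<sigma>\<bar> * (K * (h * sqrt h)) + \<sigma>\<^sup>2 * ((u + C3 * sqrt h) * h)" .
    have Pr: "(\<integral>\<omega>. Y s \<omega> * (Y t \<omega> - Y s \<omega>) \<partial>M) \<le> - lam * h * u + \<bar>lam\<bar> * (sqrt K * (sqrt C1 * (h * sqrt h)))"
      using product_step[OF st] by (simp add: h_def u_def K_def C1_def abs_le_iff)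
    have "mean_square M (Y t) \<le> u + 2 * (- lam * h * u + \<bar>lam\<bar> * (sqrt K * (sqrt C1 * (h * sqrt h))))
        + (lam\<^sup>2 * (K * (sqrt (b - a) * (h * sqrt h))) + 2 * \<bar>lam * \<sigma>\<bar> * (K * (h * sqrt h)) + \<sigma>\<^sup>2 * ((u + C3 * sqrt h) * h))"
      unfolding second_moment_split[OF st] u_def[symmetric] by (intro add_mono mult_left_mono I Pr order_refl) auto
    also have "\<dots> = (1 + (- 2 * lam + \<sigma>\<^sup>2) * h) * u + C * (h * sqrt h)"
      by (simp add: C_def algebra_simps)
    finally show ?thesis by (simp add: h_def u_def)
  qed
  with C show thesis by (rule that)
qed

lemma mean_before_end:
  assumes t: "t \<in> {a..<b}"
  shows "(\<integral>\<omega>. Y t \<omega> \<partial>M) = exp (- lam * (t - a)) * (\<integral>\<omega>. Y a \<omega> \<partial>M)"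
proof (rule Euler_exact[where m="\<lambda>t. \<integral>\<omega>. Y t \<omega> \<partial>M"])
  show "\<bar>\<integral>\<omega>. Y s \<omega> \<partial>M\<bar> \<le> sqrt moment_bound" if "a \<le> s" "s \<le> t" for s
  proof -
    have s: "s \<in> {a..<b}" using that t by auto
    have "Y s \<in> borel_measurable M" using Y_measurable s by auto
    from order_trans[OF abs_expectation_le_sqrt(2)[OF this Y_square_integrable(1)[OF s]] real_sqrt_le_mono[OF Y_square_integrable(3)[OF s]]]
    show ?thesis .
  qed
  show "0 \<le> \<bar>lam\<bar> * sqrt increment_const" using increment_const_nonneg by simp
qed (use t mean_step in auto)

lemma second_moment_before_end:
  assumes t: "t \<in> {a..<b}"
  shows "mean_square M (Y t) \<le> exp ((- 2 * lam + \<sigma>\<^sup>2) * (t - a)) * mean_square M (Y a)"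
proof -
  obtain C where C: "0 \<le> C" and step: "\<And>s t. a \<le> s \<Longrightarrow> s \<le> t \<Longrightarrow> t < b \<Longrightarrow>
    (mean_square M (Y t)) \<le> (1 + (- 2 * lam + \<sigma>\<^sup>2) * (t - s)) * mean_square M (Y s) + C * ((t - s) * sqrt (t - s))"
    by (rule second_moment_step) blast
  show ?thesis
    by (rule Euler_upper_bound[where u="\<lambda>t. \<integral>\<omega>. (Y t \<omega>)\<^sup>2 \<partial>M", OF step _ _ C]) (use t in auto)
qed

text \<open>The equation is only assumed before \<open>b\<close>; the final time is reached along the paths.\<close>

lemma end_limit:
  fixes f :: "real \<Rightarrow> real"
  assumes f: "continuous_on UNIV f" and c: "\<And>t. t \<in> {a..<b} \<Longrightarrow> s \<le> t \<Longrightarrow> (\<integral>\<^sup>+\<omega>. ennreal (f (Y t \<omega> - g \<omega>)) \<partial>M) \<le> ennreal c"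
    and s: "s < b" and g: "g \<in> borel_measurable M"
  shows "(\<integral>\<^sup>+\<omega>. ennreal (f (Y b \<omega> - g \<omega>)) \<partial>M) \<le> ennreal c"
proof -
  define z where "z = max a s"
  have z: "a \<le> z" "s \<le> z" "z < b" using s a_less_b by (auto simp: z_def)
  define x where "x n = b - (b - z) * inverse (real (Suc n))" for n
  have "(b - z) * inverse (real (Suc n)) \<le> (b - z) * 1" for n
    using z by (intro mult_left_mono) (auto simp: inverse_le_1_iff)
  moreover have "0 < (b - z) * inverse (real (Suc n))" for n using z by simp
  ultimately have x: "z \<le> x n" "x n < b" for n unfolding x_def by (auto simp: algebra_simps)
  have lim: "x \<longlonglongrightarrow> b"
  proof -
    have "(\<lambda>n. b - (b - z) * inverse (real (Suc n))) \<longlonglongrightarrow> b - (b - z) * 0"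
      by (intro tendsto_intros LIMSEQ_inverse_real_of_nat)
    then show ?thesis by (simp add: x_def[abs_def])
  qed
  have xm: "Y (x n) \<in> borel_measurable M" for n using Y_measurable[of "x n"] x[of n] z by auto
  have fm: "f \<in> borel_measurable borel" using f by (rule borel_measurable_continuous_onI)
  have "(\<integral>\<^sup>+\<omega>. ennreal (f (Y b \<omega> - g \<omega>)) \<partial>M) \<le> (\<integral>\<^sup>+\<omega>. liminf (\<lambda>n. ennreal (f (Y (x n) \<omega> - g \<omega>))) \<partial>M)"
  proof (rule nn_integral_mono_AE)
    show "AE \<omega> in M. ennreal (f (Y b \<omega> - g \<omega>)) \<le> liminf (\<lambda>n. ennreal (f (Y (x n) \<omega> - g \<omega>)))"
      using continuous_paths
    proof eventually_elim
      case (elim \<omega>)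
      have "x n \<in> {a..b}" for n using x[of n] z by auto
      then have "(\<lambda>n. Y (x n) \<omega>) \<longlonglongrightarrow> Y b \<omega>"
        using continuous_on_tendsto_compose[OF elim lim] a_less_b by auto
      then have "(\<lambda>n. f (Y (x n) \<omega> - g \<omega>)) \<longlonglongrightarrow> f (Y b \<omega> - g \<omega>)"
        by (intro continuous_on_tendsto_compose[OF f] tendsto_diff tendsto_const) auto
      from lim_imp_Liminf[OF _ tendsto_ennrealI[OF this]] show ?case by simp
    qed
  qed
  also have "\<dots> \<le> liminf (\<lambda>n. \<integral>\<^sup>+\<omega>. ennreal (f (Y (x n) \<omega> - g \<omega>)) \<partial>M)"
    using measurable_compose[OF borel_measurable_diff[OF xm g] fm] by (intro nn_integral_liminf) auto
  also have "\<dots> \<le> liminf (\<lambda>n::nat. ennreal c)"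
    using c x z by (intro Liminf_mono always_eventually allI) (auto intro: order_trans)
  also have "\<dots> = ennreal c" by (simp add: Liminf_const)
  finally show ?thesis .
qed

text \<open>Only \<open>t = b\<close> is new. Fatou's lemma suffices for the second moment, where an
  upper bound is claimed. The mean is an equality and needs convergence, which follows from the mean
  square continuity at \<open>b\<close> inherited from the increment bound.\<close>

lemma moments:
  assumes t: "t \<in> {a..b}"
  shows "square_integrable M (Y t)"
    "(\<integral>\<omega>. Y t \<omega> \<partial>M) = exp (- lam * (t - a)) * (\<integral>\<omega>. Y a \<omega> \<partial>M)"
    "mean_square M (Y t) \<le> exp ((- 2 * lam + \<sigma>\<^sup>2) * (t - a)) * mean_square M (Y a)"
proof -
  have *: "square_integrable M (Y t) \<and> (\<integral>\<omega>. Y t \<omega> \<partial>M) = exp (- lam * (t - a)) * (\<integral>\<omega>. Y a \<omega> \<partial>M) \<and>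
    (mean_square M (Y t)) \<le> exp ((- 2 * lam + \<sigma>\<^sup>2) * (t - a)) * mean_square M (Y a)"
  proof (cases "t < b")
    case True
    then show ?thesis
      using t mean_before_end[of t] second_moment_before_end[of t] Y_square_integrable(1)[of t] by simp
  next
    case False
    with t have tb: "t = b" by simp
    have Yb: "Y b \<in> borel_measurable M" using Y_measurable a_less_b by auto
    let ?k = "- 2 * lam + \<sigma>\<^sup>2" and ?u = "\<integral>\<omega>. (Y a \<omega>)\<^sup>2 \<partial>M"
    have cp: "continuous_on UNIV (\<lambda>x::real. x\<^sup>2)" by (intro continuous_intros)
    have b2: "nn_square M (Y b) \<le> ennreal moment_bound"
      using end_limit[OF cp, where s=a and g="\<lambda>_. 0" and c=moment_bound] moment_bound a_less_b by simp
    note B = square_integrable_boundI[OF Yb b2 less_imp_le[OF moment_bound_pos]]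
    have inc: "mean_square M (\<lambda>\<omega>. Y b \<omega> - Y s \<omega>) \<le> increment_const * (b - s)"
      and inci: "square_integrable M (\<lambda>\<omega>. Y b \<omega> - Y s \<omega>)" if s: "s \<in> {a..<b}" for s
    proof -
      have Ysm: "Y s \<in> borel_measurable M" using Y_measurable s by auto
      have "nn_square M (\<lambda>\<omega>. Y b \<omega> - Y s \<omega>) \<le> ennreal (increment_const * (b - s))"
      proof (rule end_limit[where f="\<lambda>x. x\<^sup>2" and s=s])
        fix t assume t: "t \<in> {a..<b}" "s \<le> t"
        then have st: "a \<le> s" "s \<le> t" "t < b" using s by auto
        have "nn_square M (\<lambda>\<omega>. Y t \<omega> - Y s \<omega>) = ennreal (mean_square M (\<lambda>\<omega>. Y t \<omega> - Y s \<omega>))"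
          using increment_square_le(1)[OF st] by (intro nn_integral_eq_integral) auto
        also have "\<dots> \<le> ennreal (increment_const * (b - s))"
        proof (rule ennreal_leI)
          have "increment_const * (t - s) \<le> increment_const * (b - s)"
            using st increment_const_nonneg by (intro mult_left_mono) auto
          then show "mean_square M (\<lambda>\<omega>. Y t \<omega> - Y s \<omega>) \<le> increment_const * (b - s)"
            using increment_square_le(2)[OF st] by linarith
        qed
        finally show "nn_square M (\<lambda>\<omega>. Y t \<omega> - Y s \<omega>) \<le> ennreal (increment_const * (b - s))" .
      qed (use s Ysm in \<open>auto intro!: continuous_intros\<close>)
      moreover have "0 \<le> increment_const * (b - s)" using increment_const_nonneg s by auto
      ultimately show "mean_square M (\<lambda>\<omega>. Y b \<omega> - Y s \<omega>) \<le> increment_const * (b - s)" "square_integrable M (\<lambda>\<omega>. Y b \<omega> - Y s \<omega>)"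
        using square_integrable_boundI[OF borel_measurable_diff[OF Yb Ysm]] by blast+
    qed
    define x where "x n = b - (b - a) * inverse (real (Suc n))" for n
    have "(b - a) * inverse (real (Suc n)) \<le> (b - a) * 1" for n
      using a_less_b by (intro mult_left_mono) (auto simp: inverse_le_1_iff)
    moreover have "0 < (b - a) * inverse (real (Suc n))" for n using a_less_b by simp
    ultimately have x: "x n \<in> {a..<b}" for n unfolding x_def by (auto simp: algebra_simps)
    have lim: "x \<longlonglongrightarrow> b"
    proof -
      have "(\<lambda>n. b - (b - a) * inverse (real (Suc n))) \<longlonglongrightarrow> b - (b - a) * 0"
        by (intro tendsto_intros LIMSEQ_inverse_real_of_nat)
      then show ?thesis by (simp add: x_def[abs_def])
    qed
    have dm: "\<bar>(\<integral>\<omega>. Y (x n) \<omega> \<partial>M) - (\<integral>\<omega>. Y b \<omega> \<partial>M)\<bar> \<le> sqrt (increment_const * (b - x n))" for n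
    proof -
      have Yx: "Y (x n) \<in> borel_measurable M" using Y_measurable[of "x n"] x[of n] by auto
      have "(\<integral>\<omega>. Y b \<omega> \<partial>M) - (\<integral>\<omega>. Y (x n) \<omega> \<partial>M) = (\<integral>\<omega>. Y b \<omega> - Y (x n) \<omega> \<partial>M)"
        using B(2) Y_square_integrable(2)[OF x] by simp
      moreover have "\<bar>\<integral>\<omega>. Y b \<omega> - Y (x n) \<omega> \<partial>M\<bar> \<le> sqrt (increment_const * (b - x n))"
        by (rule order_trans[OF abs_expectation_le_sqrt(2)[OF borel_measurable_diff[OF Yb Yx] inci[OF x]]])
          (use inc[OF x] in simp)
      ultimately show ?thesis by linarith
    qed
    have "(\<lambda>n. sqrt (increment_const * (b - x n))) \<longlonglongrightarrow> sqrt (increment_const * (b - b))"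
      by (intro tendsto_intros lim)
    then have z: "(\<lambda>n. sqrt (increment_const * (b - x n))) \<longlonglongrightarrow> 0" by simp
    have "(\<lambda>n. (\<integral>\<omega>. Y (x n) \<omega> \<partial>M) - (\<integral>\<omega>. Y b \<omega> \<partial>M)) \<longlonglongrightarrow> 0"
      by (rule tendsto_0_le[OF z, of _ 1]) (use dm in \<open>auto intro!: always_eventually intro: order_trans[OF _ abs_ge_self]\<close>)
    then have "(\<lambda>n. \<integral>\<omega>. Y (x n) \<omega> \<partial>M) \<longlonglongrightarrow> (\<integral>\<omega>. Y b \<omega> \<partial>M)" by (rule LIM_zero_cancel)
    moreover have "(\<lambda>n. \<integral>\<omega>. Y (x n) \<omega> \<partial>M) \<longlonglongrightarrow> exp (- lam * (b - a)) * (\<integral>\<omega>. Y a \<omega> \<partial>M)"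
      unfolding mean_before_end[OF x] by (intro tendsto_intros lim)
    ultimately have mean: "(\<integral>\<omega>. Y b \<omega> \<partial>M) = exp (- lam * (b - a)) * (\<integral>\<omega>. Y a \<omega> \<partial>M)"
      by (rule LIMSEQ_unique)
    \<comment> \<open>\<open>end_limit\<close> takes a constant bound whereas the rate varies with
      \<open>t\<close>. Any \<open>c\<close> above the limiting value is such a bound on a left
      neighbourhood of \<open>b\<close>, and \<open>dense_ge\<close> then removes the slack.\<close>
    have le: "mean_square M (Y b) \<le> c" if c: "exp (?k * (b - a)) * ?u < c" for c
    proof -
      have "((\<lambda>t. exp (?k * (t - a)) * ?u) \<longlongrightarrow> exp (?k * (b - a)) * ?u) (at_left b)"
        by (intro tendsto_intros)
      then have "\<forall>\<^sub>F t in at_left b. exp (?k * (t - a)) * ?u < c" using c by (rule order_tendstoD)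
      then obtain s where s: "s < b" and sc: "\<forall>t>s. t < b \<longrightarrow> exp (?k * (t - a)) * ?u < c"
        unfolding eventually_at_left[OF a_less_b] by auto
      have c0: "0 \<le> c"
      proof -
        have "0 \<le> exp (?k * (b - a)) * ?u" by simp
        with c show ?thesis by linarith
      qed
      have "(\<integral>\<^sup>+\<omega>. ennreal ((\<lambda>x. x\<^sup>2) (Y b \<omega> - (\<lambda>_. 0) \<omega>)) \<partial>M) \<le> ennreal c"
      proof (rule end_limit[where s="(s + b) / 2"])
        fix t assume t: "t \<in> {a..<b}" "(s + b) / 2 \<le> t"
        have "nn_square M (Y t) = ennreal (mean_square M (Y t))"
          using Y_square_integrable(1)[OF t(1)] by (intro nn_integral_eq_integral) auto
        also have "\<dots> \<le> ennreal c"
          using second_moment_before_end[OF t(1)] sc[rule_format, of t] t s by (intro ennreal_leI) auto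
        finally show "nn_square M (\<lambda>\<omega>. Y t \<omega> - 0) \<le> ennreal c" by simp
      qed (use s in \<open>auto intro!: continuous_intros\<close>)
      then have "nn_square M (Y b) \<le> ennreal c" by simp
      then show ?thesis by (rule square_integrable_boundI(3)[OF Yb _ c0])
    qed
    then have "mean_square M (Y b) \<le> exp (?k * (b - a)) * ?u" by (rule dense_ge)
    with mean B(1) show ?thesis unfolding tb by simp
  qed
  then show "square_integrable M (Y t)"
    "(\<integral>\<omega>. Y t \<omega> \<partial>M) = exp (- lam * (t - a)) * (\<integral>\<omega>. Y a \<omega> \<partial>M)"
    "mean_square M (Y t) \<le> exp ((- 2 * lam + \<sigma>\<^sup>2) * (t - a)) * mean_square M (Y a)" by auto
qed

end

subsection \<open>The semi-discrete model\<close>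

text \<open>Independence is given for the whole vector of increments; the sigma-algebra of one
  component is contained in that of the vector and inherits it.\<close>

lemma brownian_component:
  assumes "prob_space M" and W: "standard_brownian_motion M (W i)" and F: "brownian_filtration M F W"
  shows "brownian M F (W i)"
proof -
  interpret prob_space M by fact
  interpret filtration "space M" F using F by (simp add: brownian_filtration_def)
  show ?thesis
  proof
    show "subalgebra M (F t)" for t using F by (simp add: brownian_filtration_def)
    show "sets (F s) \<subseteq> sets (F t)" if "s \<le> t" for s t using sets_F_mono[OF that] .
    show "W i t \<in> borel_measurable (F t)" if "0 \<le> t" for t using F that by (simp add: brownian_filtration_def)
    show "distributed M lborel (\<lambda>\<omega>. W i t \<omega> - W i s \<omega>) (normal_density 0 (sqrt (t - s)))"
      if "0 \<le> s" "s < t" for s t using W that by (simp add: standard_brownian_motion_def)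
    fix s t :: real assume st: "0 \<le> s" "s \<le> t"
    let ?V = "\<lambda>\<omega>. (\<chi> j. W j t \<omega> - W j s \<omega>)"
    have ind: "indep_set (sets (F s)) (sets (vimage_algebra (space M) ?V borel))"
      using F st by (simp add: brownian_filtration_def)
    have "(\<lambda>x. x $ i) \<circ> ?V \<in> borel_measurable (vimage_algebra (space M) ?V borel)"
      by (rule measurable_comp[OF measurable_vimage_algebra1]) auto
    then have "(\<lambda>\<omega>. W i t \<omega> - W i s \<omega>) \<in> borel_measurable (vimage_algebra (space M) ?V borel)"
      by (simp add: comp_def)
    then have "sets (vimage_algebra (space M) (\<lambda>\<omega>. W i t \<omega> - W i s \<omega>) borel)
        \<subseteq> sets (vimage_algebra (space M) ?V borel)"
      by (intro sets_image_in_sets) auto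
    with ind show "indep_set (sets (F s)) (sets (vimage_algebra (space M) (\<lambda>\<omega>. W i t \<omega> - W i s \<omega>) borel))"
      unfolding indep_sets2_eq by blast
  qed
qed

section \<open>Means and variances of random vectors\<close>

lemma power2_norm_vec: "(norm (x :: real ^ 'd::finite))\<^sup>2 = (\<Sum>i\<in>UNIV. (x $ i)\<^sup>2)"
  unfolding power2_norm_eq_inner inner_vec_def by (simp add: power2_eq_square)

lemma norm_add_sq_le: "(norm (x + y))\<^sup>2 \<le> 2 * (norm x)\<^sup>2 + 2 * (norm y)\<^sup>2" for x y :: "'v::real_inner"
proof -
  have "0 \<le> (norm (x - y))\<^sup>2" by simp
  then show ?thesis by (simp add: power2_norm_eq_inner inner_simps inner_commute)
qed

lemma norm_sq_le_weighted:
  fixes x y :: "'v::real_inner"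
  assumes "0 < e"
  shows "(norm x)\<^sup>2 \<le> (1 + e) * (norm y)\<^sup>2 + (1 + 1 / e) * (norm (x - y))\<^sup>2"
proof -
  have "norm x \<le> norm y + norm (x - y)" by (metis add.commute diff_add_cancel norm_triangle_ineq)
  then have "(norm x)\<^sup>2 \<le> (norm y + norm (x - y))\<^sup>2" by (intro power_mono) auto
  also have "\<dots> \<le> (1 + e) * (norm y)\<^sup>2 + (1 + 1 / e) * (norm (x - y))\<^sup>2"
    using sq_le_weighted[OF assms, of "norm y + norm (x - y)" "norm y"] by simp
  finally show ?thesis .
qed

lemma (in prob_space) integrable_square_shift:
  fixes X :: "'a \<Rightarrow> real ^ 'd::finite"
  assumes X: "X \<in> borel_measurable M" "square_integrable M (\<lambda>\<omega>. norm (X \<omega> - c))"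
  shows "square_integrable M (\<lambda>\<omega>. norm (X \<omega> - c'))"
proof (rule Bochner_Integration.integrable_bound[of M "\<lambda>\<omega>. 2 * (norm (X \<omega> - c))\<^sup>2 + 2 * (norm (c - c'))\<^sup>2"])
  show "AE \<omega> in M. norm ((norm (X \<omega> - c'))\<^sup>2) \<le> norm (2 * (norm (X \<omega> - c))\<^sup>2 + 2 * (norm (c - c'))\<^sup>2)"
  proof (intro AE_I2)
    fix \<omega>
    show "norm ((norm (X \<omega> - c'))\<^sup>2) \<le> norm (2 * (norm (X \<omega> - c))\<^sup>2 + 2 * (norm (c - c'))\<^sup>2)"
      using norm_add_sq_le[of "X \<omega> - c" "c - c'"] by simp
  qed
qed (use X in auto)

lemma (in prob_space) integrable_vec_of_square:
  fixes X :: "'a \<Rightarrow> real ^ 'd::finite"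
  assumes [measurable]: "X \<in> borel_measurable M" and X: "square_integrable M (\<lambda>\<omega>. norm (X \<omega>))"
  shows "integrable M X"
proof -
  have "integrable M (\<lambda>\<omega>. norm (X \<omega>))"
    by (rule square_integrable_imp_integrable[OF _ X]) measurable
  then show ?thesis by (rule integrable_norm_cancel) measurable
qed

lemma (in prob_space) bias_variance:
  fixes X :: "'a \<Rightarrow> real ^ 'd::finite"
  assumes Xm: "X \<in> borel_measurable M" and X: "square_integrable M (\<lambda>\<omega>. norm (X \<omega>))"
  defines "m \<equiv> \<integral>\<omega>. X \<omega> \<partial>M"
  shows "mean_square M (\<lambda>\<omega>. norm (X \<omega> - c)) = mean_square M (\<lambda>\<omega>. norm (X \<omega> - m)) + (norm (m - c))\<^sup>2"
proof -
  note i = integrable_vec_of_square[OF Xm X]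
  have i2: "square_integrable M (\<lambda>\<omega>. norm (X \<omega> - m))" using integrable_square_shift[OF Xm, of 0] X by simp
  have i3: "integrable M (\<lambda>\<omega>. (X \<omega> - m) \<bullet> (m - c))"
    using i by (intro integrable_inner_left) auto
  have "(\<integral>\<omega>. (X \<omega> - m) \<bullet> (m - c) \<partial>M) = (\<integral>\<omega>. X \<omega> - m \<partial>M) \<bullet> (m - c)"
    using i by (intro integral_inner_left) auto
  also have "(\<integral>\<omega>. X \<omega> - m \<partial>M) = 0" using i by (simp add: m_def prob_space)
  finally have z: "(\<integral>\<omega>. (X \<omega> - m) \<bullet> (m - c) \<partial>M) = 0" by simp
  have "(norm (X \<omega> - c))\<^sup>2 = (norm (X \<omega> - m))\<^sup>2 + 2 * ((X \<omega> - m) \<bullet> (m - c)) + (norm (m - c))\<^sup>2" for \<omega>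
    by (simp add: power2_norm_eq_inner inner_simps inner_commute)
  then have "mean_square M (\<lambda>\<omega>. norm (X \<omega> - c))
      = (\<integral>\<omega>. (norm (X \<omega> - m))\<^sup>2 + 2 * ((X \<omega> - m) \<bullet> (m - c)) + (norm (m - c))\<^sup>2 \<partial>M)" by simp
  also have "\<dots> = mean_square M (\<lambda>\<omega>. norm (X \<omega> - m)) + (norm (m - c))\<^sup>2"
    using i2 i3 z by (simp add: prob_space)
  finally show ?thesis .
qed

text \<open>Jensen's inequality for the density \<open>w / W\<close>, in the form of Cauchy-Schwarz
  with \<open>w * d\<close> split as \<open>sqrt w * (sqrt w * d)\<close>. One factor
  \<open>W\<close> cancels against \<open>W\<^sup>2\<close>, and only then is the remaining weight
  replaced by its bound \<open>C\<close>; this leaves the ratio \<open>C / W\<close> of the step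
  size condition.\<close>

lemma (in prob_space) weighted_mean_deviation:
  fixes X :: "'a \<Rightarrow> real ^ 'd::finite" and w :: "'a \<Rightarrow> real"
  assumes Xm: "X \<in> borel_measurable M" and X: "square_integrable M (\<lambda>\<omega>. norm (X \<omega>))"
    and wm: "w \<in> borel_measurable M" and w: "\<And>\<omega>. 0 < w \<omega>" "\<And>\<omega>. w \<omega> \<le> C"
  defines "m \<equiv> \<integral>\<omega>. X \<omega> \<partial>M" and "W \<equiv> \<integral>\<omega>. w \<omega> \<partial>M"
  shows "0 < W" "(norm ((\<integral>\<omega>. w \<omega> *\<^sub>R X \<omega> \<partial>M) /\<^sub>R W - m))\<^sup>2 \<le> C / W * mean_square M (\<lambda>\<omega>. norm (X \<omega> - m))"
proof -
  note [measurable] = Xm wm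
  have C: "0 < C" using w(1)[of undefined] w(2)[of undefined] by linarith
  have iw: "integrable M w"
    using w by (intro integrable_const_bound[of _ C]) (auto intro!: AE_I2 simp: less_imp_le)
  show W: "0 < W"
  proof -
    have "W \<noteq> 0"
    proof
      assume "W = 0"
      then have "AE \<omega> in M. w \<omega> = 0"
        using integral_nonneg_eq_0_iff_AE[OF iw] w(1) by (simp add: W_def less_imp_le)
      then have "AE \<omega> in M. False" by eventually_elim (use w(1) in \<open>metis less_irrefl\<close>)
      then show False by simp
    qed
    moreover have "0 \<le> W" unfolding W_def by (intro Bochner_Integration.integral_nonneg less_imp_le w)
    ultimately show ?thesis by simp
  qed
  let ?d = "\<lambda>\<omega>. norm (X \<omega> - m)"
  note iX = integrable_vec_of_square[OF Xm X]
  have i2: "square_integrable M ?d" using integrable_square_shift[OF Xm, of 0] X by simp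
  have iwX: "integrable M (\<lambda>\<omega>. w \<omega> *\<^sub>R X \<omega>)"
    by (rule Bochner_Integration.integrable_bound[OF integrable_scaleR_right[OF iX, of C]])
      (use w C in \<open>auto simp: less_imp_le abs_of_pos intro!: AE_I2 mult_right_mono\<close>)
  have iwd: "integrable M (\<lambda>\<omega>. w \<omega> * (?d \<omega>)\<^sup>2)"
    by (rule Bochner_Integration.integrable_bound[OF integrable_mult_right[OF i2, of C]])
      (use w C in \<open>auto simp: less_imp_le abs_of_pos intro!: AE_I2 mult_right_mono\<close>)
  have wwd: "(sqrt (w \<omega>))\<^sup>2 = w \<omega>" "(sqrt (w \<omega>) * ?d \<omega>)\<^sup>2 = w \<omega> * (?d \<omega>)\<^sup>2" "sqrt (w \<omega>) * (sqrt (w \<omega>) * ?d \<omega>) = w \<omega> * ?d \<omega>" for \<omega>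
    using w(1)[of \<omega>] by (auto simp: power_mult_distrib mult.assoc[symmetric])
  have CS: "\<bar>\<integral>\<omega>. w \<omega> * ?d \<omega> \<partial>M\<bar> \<le> sqrt W * sqrt (\<integral>\<omega>. w \<omega> * (?d \<omega>)\<^sup>2 \<partial>M)"
    using Cauchy_Schwarz_expectation(2)[of "\<lambda>\<omega>. sqrt (w \<omega>)" "\<lambda>\<omega>. sqrt (w \<omega>) * ?d \<omega>"] iw iwd
    unfolding wwd W_def by simp
  have "(\<integral>\<omega>. w \<omega> *\<^sub>R (X \<omega> - m) \<partial>M) = (\<integral>\<omega>. w \<omega> *\<^sub>R X \<omega> \<partial>M) - W *\<^sub>R m"
    using iwX iw by (simp add: scaleR_diff_right W_def)
  then have "(\<integral>\<omega>. w \<omega> *\<^sub>R X \<omega> \<partial>M) /\<^sub>R W - m = (\<integral>\<omega>. w \<omega> *\<^sub>R (X \<omega> - m) \<partial>M) /\<^sub>R W"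
    using W by (simp add: scaleR_diff_right)
  then have "norm ((\<integral>\<omega>. w \<omega> *\<^sub>R X \<omega> \<partial>M) /\<^sub>R W - m) = norm (\<integral>\<omega>. w \<omega> *\<^sub>R (X \<omega> - m) \<partial>M) / W"
    using W by (simp add: divide_inverse_commute)
  also have "\<dots> \<le> (\<integral>\<omega>. w \<omega> * ?d \<omega> \<partial>M) / W"
  proof (rule divide_right_mono)
    have "norm (\<integral>\<omega>. w \<omega> *\<^sub>R (X \<omega> - m) \<partial>M) \<le> (\<integral>\<omega>. norm (w \<omega> *\<^sub>R (X \<omega> - m)) \<partial>M)" by (rule integral_norm_bound)
    also have "\<dots> = (\<integral>\<omega>. w \<omega> * ?d \<omega> \<partial>M)" using w(1) by (simp add: abs_of_pos)
    finally show "norm (\<integral>\<omega>. w \<omega> *\<^sub>R (X \<omega> - m) \<partial>M) \<le> (\<integral>\<omega>. w \<omega> * ?d \<omega> \<partial>M)" .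
  qed (use W in auto)
  also have "\<dots> \<le> sqrt W * sqrt (\<integral>\<omega>. w \<omega> * (?d \<omega>)\<^sup>2 \<partial>M) / W" using CS W by (intro divide_right_mono) auto
  finally have "(norm ((\<integral>\<omega>. w \<omega> *\<^sub>R X \<omega> \<partial>M) /\<^sub>R W - m))\<^sup>2 \<le> (sqrt W * sqrt (\<integral>\<omega>. w \<omega> * (?d \<omega>)\<^sup>2 \<partial>M) / W)\<^sup>2"
    by (intro power_mono) auto
  also have "\<dots> = (\<integral>\<omega>. w \<omega> * (?d \<omega>)\<^sup>2 \<partial>M) / W"
  proof -
    have "0 \<le> (\<integral>\<omega>. w \<omega> * (?d \<omega>)\<^sup>2 \<partial>M)" using w(1) by (intro Bochner_Integration.integral_nonneg) (simp add: less_imp_le)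
    then have "(sqrt W * sqrt (\<integral>\<omega>. w \<omega> * (?d \<omega>)\<^sup>2 \<partial>M) / W)\<^sup>2 = W * (\<integral>\<omega>. w \<omega> * (?d \<omega>)\<^sup>2 \<partial>M) / W\<^sup>2"
      using W by (simp only: power_divide power_mult_distrib real_sqrt_pow2 less_imp_le)
    then show ?thesis using W by (simp add: power2_eq_square)
  qed
  also have "\<dots> \<le> (\<integral>\<omega>. C * (?d \<omega>)\<^sup>2 \<partial>M) / W"
    using W w(2) iwd i2 by (intro divide_right_mono integral_mono mult_right_mono) auto
  also have "\<dots> = C / W * mean_square M ?d" by simp
  finally show "(norm ((\<integral>\<omega>. w \<omega> *\<^sub>R X \<omega> \<partial>M) /\<^sub>R W - m))\<^sup>2 \<le> C / W * mean_square M ?d" .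
qed

section \<open>One grid interval of the semi-discrete model\<close>

locale semi_discrete = prob_space M for M :: "'a measure" +
  fixes F :: "real \<Rightarrow> 'a measure" and W :: "'d::finite \<Rightarrow> real \<Rightarrow> 'a \<Rightarrow> real"
    and \<beta> lam \<sigma> \<gamma> :: real and L :: "real ^ 'd \<Rightarrow> real" and X :: "real \<Rightarrow> 'a \<Rightarrow> real ^ 'd"
  assumes brownian_motion: "\<And>i. standard_brownian_motion M (W i)"
    and filtration: "brownian_filtration M F W"
    and initial: "square_integrable M (\<lambda>\<omega>. norm (X 0 \<omega>))"
    and solution: "semi_discrete_solution M F W \<beta> lam \<sigma> \<gamma> L X"
    and \<gamma>_pos: "0 < \<gamma>"
begin

abbreviation "t\<^sub>g \<equiv> grid \<gamma>"
abbreviation "x\<^sub>c \<equiv> consensus_point M \<beta> \<gamma> L X"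

lemma grid_nonneg: "0 \<le> t\<^sub>g k" and grid_Suc: "t\<^sub>g (Suc k) = t\<^sub>g k + \<gamma>" and grid_less: "t\<^sub>g k < t\<^sub>g (Suc k)"
  using \<gamma>_pos by (auto simp: grid_def algebra_simps)

lemma X_adapted: "0 \<le> t \<Longrightarrow> X t \<in> borel_measurable (F t)"
  using solution by (simp add: semi_discrete_solution_def)

lemma X_measurable: "0 \<le> t \<Longrightarrow> X t \<in> borel_measurable M"
  using measurable_from_subalg[OF _ X_adapted] filtration by (auto simp: brownian_filtration_def)

text \<open>Within one interval the consensus point is constant, so subtracting it changes no
  increment, and each component of the difference solves a scalar equation driven by its own
  Brownian motion.\<close>

lemma component_linear_sde:
  assumes sq: "square_integrable M (\<lambda>\<omega>. norm (X (t\<^sub>g k) \<omega>))"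
  shows "linear_sde M F (W i) (\<lambda>t \<omega>. (X t \<omega> - x\<^sub>c (Suc k)) $ i) (t\<^sub>g k) (t\<^sub>g (Suc k)) lam \<sigma>"
proof -
  let ?c = "x\<^sub>c (Suc k)" and ?a = "t\<^sub>g k" and ?b = "t\<^sub>g (Suc k)"
  interpret B: brownian M F "W i"
    by (rule brownian_component[OF prob_space_axioms brownian_motion filtration])
  have cont: "AE \<omega> in M. continuous_on {0..} (\<lambda>t. X t \<omega>)"
    using solution by (simp add: semi_discrete_solution_def)
  have comp: "(\<lambda>x::real ^ 'd. (x - ?c) $ i) \<in> borel_measurable borel"
    by (intro borel_measurable_continuous_onI continuous_intros)
  show ?thesis
  proof
    show "0 \<le> ?a" by (rule grid_nonneg)
    show "?a < ?b" by (rule grid_less)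
    show "AE \<omega> in M. continuous_on {?a..?b} (\<lambda>t. (X t \<omega> - ?c) $ i)"
      using cont
    proof eventually_elim
      case (elim \<omega>)
      show ?case
        using grid_nonneg[of k] by (intro continuous_intros continuous_on_subset[OF elim]) auto
    qed
    show "(\<lambda>\<omega>. (X t \<omega> - ?c) $ i) \<in> borel_measurable (F t)" if "t \<in> {?a..?b}" for t
      using measurable_compose[OF X_adapted comp] that grid_nonneg[of k] by auto
    have i2: "square_integrable M (\<lambda>\<omega>. norm (X ?a \<omega> - ?c))"
      using integrable_square_shift[OF X_measurable[OF grid_nonneg], of k 0] sq by simp
    show "square_integrable M (\<lambda>\<omega>. (X ?a \<omega> - ?c) $ i)"
    proof (rule Bochner_Integration.integrable_bound[OF i2])
      show "(\<lambda>\<omega>. ((X ?a \<omega> - ?c) $ i)\<^sup>2) \<in> borel_measurable M"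
        using measurable_compose[OF X_measurable[OF grid_nonneg] comp] by measurable
      show "AE \<omega> in M. norm (((X ?a \<omega> - ?c) $ i)\<^sup>2) \<le> norm ((norm (X ?a \<omega> - ?c))\<^sup>2)"
        using component_le_norm_cart[of "X ?a _ - ?c" i] by (simp add: abs_le_square_iff[symmetric])
    qed
    fix t assume t: "t \<in> {?a..<?b}"
    have "\<exists>J. (\<forall>i. has_ito_integral M F (W i) (\<lambda>s \<omega>. (X s \<omega> - ?c) $ i) ?a t (J i)) \<and>
        (AE \<omega> in M. X t \<omega> = X ?a \<omega> - lam *\<^sub>R (LINT s:{?a..t}|lborel. X s \<omega> - ?c)
             + \<sigma> *\<^sub>R (\<Sum>i\<in>UNIV. J i \<omega> *\<^sub>R axis i 1))"
      using conjunct2[OF conjunct2[OF solution[unfolded semi_discrete_solution_def]], THEN spec[of _ "Suc k"]] t by simp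
    then obtain J where J: "\<And>i. has_ito_integral M F (W i) (\<lambda>s \<omega>. (X s \<omega> - ?c) $ i) ?a t (J i)"
      and eq: "AE \<omega> in M. X t \<omega> = X ?a \<omega> - lam *\<^sub>R (LINT s:{?a..t}|lborel. X s \<omega> - ?c)
             + \<sigma> *\<^sub>R (\<Sum>i\<in>UNIV. J i \<omega> *\<^sub>R axis i 1)"
      by blast
    show "\<exists>J. has_ito_integral M F (W i) (\<lambda>s \<omega>. (X s \<omega> - ?c) $ i) ?a t J \<and>
        (AE \<omega> in M. (X t \<omega> - ?c) $ i = (X ?a \<omega> - ?c) $ i - lam * (LINT r:{?a..t}|lborel. (X r \<omega> - ?c) $ i) + \<sigma> * J \<omega>)"
    proof (intro exI conjI)
      show "has_ito_integral M F (W i) (\<lambda>s \<omega>. (X s \<omega> - ?c) $ i) ?a t (J i)" by (rule J)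
      show "AE \<omega> in M. (X t \<omega> - ?c) $ i = (X ?a \<omega> - ?c) $ i - lam * (LINT r:{?a..t}|lborel. (X r \<omega> - ?c) $ i) + \<sigma> * J i \<omega>"
        using eq cont
      proof eventually_elim
        case (elim \<omega>)
        have "set_integrable lborel {?a..t} (\<lambda>s. X s \<omega> - ?c)"
          using grid_nonneg[of k]
          by (intro borel_integrable_atLeastAtMost' continuous_intros continuous_on_subset[OF elim(2)]) auto
        then have lin: "(LINT s:{?a..t}|lborel. X s \<omega> - ?c) $ i = (LINT r:{?a..t}|lborel. (X r \<omega> - ?c) $ i)"
          unfolding set_integrable_def set_lebesgue_integral_def
          by (subst integral_bounded_linear[OF bounded_linear_vec_nth, symmetric]) auto
        have sum: "(\<Sum>j\<in>UNIV. J j \<omega> *\<^sub>R axis j 1) $ i = J i \<omega>"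
          by (simp add: axis_def if_distrib cong: if_cong)
        show ?case
          using arg_cong[OF elim(1), of "\<lambda>x. x $ i"] lin sum by simp
      qed
    qed
  qed
qed

text \<open>The right end of the interval is included, so that square integrability passes from one
  grid time to the next.\<close>

lemma step_moments:
  assumes sq: "square_integrable M (\<lambda>\<omega>. norm (X (t\<^sub>g k) \<omega>))" and t: "t \<in> {t\<^sub>g k..t\<^sub>g (Suc k)}"
  shows "square_integrable M (\<lambda>\<omega>. norm (X t \<omega>))"
    "mean_at M X t - x\<^sub>c (Suc k) = exp (- lam * (t - t\<^sub>g k)) *\<^sub>R (mean_at M X (t\<^sub>g k) - x\<^sub>c (Suc k))"
    "mean_square M (\<lambda>\<omega>. norm (X t \<omega> - x\<^sub>c (Suc k)))
      \<le> exp ((- 2 * lam + \<sigma>\<^sup>2) * (t - t\<^sub>g k)) * mean_square M (\<lambda>\<omega>. norm (X (t\<^sub>g k) \<omega> - x\<^sub>c (Suc k)))"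
proof -
  let ?c = "x\<^sub>c (Suc k)" and ?a = "t\<^sub>g k"
  note mom = linear_sde.moments[OF component_linear_sde[OF sq] t]
  have aa: "?a \<in> {t\<^sub>g k..t\<^sub>g (Suc k)}" using grid_less[of k] by auto
  note moma = linear_sde.moments(1)[OF component_linear_sde[OF sq] aa]
  have t0: "0 \<le> t" using t grid_nonneg[of k] by auto
  have "square_integrable M (\<lambda>\<omega>. norm (X t \<omega> - ?c))"
    unfolding power2_norm_vec using mom(1) by (intro Bochner_Integration.integrable_sum)
  then show sqt: "square_integrable M (\<lambda>\<omega>. norm (X t \<omega>))"
    using integrable_square_shift[OF X_measurable[OF t0], of ?c 0] by simp
  note it = integrable_vec_of_square[OF X_measurable[OF t0] sqt]
  note ia = integrable_vec_of_square[OF X_measurable[OF grid_nonneg] sq]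
  have "(mean_at M X s - ?c) $ i = (\<integral>\<omega>. (X s \<omega> - ?c) $ i \<partial>M)" if "integrable M (X s)" for s i
  proof -
    have "mean_at M X s - ?c = (\<integral>\<omega>. X s \<omega> - ?c \<partial>M)" using that by (simp add: mean_at_def prob_space)
    then show ?thesis
      using integral_bounded_linear[OF bounded_linear_vec_nth[of i], of M "\<lambda>\<omega>. X s \<omega> - ?c"] that by simp
  qed
  then show "mean_at M X t - ?c = exp (- lam * (t - ?a)) *\<^sub>R (mean_at M X ?a - ?c)"
    using it ia mom(2) by (simp add: vec_eq_iff)
  have "mean_square M (\<lambda>\<omega>. norm (X t \<omega> - ?c)) = (\<Sum>i\<in>UNIV. \<integral>\<omega>. ((X t \<omega> - ?c) $ i)\<^sup>2 \<partial>M)"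
    unfolding power2_norm_vec using mom(1) by (intro Bochner_Integration.integral_sum)
  also have "\<dots> \<le> (\<Sum>i\<in>UNIV. exp ((- 2 * lam + \<sigma>\<^sup>2) * (t - ?a)) * mean_square M (\<lambda>\<omega>. (X ?a \<omega> - ?c) $ i))"
    by (intro sum_mono mom(3))
  also have "\<dots> = exp ((- 2 * lam + \<sigma>\<^sup>2) * (t - ?a)) * (\<integral>\<omega>. (\<Sum>i\<in>UNIV. ((X ?a \<omega> - ?c) $ i)\<^sup>2) \<partial>M)"
    using moma by (subst Bochner_Integration.integral_sum) (auto simp: sum_distrib_left)
  finally show "mean_square M (\<lambda>\<omega>. norm (X t \<omega> - ?c))
      \<le> exp ((- 2 * lam + \<sigma>\<^sup>2) * (t - ?a)) * mean_square M (\<lambda>\<omega>. norm (X ?a \<omega> - ?c))"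
    unfolding power2_norm_vec .
qed

lemma grid_square_integrable: "square_integrable M (\<lambda>\<omega>. norm (X (t\<^sub>g k) \<omega>))"
proof (induction k)
  case 0
  then show ?case using initial by (simp add: grid_def)
next
  case (Suc k)
  then show ?case using step_moments(1)[OF Suc, of "t\<^sub>g (Suc k)"] grid_less[of k] by simp
qed

end

section \<open>Uniform bounds along the grid\<close>

locale stable_semi_discrete = semi_discrete +
  assumes L_continuous: "continuous_on UNIV L"
    and L_minimum: "\<exists>x. \<forall>y. L x \<le> L y"
    and \<beta>_pos: "0 < \<beta>"
    and consensus_bounded: "bounded (x\<^sub>c ` {1..})"
    and stable: "\<sigma>\<^sup>2 < 2 * lam"
begin

abbreviation "\<kappa> \<equiv> - 2 * lam + \<sigma>\<^sup>2"
definition "weight x = exp (- \<beta> * L x)"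
definition "weight_max = exp (- \<beta> * (INF x. L x))"
abbreviation "m k \<equiv> mean_at M X (t\<^sub>g k)"
abbreviation "V k \<equiv> variance_at M X (t\<^sub>g k)"
abbreviation "M\<^sub>L k \<equiv> weight_at M \<beta> L X (t\<^sub>g k)"

lemma Xg_measurable [measurable]: "X (t\<^sub>g k) \<in> borel_measurable M"
  by (rule X_measurable[OF grid_nonneg])

lemma weight_pos: "0 < weight x"
  by (simp add: weight_def)

lemma weight_measurable [measurable]: "weight \<in> borel_measurable borel"
  unfolding weight_def[abs_def] by (intro borel_measurable_continuous_onI continuous_intros L_continuous)

lemma weight_le_max: "weight x \<le> weight_max"
proof -
  have "bdd_below (range L)" using L_minimum by (auto intro: bdd_belowI)
  then have "(INF x. L x) \<le> L x" by (rule cINF_lower) simp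
  then show ?thesis using \<beta>_pos by (simp add: weight_def weight_max_def)
qed

lemma weight_integrable: "integrable M (\<lambda>\<omega>. weight (X (t\<^sub>g k) \<omega>))"
  by (rule integrable_const_bound[of _ weight_max]) (auto simp: weight_le_max abs_of_pos weight_pos)

lemma grid_shift_integrable: "square_integrable M (\<lambda>\<omega>. norm (X (t\<^sub>g k) \<omega> - c))"
  using integrable_square_shift[OF Xg_measurable, of k 0] grid_square_integrable[of k] by simp

text \<open>The contraction by \<open>exp (\<kappa> * \<gamma>)\<close> is centred at the consensus
  point. Passing from the origin to that centre and back costs a factor
  \<open>1 + \<epsilon>\<close> each time plus a constant controlled by the bound \<open>R\<close>,
  so an affine recursion with slope below 1 remains.\<close>

lemma grid_second_moment_bounded:
  obtains B where "0 < B" "\<And>k. mean_square M (\<lambda>\<omega>. norm (X (t\<^sub>g k) \<omega>)) \<le> B"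
proof -
  define A where "A k = mean_square M (\<lambda>\<omega>. norm (X (t\<^sub>g k) \<omega>))" for k
  obtain R where R: "\<And>k. norm (x\<^sub>c (Suc k)) \<le> R"
    using consensus_bounded unfolding bounded_iff by force
  have R0: "0 \<le> R" using norm_ge_zero order_trans R by blast
  \<comment> \<open>Half of the exponent is spent on the two changes of centre:
    \<open>(1 + \<epsilon>)\<^sup>2 = exp (- \<kappa> * \<gamma> / 2)\<close>, so the slope is
    \<open>p = exp (\<kappa> * \<gamma> / 2)\<close>.\<close>
  define \<epsilon> where "\<epsilon> = exp (- \<kappa> * \<gamma> / 4) - 1"
  have \<epsilon>: "0 < \<epsilon>" using stable \<gamma>_pos by (simp add: \<epsilon>_def mult_pos_pos)
  define q where "q = exp (\<kappa> * \<gamma>)"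
  define p where "p = exp (\<kappa> * \<gamma> / 2)"
  have p: "0 < p" "p < 1" using stable \<gamma>_pos by (auto simp: p_def mult_neg_pos)
  have qp: "(1 + \<epsilon>) * (q * (1 + \<epsilon>)) = p"
    by (simp add: \<epsilon>_def q_def p_def flip: exp_add) (simp add: algebra_simps)
  define D where "D = (1 + 1 / \<epsilon>) * R\<^sup>2"
  define C where "C = (1 + \<epsilon>) * (q * D) + D"
  have D0: "0 \<le> D" and C0: "0 \<le> C" using \<epsilon> by (auto simp: D_def C_def q_def)
  have step: "A (Suc k) \<le> p * A k + C" for k
  proof -
    let ?c = "x\<^sub>c (Suc k)"
    have c: "(1 + 1 / \<epsilon>) * (norm ?c)\<^sup>2 \<le> D"
      using R[of k] \<epsilon> unfolding D_def by (intro mult_left_mono power_mono) auto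
    have "A (Suc k) \<le> (\<integral>\<omega>. (1 + \<epsilon>) * (norm (X (t\<^sub>g (Suc k)) \<omega> - ?c))\<^sup>2 + D \<partial>M)"
      unfolding A_def
    proof (rule integral_mono)
      fix \<omega>
      show "(norm (X (t\<^sub>g (Suc k)) \<omega>))\<^sup>2 \<le> (1 + \<epsilon>) * (norm (X (t\<^sub>g (Suc k)) \<omega> - ?c))\<^sup>2 + D"
        using norm_sq_le_weighted[OF \<epsilon>, of "X (t\<^sub>g (Suc k)) \<omega>" "X (t\<^sub>g (Suc k)) \<omega> - ?c"] c by simp
    qed (use grid_square_integrable grid_shift_integrable in auto)
    also have "\<dots> = (1 + \<epsilon>) * mean_square M (\<lambda>\<omega>. norm (X (t\<^sub>g (Suc k)) \<omega> - ?c)) + D"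
      using grid_shift_integrable by (simp add: prob_space)
    also have "\<dots> \<le> (1 + \<epsilon>) * (q * mean_square M (\<lambda>\<omega>. norm (X (t\<^sub>g k) \<omega> - ?c))) + D"
      using step_moments(3)[OF grid_square_integrable, of "t\<^sub>g (Suc k)" k] grid_less[of k] \<epsilon>
      by (intro add_right_mono mult_left_mono) (auto simp: q_def grid_Suc)
    also have "\<dots> \<le> (1 + \<epsilon>) * (q * ((1 + \<epsilon>) * A k + D)) + D"
    proof (intro add_right_mono mult_left_mono)
      have "mean_square M (\<lambda>\<omega>. norm (X (t\<^sub>g k) \<omega> - ?c)) \<le> (\<integral>\<omega>. (1 + \<epsilon>) * (norm (X (t\<^sub>g k) \<omega>))\<^sup>2 + D \<partial>M)"
      proof (rule integral_mono)
        fix \<omega>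
        show "(norm (X (t\<^sub>g k) \<omega> - ?c))\<^sup>2 \<le> (1 + \<epsilon>) * (norm (X (t\<^sub>g k) \<omega>))\<^sup>2 + D"
          using norm_sq_le_weighted[OF \<epsilon>, of "X (t\<^sub>g k) \<omega> - ?c" "X (t\<^sub>g k) \<omega>"] c by simp
      qed (use grid_square_integrable grid_shift_integrable in auto)
      also have "\<dots> = (1 + \<epsilon>) * A k + D" using grid_square_integrable by (simp add: A_def prob_space)
      finally show "mean_square M (\<lambda>\<omega>. norm (X (t\<^sub>g k) \<omega> - ?c)) \<le> (1 + \<epsilon>) * A k + D" .
    qed (use \<epsilon> in \<open>auto simp: q_def\<close>)
    also have "\<dots> = ((1 + \<epsilon>) * (q * (1 + \<epsilon>))) * A k + C" by (simp add: C_def algebra_simps)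
    finally show ?thesis unfolding qp .
  qed
  have A0: "0 \<le> A k" for k by (simp add: A_def)
  \<comment> \<open>Lies above both the initial value and the fixed point \<open>C / (1 - p)\<close>
    of the recursion, hence is preserved by it; the 1 makes it positive.\<close>
  define B where "B = A 0 + C / (1 - p) + 1"
  have "A k \<le> B" for k
  proof (induction k)
    case 0
    show ?case using C0 p by (simp add: B_def)
  next
    case (Suc k)
    have "A (Suc k) \<le> p * B + C" using step[of k] mult_left_mono[OF Suc, of p] p by linarith
    also have "\<dots> \<le> B"
    proof -
      have "C / (1 - p) \<le> B" using A0[of 0] by (simp add: B_def)
      then have "C \<le> B * (1 - p)" using p by (simp add: divide_simps)
      then show ?thesis by (simp add: algebra_simps)
    qed
    finally show ?case .
  qed
  moreover have "0 < B" using A0[of 0] C0 p by (simp add: B_def add_nonneg_pos)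
  ultimately show thesis unfolding A_def by (rule that[rotated])
qed

lemma weight_at_eq: "M\<^sub>L k = (\<integral>\<omega>. weight (X (t\<^sub>g k) \<omega>) \<partial>M)"
  by (simp add: weight_at_def weight_def)

text \<open>Chebyshev's inequality at radius \<open>r\<close> with \<open>r\<^sup>2 = 2 * B\<close>
  leaves at least half of the mass in the ball, where the weight is at least its value at a
  maximiser \<open>z\<close> of \<open>L\<close>. This gives the bound \<open>weight z / 2\<close>
  for every \<open>k\<close>.\<close>

lemma weight_inf_pos: "0 < weight_inf M \<beta> \<gamma> L X"
proof -
  obtain B where B: "0 < B" "\<And>k. mean_square M (\<lambda>\<omega>. norm (X (t\<^sub>g k) \<omega>)) \<le> B"
    by (rule grid_second_moment_bounded) blast
  define r where "r = sqrt (2 * B)"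
  have r: "0 < r" "r\<^sup>2 = 2 * B" using B by (auto simp: r_def)
  have "\<exists>z\<in>cball 0 r. \<forall>y\<in>cball 0 r. L y \<le> L z"
    using r by (intro continuous_attains_sup continuous_on_subset[OF L_continuous]) auto
  then obtain z where "\<forall>y\<in>cball 0 r. L y \<le> L z" by blast
  then have z: "L y \<le> L z" if "norm y \<le> r" for y using that by simp
  \<comment> \<open>Chebyshev's inequality in pointwise form: the left side is at most
    \<open>weight z\<close> inside the ball and nonpositive outside, so a single integration gives
    the bound.\<close>
  have pt: "weight z * (1 - (norm x)\<^sup>2 / r\<^sup>2) \<le> weight x" for x
  proof (cases "norm x \<le> r")
    case True
    have "weight z * (1 - (norm x)\<^sup>2 / r\<^sup>2) \<le> weight z * 1" by (intro mult_left_mono) (auto simp: less_imp_le weight_pos)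
    also have "\<dots> \<le> weight x" using z[OF True] \<beta>_pos by (simp add: weight_def)
    finally show ?thesis .
  next
    case False
    then have "r\<^sup>2 \<le> (norm x)\<^sup>2" using r by (intro power_mono) auto
    then have "1 - (norm x)\<^sup>2 / r\<^sup>2 \<le> 0" using r B(1) by simp
    then have "weight z * (1 - (norm x)\<^sup>2 / r\<^sup>2) \<le> 0" by (intro mult_nonneg_nonpos) (auto simp: less_imp_le weight_pos)
    also have "0 \<le> weight x" by (simp add: less_imp_le weight_pos)
    finally show ?thesis .
  qed
  have "weight z / 2 \<le> M\<^sub>L k" for k
  proof -
    have "weight z / 2 \<le> weight z * (1 - mean_square M (\<lambda>\<omega>. norm (X (t\<^sub>g k) \<omega>)) / r\<^sup>2)"
    proof -
      have "mean_square M (\<lambda>\<omega>. norm (X (t\<^sub>g k) \<omega>)) / r\<^sup>2 \<le> 1 / 2"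
        using B(2)[of k] B(1) r(2) by (simp add: divide_simps)
      then have "1 / 2 \<le> 1 - mean_square M (\<lambda>\<omega>. norm (X (t\<^sub>g k) \<omega>)) / r\<^sup>2" by linarith
      from mult_left_mono[OF this, of "weight z"] show ?thesis by (simp add: less_imp_le weight_pos)
    qed
    also have "\<dots> = (\<integral>\<omega>. weight z * (1 - (norm (X (t\<^sub>g k) \<omega>))\<^sup>2 / r\<^sup>2) \<partial>M)"
      using grid_square_integrable[of k] by (simp add: prob_space)
    also have "\<dots> \<le> M\<^sub>L k"
      unfolding weight_at_eq using grid_square_integrable[of k] weight_integrable
      by (intro integral_mono pt) auto
    finally show ?thesis .
  qed
  then have "weight z / 2 \<le> weight_inf M \<beta> \<gamma> L X"
    unfolding weight_inf_def by (intro cINF_greatest) auto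
  moreover have "0 < weight z / 2" by (simp add: weight_pos)
  ultimately show ?thesis by linarith
qed

lemma weight_inf_le: "weight_inf M \<beta> \<gamma> L X \<le> M\<^sub>L k"
  unfolding weight_inf_def
proof (rule cINF_lower)
  show "bdd_below (range M\<^sub>L)"
    unfolding weight_at_eq
    by (intro bdd_belowI2[of _ 0] Bochner_Integration.integral_nonneg less_imp_le weight_pos)
qed simp

lemma variance_nonneg: "0 \<le> V k"
  by (simp add: variance_at_def)

lemma grid_bias_variance: "mean_square M (\<lambda>\<omega>. norm (X (t\<^sub>g k) \<omega> - c)) = V k + (norm (m k - c))\<^sup>2"
  unfolding variance_at_def mean_at_def by (rule bias_variance[OF Xg_measurable grid_square_integrable])

lemma consensus_deviation:
  "(norm (m k - x\<^sub>c (Suc k)))\<^sup>2 \<le> weight_max / weight_inf M \<beta> \<gamma> L X * V k"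
proof -
  have 1: "(\<integral>x. weight x *\<^sub>R x \<partial>distr M borel (X (t\<^sub>g k))) = (\<integral>\<omega>. weight (X (t\<^sub>g k) \<omega>) *\<^sub>R X (t\<^sub>g k) \<omega> \<partial>M)"
    by (rule integral_distr) auto
  have 2: "(\<integral>x. weight x \<partial>distr M borel (X (t\<^sub>g k))) = (\<integral>\<omega>. weight (X (t\<^sub>g k) \<omega>) \<partial>M)"
    by (rule integral_distr) auto
  have c: "x\<^sub>c (Suc k) = (\<integral>\<omega>. weight (X (t\<^sub>g k) \<omega>) *\<^sub>R X (t\<^sub>g k) \<omega> \<partial>M) /\<^sub>R (\<integral>\<omega>. weight (X (t\<^sub>g k) \<omega>) \<partial>M)"
    unfolding consensus_point_def weighted_mean_def diff_Suc_1 weight_def[symmetric] 1 2 ..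
  have "(norm (m k - x\<^sub>c (Suc k)))\<^sup>2 = (norm (x\<^sub>c (Suc k) - m k))\<^sup>2" by (simp add: norm_minus_commute)
  also have "\<dots> \<le> weight_max / M\<^sub>L k * V k"
    unfolding c mean_at_def weight_at_eq variance_at_def
    by (rule weighted_mean_deviation(2)[OF Xg_measurable grid_square_integrable]) (auto simp: weight_le_max weight_pos)
  also have "\<dots> \<le> weight_max / weight_inf M \<beta> \<gamma> L X * V k"
    using weight_inf_pos weight_inf_le[of k] variance_nonneg[of k]
    by (intro mult_right_mono divide_left_mono mult_pos_pos) (auto simp: weight_max_def)
  finally show ?thesis .
qed

section \<open>Contraction of the variance and convergence along the grid\<close>

definition contraction :: real where
  "contraction = exp (\<kappa> * \<gamma>) + weight_max / weight_inf M \<beta> \<gamma> L X * (exp (\<kappa> * \<gamma>) - exp (- 2 * lam * \<gamma>))"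

lemma mean_step_grid: "m (Suc k) - x\<^sub>c (Suc k) = exp (- lam * \<gamma>) *\<^sub>R (m k - x\<^sub>c (Suc k))"
  using step_moments(2)[OF grid_square_integrable, of "t\<^sub>g (Suc k)" k] grid_less[of k] by (simp add: grid_Suc)

lemma exp_diff_nonneg: "0 \<le> exp (\<kappa> * \<gamma>) - exp (- 2 * lam * \<gamma>)"
proof -
  have "- 2 * lam * \<gamma> \<le> \<kappa> * \<gamma>" using \<gamma>_pos by (intro mult_right_mono) auto
  then show ?thesis by simp
qed

text \<open>Bias and variance are split about the same consensus point at both ends of the step. The
  bias decays exactly like \<open>exp (- 2 * lam * \<gamma>)\<close>, faster than the bound for the
  second moment, so a positive multiple of the old bias remains and is charged to the old variance
  by \<open>consensus_deviation\<close>.\<close>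

lemma variance_step: "V (Suc k) \<le> contraction * V k"
proof -
  let ?c = "x\<^sub>c (Suc k)"
  have "V (Suc k) = mean_square M (\<lambda>\<omega>. norm (X (t\<^sub>g (Suc k)) \<omega> - ?c)) - (norm (m (Suc k) - ?c))\<^sup>2"
    by (simp add: grid_bias_variance)
  also have "(norm (m (Suc k) - ?c))\<^sup>2 = exp (- 2 * lam * \<gamma>) * (norm (m k - ?c))\<^sup>2"
    unfolding mean_step_grid by (simp add: power_mult_distrib power2_eq_square flip: exp_add)
  also have "mean_square M (\<lambda>\<omega>. norm (X (t\<^sub>g (Suc k)) \<omega> - ?c)) \<le> exp (\<kappa> * \<gamma>) * (V k + (norm (m k - ?c))\<^sup>2)"
    using step_moments(3)[OF grid_square_integrable, of "t\<^sub>g (Suc k)" k] grid_less[of k]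
    by (simp add: grid_Suc grid_bias_variance)
  also have "exp (\<kappa> * \<gamma>) * (V k + (norm (m k - ?c))\<^sup>2) - exp (- 2 * lam * \<gamma>) * (norm (m k - ?c))\<^sup>2
      = exp (\<kappa> * \<gamma>) * V k + (exp (\<kappa> * \<gamma>) - exp (- 2 * lam * \<gamma>)) * (norm (m k - ?c))\<^sup>2"
    by (simp add: algebra_simps)
  also have "\<dots> \<le> exp (\<kappa> * \<gamma>) * V k
      + (exp (\<kappa> * \<gamma>) - exp (- 2 * lam * \<gamma>)) * (weight_max / weight_inf M \<beta> \<gamma> L X * V k)"
    by (intro add_left_mono mult_left_mono consensus_deviation exp_diff_nonneg)
  also have "\<dots> = contraction * V k" by (simp add: contraction_def algebra_simps)
  finally show ?thesis by simp
qed

lemma contraction_nonneg: "0 \<le> contraction"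
  unfolding contraction_def using weight_inf_pos exp_diff_nonneg
  by (intro add_nonneg_nonneg mult_nonneg_nonneg) (auto simp: weight_max_def)

lemma variance_geometric: "V k \<le> contraction ^ k * V 0"
proof (induction k)
  case (Suc k)
  have "V (Suc k) \<le> contraction * (contraction ^ k * V 0)"
    using variance_step[of k] mult_left_mono[OF Suc contraction_nonneg] by linarith
  then show ?case by (simp add: mult.assoc)
qed simp

lemma variance_tendsto:
  assumes "contraction < 1"
  shows "V \<longlonglongrightarrow> 0"
proof (rule tendsto_sandwich[where f="\<lambda>_. 0"])
  show "(\<lambda>k. contraction ^ k * V 0) \<longlonglongrightarrow> 0"
    using tendsto_mult_left_zero[OF LIMSEQ_realpow_zero[OF contraction_nonneg assms]] .
qed (use variance_nonneg variance_geometric in auto)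

lemma consensus_gap_tendsto:
  assumes "contraction < 1"
  shows "(\<lambda>k. m k - x\<^sub>c (Suc k)) \<longlonglongrightarrow> 0"
proof -
  let ?g = "weight_max / weight_inf M \<beta> \<gamma> L X"
  have "(\<lambda>k. ?g * V k) \<longlonglongrightarrow> ?g * 0" by (intro tendsto_intros variance_tendsto assms)
  then have "(\<lambda>k. sqrt (?g * V k)) \<longlonglongrightarrow> sqrt 0" by (intro tendsto_real_sqrt) simp
  then have "(\<lambda>k. sqrt (?g * V k)) \<longlonglongrightarrow> 0" by simp
  then show ?thesis
    by (rule Lim_null_comparison[rotated])
      (use consensus_deviation in \<open>auto intro!: always_eventually real_le_rsqrt\<close>)
qed

text \<open>The mean moves towards the consensus point by at most their distance, which is of the
  order of the standard deviation. The increments are therefore dominated by a geometric series of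
  ratio \<open>sqrt contraction\<close>.\<close>

lemma mean_convergent:
  assumes "contraction < 1"
  shows "convergent m"
proof -
  let ?g = "weight_max / weight_inf M \<beta> \<gamma> L X"
  have g: "0 \<le> ?g" using weight_inf_pos by (simp add: weight_max_def)
  have "summable (\<lambda>k. sqrt (?g * V 0) * sqrt contraction ^ k)"
    using contraction_nonneg assms by (intro summable_mult summable_geometric) auto
  then have "summable (\<lambda>k. norm (m (Suc k) - m k))"
  proof (rule summable_comparison_test'[where N=0])
    fix k
    have "m (Suc k) - m k = (exp (- lam * \<gamma>) - 1) *\<^sub>R (m k - x\<^sub>c (Suc k))"
      using mean_step_grid[of k] by (simp add: algebra_simps)
    then have "norm (m (Suc k) - m k) = \<bar>exp (- lam * \<gamma>) - 1\<bar> * norm (m k - x\<^sub>c (Suc k))" by simp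
    also have "\<dots> \<le> 1 * norm (m k - x\<^sub>c (Suc k))"
    proof (rule mult_right_mono)
      have "0 \<le> \<sigma>\<^sup>2" by simp
      then have "0 < lam" using stable by linarith
      then have "exp (- lam * \<gamma>) \<le> 1" using \<gamma>_pos by simp
      then show "\<bar>exp (- lam * \<gamma>) - 1\<bar> \<le> 1" using exp_gt_zero[of "- lam * \<gamma>"] by linarith
    qed simp
    also have "\<dots> \<le> sqrt (?g * V k)"
      using consensus_deviation[of k] by (simp add: real_le_rsqrt)
    also have "\<dots> \<le> sqrt (?g * (contraction ^ k * V 0))"
      using mult_left_mono[OF variance_geometric g] by (intro real_sqrt_le_mono)
    also have "\<dots> = sqrt (?g * V 0) * sqrt contraction ^ k"
    proof -
      have "?g * (contraction ^ k * V 0) = (?g * V 0) * contraction ^ k" by (simp only: mult_ac)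
      then show ?thesis by (simp only: real_sqrt_mult real_sqrt_power)
    qed
    finally show "norm (norm (m (Suc k) - m k)) \<le> sqrt (?g * V 0) * sqrt contraction ^ k" by simp
  qed
  then have "summable (\<lambda>k. m (Suc k) - m k)" by (rule summable_norm_cancel)
  then have "convergent (\<lambda>n. \<Sum>k<n. m (Suc k) - m k)" by (simp add: summable_iff_convergent)
  then have "convergent (\<lambda>n. m n - m 0)" using sum_lessThan_telescope[of "\<lambda>k. m k"] by simp
  then show ?thesis by (simp add: convergent_diff_const_right_iff)
qed

text \<open>Since \<open>\<kappa> < 0\<close>, the mean squared distance to the current consensus
  point does not exceed, inside an interval, its value at the left grid time. Convergence along the
  grid thus controls all times.\<close>

lemma distance_tendsto:
  assumes c: "contraction < 1" and mbar: "m \<longlonglongrightarrow> mbar"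
  shows "((\<lambda>t. \<integral>\<omega>. (norm (X t \<omega> - mbar))\<^sup>2 \<partial>M) \<longlongrightarrow> 0) at_top"
    "0 \<le> t \<Longrightarrow> square_integrable M (\<lambda>\<omega>. norm (X t \<omega> - mbar))"
proof -
  define G where "G k = 2 * (V k + (norm (m k - x\<^sub>c (Suc k)))\<^sup>2) + 2 * (norm (x\<^sub>c (Suc k) - mbar))\<^sup>2" for k
  have cm: "(\<lambda>k. x\<^sub>c (Suc k)) \<longlonglongrightarrow> mbar"
    using tendsto_diff[OF mbar consensus_gap_tendsto[OF c]] by simp
  have "G \<longlonglongrightarrow> 2 * (0 + (norm (0::real ^ 'b))\<^sup>2) + 2 * (norm (mbar - mbar))\<^sup>2"
    unfolding G_def[abs_def] by (intro tendsto_intros variance_tendsto[OF c] consensus_gap_tendsto[OF c] cm)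
  then have G: "G \<longlonglongrightarrow> 0" by simp
  \<comment> \<open>Index of a grid interval containing \<open>t\<close>; the consensus point in
    force there has index \<open>Suc (n t)\<close>.\<close>
  define n where "n t = nat \<lfloor>t / \<gamma>\<rfloor>" for t
  have nt: "t \<in> {t\<^sub>g (n t)..t\<^sub>g (Suc (n t))}" if "0 \<le> t" for t
  proof -
    have f: "0 \<le> \<lfloor>t / \<gamma>\<rfloor>" using that \<gamma>_pos by simp
    then have "real (n t) = of_int \<lfloor>t / \<gamma>\<rfloor>" by (simp add: n_def)
    then have "real (n t) \<le> t / \<gamma>" "t / \<gamma> \<le> real (n t) + 1" by linarith+
    then show ?thesis using \<gamma>_pos by (auto simp: grid_def field_simps)
  qed
  have i: "square_integrable M (\<lambda>\<omega>. norm (X t \<omega> - c))" if t: "0 \<le> t" for t c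
    using integrable_square_shift[OF X_measurable[OF t], of 0 c]
      step_moments(1)[OF grid_square_integrable nt[OF t]] by simp
  then show "0 \<le> t \<Longrightarrow> square_integrable M (\<lambda>\<omega>. norm (X t \<omega> - mbar))" .
  have le: "mean_square M (\<lambda>\<omega>. norm (X t \<omega> - mbar)) \<le> G (n t)" if t: "0 \<le> t" for t
  proof -
    let ?c = "x\<^sub>c (Suc (n t))"
    have "mean_square M (\<lambda>\<omega>. norm (X t \<omega> - mbar)) \<le> (\<integral>\<omega>. 2 * (norm (X t \<omega> - ?c))\<^sup>2 + 2 * (norm (?c - mbar))\<^sup>2 \<partial>M)"
    proof (rule integral_mono)
      fix \<omega>
      show "(norm (X t \<omega> - mbar))\<^sup>2 \<le> 2 * (norm (X t \<omega> - ?c))\<^sup>2 + 2 * (norm (?c - mbar))\<^sup>2"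
        using norm_add_sq_le[of "X t \<omega> - ?c" "?c - mbar"] by simp
    qed (use i[OF t] in auto)
    also have "\<dots> = 2 * mean_square M (\<lambda>\<omega>. norm (X t \<omega> - ?c)) + 2 * (norm (?c - mbar))\<^sup>2"
      using i[OF t] by (simp add: prob_space)
    also have "\<dots> \<le> 2 * (V (n t) + (norm (m (n t) - ?c))\<^sup>2) + 2 * (norm (?c - mbar))\<^sup>2"
    proof (intro add_right_mono mult_left_mono)
      have "\<kappa> * (t - t\<^sub>g (n t)) \<le> 0"
        using nt[OF t] stable by (intro mult_nonpos_nonneg) auto
      then have "exp (\<kappa> * (t - t\<^sub>g (n t))) \<le> 1" by simp
      then have "exp (\<kappa> * (t - t\<^sub>g (n t))) * mean_square M (\<lambda>\<omega>. norm (X (t\<^sub>g (n t)) \<omega> - ?c))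
          \<le> 1 * mean_square M (\<lambda>\<omega>. norm (X (t\<^sub>g (n t)) \<omega> - ?c))"
        by (intro mult_right_mono) auto
      with step_moments(3)[OF grid_square_integrable nt[OF t]]
      show "mean_square M (\<lambda>\<omega>. norm (X t \<omega> - ?c)) \<le> V (n t) + (norm (m (n t) - ?c))\<^sup>2"
        by (simp add: grid_bias_variance)
    qed simp
    finally show ?thesis by (simp add: G_def)
  qed
  have n_top: "filterlim n at_top at_top"
    unfolding filterlim_at_top
  proof
    fix K :: nat
    show "\<forall>\<^sub>F t in at_top. K \<le> n t"
      using eventually_ge_at_top[of "real K * \<gamma>"]
    proof eventually_elim
      case (elim t)
      then have "real K \<le> t / \<gamma>" using \<gamma>_pos by (simp add: field_simps)
      then show ?case unfolding n_def by (simp add: le_nat_iff le_floor_iff)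
    qed
  qed
  show "((\<lambda>t. \<integral>\<omega>. (norm (X t \<omega> - mbar))\<^sup>2 \<partial>M) \<longlongrightarrow> 0) at_top"
  proof (rule tendsto_sandwich[where f="\<lambda>_. 0"])
    show "((\<lambda>t. G (n t)) \<longlongrightarrow> 0) at_top" by (rule filterlim_compose[OF G n_top])
    show "\<forall>\<^sub>F t in at_top. mean_square M (\<lambda>\<omega>. norm (X t \<omega> - mbar)) \<le> G (n t)"
      using eventually_ge_at_top[of 0] by eventually_elim (rule le)
  qed auto
qed

text \<open>Near \<open>mbar\<close> continuity makes the deviation of \<open>\<phi>\<close> small;
  at distance \<open>d\<close> or more it is at most \<open>2 * N\<close>, hence at most
  \<open>2 * N\<close> times the squared distance over \<open>d\<^sup>2\<close>. Integrating this
  pointwise bound leaves only the mean squared distance.\<close>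

lemma bounded_continuous_tendsto:
  fixes \<phi> :: "(real ^ 'b) \<Rightarrow>\<^sub>C real"
  assumes c: "contraction < 1" and mbar: "m \<longlonglongrightarrow> mbar"
  shows "((\<lambda>t. \<integral>\<omega>. apply_bcontfun \<phi> (X t \<omega>) \<partial>M) \<longlongrightarrow> apply_bcontfun \<phi> mbar) at_top"
proof (rule tendstoI)
  fix e :: real assume e: "0 < e"
  let ?f = "apply_bcontfun \<phi>"
  have cont: "continuous_on UNIV ?f" using apply_bcontfun[of \<phi>] by (simp add: bcontfun_def)
  have fm: "?f \<in> borel_measurable borel" using cont by (rule borel_measurable_continuous_onI)
  define N where "N = norm \<phi>"
  have N: "\<bar>?f x\<bar> \<le> N" for x using norm_bounded[of \<phi> x] by (simp add: N_def)
  obtain d where d: "0 < d" "\<And>x. dist x mbar < d \<Longrightarrow> dist (?f x) (?f mbar) < e / 2"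
    using cont e unfolding continuous_on_iff by (meson UNIV_I half_gt_zero)
  have pt: "\<bar>?f x - ?f mbar\<bar> \<le> e / 2 + 2 * N / d\<^sup>2 * (norm (x - mbar))\<^sup>2" for x
  proof (cases "norm (x - mbar) < d")
    case True
    then have "\<bar>?f x - ?f mbar\<bar> \<le> e / 2" using d(2)[of x] by (simp add: dist_norm)
    moreover have "0 \<le> 2 * N / d\<^sup>2 * (norm (x - mbar))\<^sup>2" by (simp add: N_def)
    ultimately show ?thesis by linarith
  next
    case False
    then have "1 \<le> (norm (x - mbar))\<^sup>2 / d\<^sup>2" using d(1) by (simp add: power_mono)
    then have "2 * N * 1 \<le> 2 * N * ((norm (x - mbar))\<^sup>2 / d\<^sup>2)" by (intro mult_left_mono) (auto simp: N_def)
    moreover have "\<bar>?f x - ?f mbar\<bar> \<le> 2 * N" using N[of x] N[of mbar] by linarith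
    ultimately show ?thesis using e by simp
  qed
  have "((\<lambda>t. e / 2 + 2 * N / d\<^sup>2 * mean_square M (\<lambda>\<omega>. norm (X t \<omega> - mbar))) \<longlongrightarrow> e / 2 + 2 * N / d\<^sup>2 * 0) at_top"
    by (intro tendsto_intros distance_tendsto(1)[OF c mbar])
  then have "\<forall>\<^sub>F t in at_top. e / 2 + 2 * N / d\<^sup>2 * mean_square M (\<lambda>\<omega>. norm (X t \<omega> - mbar)) < e"
    by (rule order_tendstoD(2)) (use e in simp)
  then show "\<forall>\<^sub>F t in at_top. dist (\<integral>\<omega>. ?f (X t \<omega>) \<partial>M) (?f mbar) < e"
    using eventually_ge_at_top[of 0]
  proof eventually_elim
    case (elim t)
    have iphi: "integrable M (\<lambda>\<omega>. ?f (X t \<omega>))"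
      by (rule integrable_const_bound[of _ N]) (use N measurable_compose[OF X_measurable[OF elim(2)] fm] in auto)
    have "\<bar>(\<integral>\<omega>. ?f (X t \<omega>) \<partial>M) - ?f mbar\<bar> = \<bar>\<integral>\<omega>. ?f (X t \<omega>) - ?f mbar \<partial>M\<bar>"
      using iphi by (simp add: prob_space)
    also have "\<dots> \<le> (\<integral>\<omega>. \<bar>?f (X t \<omega>) - ?f mbar\<bar> \<partial>M)" by (rule integral_abs_bound)
    also have "\<dots> \<le> (\<integral>\<omega>. e / 2 + 2 * N / d\<^sup>2 * (norm (X t \<omega> - mbar))\<^sup>2 \<partial>M)"
      using iphi distance_tendsto(2)[OF c mbar elim(2)] by (intro integral_mono pt) auto
    also have "\<dots> = e / 2 + 2 * N / d\<^sup>2 * mean_square M (\<lambda>\<omega>. norm (X t \<omega> - mbar))"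
      using distance_tendsto(2)[OF c mbar elim(2)] by (simp add: prob_space)
    also have "\<dots> < e" by (rule elim)
    finally show ?case by (simp add: dist_real_def)
  qed
qed

end

theorem proposition3p1:
  fixes M :: "'a measure"
    and F :: "real \<Rightarrow> 'a measure"
    and W :: "'d::finite \<Rightarrow> real \<Rightarrow> 'a \<Rightarrow> real"
    and X :: "real \<Rightarrow> 'a \<Rightarrow> real ^ 'd"
    and L :: "real ^ 'd \<Rightarrow> real"
    and \<beta> lam \<sigma> \<gamma> :: real
  assumes "prob_space M"
    and "continuous_on UNIV L"
    and "\<exists>!x. \<forall>y. L x \<le> L y"
    and "(INF x. L x) > 0"
    and "\<beta> > 0" "lam > 0" "\<sigma> > 0" "\<gamma> > 0"
    and "\<And>i. standard_brownian_motion M (W i)"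
    and "prob_space.indep_vars M (\<lambda>_. Pi\<^sub>M {0..} (\<lambda>_. borel))
           (\<lambda>i \<omega>. \<lambda>t\<in>{0..}. W i t \<omega>) UNIV"
    and "prob_space.indep_set M
           (sets (vimage_algebra (space M) (X 0) borel))
           (sets (vimage_algebra (space M) (\<lambda>\<omega>. \<lambda>(i, t)\<in>UNIV \<times> {0..}. W i t \<omega>)
              (Pi\<^sub>M (UNIV \<times> {0..}) (\<lambda>_. borel))))"
    and "brownian_filtration M F W"
    and "integrable M (\<lambda>\<omega>. (norm (X 0 \<omega>))\<^sup>2)"
    and "semi_discrete_solution M F W \<beta> lam \<sigma> \<gamma> L X"
    and "bounded (consensus_point M \<beta> \<gamma> L X ` {1..})"
    and "2 * lam > \<sigma>\<^sup>2"
  shows "weight_inf M \<beta> \<gamma> L X > 0 \<and>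
    (exp ((- 2 * lam + \<sigma>\<^sup>2) * \<gamma>)
       + exp (- \<beta> * (INF x. L x)) / weight_inf M \<beta> \<gamma> L X
           * (exp ((- 2 * lam + \<sigma>\<^sup>2) * \<gamma>) - exp (- 2 * lam * \<gamma>)) < 1
     \<longrightarrow>
     (\<exists>m :: real ^ 'd.
        (\<lambda>k. mean_at M X (grid \<gamma> k)) \<longlonglongrightarrow> m \<and>
        (\<lambda>k. variance_at M X (grid \<gamma> k)) \<longlonglongrightarrow> 0 \<and>
        consensus_point M \<beta> \<gamma> L X \<longlonglongrightarrow> m \<and>
        (\<forall>\<phi> :: (real ^ 'd) \<Rightarrow>\<^sub>C real.
           ((\<lambda>t. \<integral>\<omega>. apply_bcontfun \<phi> (X t \<omega>) \<partial>M) \<longlongrightarrow> apply_bcontfun \<phi> m) at_top)))"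
proof -
  interpret P: prob_space M by fact
  interpret S: stable_semi_discrete M F W \<beta> lam \<sigma> \<gamma> L X
    by unfold_locales (use assms in auto)
  show ?thesis
  proof (intro conjI impI)
    show "0 < weight_inf M \<beta> \<gamma> L X" by (rule S.weight_inf_pos)
    assume "exp ((- 2 * lam + \<sigma>\<^sup>2) * \<gamma>)
       + exp (- \<beta> * (INF x. L x)) / weight_inf M \<beta> \<gamma> L X
           * (exp ((- 2 * lam + \<sigma>\<^sup>2) * \<gamma>) - exp (- 2 * lam * \<gamma>)) < 1"
    then have c: "S.contraction < 1" by (simp add: S.contraction_def S.weight_max_def)
    obtain m where m: "(\<lambda>k. mean_at M X (grid \<gamma> k)) \<longlonglongrightarrow> m"
      using S.mean_convergent[OF c] by (auto simp: convergent_def)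
    \<comment> \<open>The gap compares the mean at grid time \<open>k\<close> with the consensus
      point of index \<open>Suc k\<close>, which is computed from the same law; the shift of the
      index does not affect the limit.\<close>
    have "(\<lambda>k. consensus_point M \<beta> \<gamma> L X (Suc k)) \<longlonglongrightarrow> m"
      using tendsto_diff[OF m S.consensus_gap_tendsto[OF c]] by simp
    then have "consensus_point M \<beta> \<gamma> L X \<longlonglongrightarrow> m" by (simp add: filterlim_sequentially_Suc)
    with m S.variance_tendsto[OF c] S.bounded_continuous_tendsto[OF c m]
    show "\<exists>m. (\<lambda>k. mean_at M X (grid \<gamma> k)) \<longlonglongrightarrow> m \<and> (\<lambda>k. variance_at M X (grid \<gamma> k)) \<longlonglongrightarrow> 0 \<and>
        consensus_point M \<beta> \<gamma> L X \<longlonglongrightarrow> m \<and>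
        (\<forall>\<phi> :: (real ^ 'd) \<Rightarrow>\<^sub>C real.
           ((\<lambda>t. \<integral>\<omega>. apply_bcontfun \<phi> (X t \<omega>) \<partial>M) \<longlongrightarrow> apply_bcontfun \<phi> m) at_top)"
      by blast
  qed
qed

end
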